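(* Consider the analytic differential system $$\dot x=Ax+f(x),\qquad x\in(\mathbb C^n,0),\qquad(\ast)$$ where $A\in M_n(\mathbb C)$ is in lower triangular Jordan normal form and $f(x)=O(|x|^2)$ is a vector-valued analytic function in $(\mathbb C^n,0)$. Let $\lambda=(\lambda_1,\ldots,\lambda_n)$ be the $n$-tuple of eigenvalues of $A$. Assume that $n\ge2$ and $\lambda\ne0$, i.e. $A$ has at least one eigenvalue not equal to zero. Then system $(\ast)$ has $n-1$ functionally independent analytic first integrals in $(\mathbb C^n,0)$ if and only if the rank of the resonant set $\mathcal R_\lambda$ is $r_\lambda=n-1$, and system $(\ast)$ is analytically equivalent to its distinguished normal form $$\dot y_i=\lambda_iy_i(1+g(y)),\qquad i=1,\ldots,n,$$ by an analytic normalization tangent to the identity, where $g(y)$, without constant term, is an analytic function of $y^m$ with $m=(m_1,\ldots,m_n)\in\mathcal R_\lambda$ and $(m_1,\ldots,m_n)=1$, i.e. $m_1,\ldots,m_n$ have no common factor.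
   Context: $(\mathbb C^n,0)$ denotes a neighborhood of $0$ in $\mathbb C^n$; $M_n(\mathbb C)$ is the set of $n\times n$ complex matrices; $\mathbb Z_+$ is the set of nonnegative integers; $|m|=m_1+\cdots+m_n$, $y^m=y_1^{m_1}\cdots y_n^{m_n}$, $\langle m,\lambda\rangle=\sum_i m_i\lambda_i$; $e_j$ is the $j$th unit vector. An analytic first integral of $(\ast)$ is a nonconstant analytic function $H$ in $(\mathbb C^n,0)$ with $\langle\nabla H(x),Ax+f(x)\rangle=0$ in $(\mathbb C^n,0)$. First integrals are functionally independent if their gradients are linearly independent on an open dense subset of $(\mathbb C^n,0)$. The resonant set is $\mathcal R_\lambda=\{m\in\mathbb Z_+^n:\ \langle m,\lambda\rangle=0,\ |m|\ge2\}$, and $r_\lambda$ is the rank of the vectors in $\mathcal R_\lambda$. System $(\ast)$ is in normal form if $A$ is in Jordan normal form and the Taylor series of $f$ consists only of resonant monomials, where a monomial $x^me_j$ in the $j$th component of $f$ is resonant if $\lambda_j=\langle m,\lambda\rangle$, $m\in\mathbb Z_+^n$, $|m|\ge2$. A system $\dot y=Ay+h(y)$, with $h$ containing only higher order terms, is a normal form of $(\ast)$ if it is in normal form and there is a change of variables tangent to the identity $y=\Psi(x)$, called a normalization, transforming $(\ast)$ to it. If the transformation contains only nonresonant terms, the normalization is called distinguished and the corresponding normal form is called a distinguished normal form; here a monomial $x^me_j$ in the transformation is nonresonant if $\langle m,\lambda\rangle\ne0$.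
   Formalization: The printed claim fails as worded; here x^m e_j is nonresonant if ⟨m,λ⟩≠λ_j (not ≠0), "distinguished" is imposed on the inverse transformation x=Φ(y) of y=Ψ(x), and g may also depend on y_i when λ_i=0. *)

theory Defs
  imports
    "Jordan_Normal_Form.Jordan_Normal_Form"
    "HOL-Analysis.Analysis"
    "HOL-Library.Landau_Symbols"
begin

no_notation vec_index (infixl "$" 100)

text \<open>
  A germ at the origin is represented by a total function of which only the values near \<open>0\<close>
  matter; identities between germs are stated with \<open>\<forall>\<^sub>F x in nhds 0\<close>. Multi-indices are elements
  of \<open>nat ^ 'n\<close>. The index type is linearly ordered because Jordan normal forms need an order on
  the coordinates.
\<close>

definition mdeg :: "nat ^ 'n \<Rightarrow> nat" where
  "mdeg m = (\<Sum>i\<in>UNIV. m $ i)"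

definition mpow :: "complex ^ 'n \<Rightarrow> nat ^ 'n \<Rightarrow> complex" where
  "mpow x m = (\<Prod>i\<in>UNIV. x $ i ^ (m $ i))"

definition mpair :: "nat ^ 'n \<Rightarrow> complex ^ 'n \<Rightarrow> complex" where
  "mpair m lam = (\<Sum>i\<in>UNIV. of_nat (m $ i) * lam $ i)"


subsection \<open>Analytic germs\<close>

definition has_taylor :: "(complex ^ 'n \<Rightarrow> complex) \<Rightarrow> (nat ^ 'n \<Rightarrow> complex) \<Rightarrow> bool" where
  "has_taylor f c \<longleftrightarrow> (\<forall>\<^sub>F x in nhds 0. ((\<lambda>m. c m * mpow x m) has_sum f x) UNIV)"

definition analytic0 :: "(complex ^ 'n \<Rightarrow> complex) \<Rightarrow> bool" where
  "analytic0 f \<longleftrightarrow> (\<exists>c. has_taylor f c)"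

definition analytic0_map :: "(complex ^ 'n \<Rightarrow> complex ^ 'n) \<Rightarrow> bool" where
  "analytic0_map f \<longleftrightarrow> (\<forall>j. analytic0 (\<lambda>x. f x $ j))"

text \<open>
  A function of finitely many complex variables \<open>z i\<close>, \<open>i \<in> I\<close>, given by a convergent power
  series near the origin of \<open>\<complex>\<^sup>I\<close>; its multi-indices are the extensional functions \<open>I \<rightarrow>\<^sub>E UNIV\<close>.
\<close>

definition analytic0_vars :: "'i set \<Rightarrow> (('i \<Rightarrow> complex) \<Rightarrow> complex) \<Rightarrow> bool" where
  "analytic0_vars I G \<longleftrightarrow> finite I \<and>
     (\<exists>c r. r > 0 \<and> (\<forall>z. (\<forall>i\<in>I. norm (z i) < r) \<longrightarrow>
        ((\<lambda>a. c a * (\<Prod>i\<in>I. z i ^ a i)) has_sum G z) (I \<rightarrow>\<^sub>E (UNIV :: nat set))))"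

text \<open>
  \<open>P\<close> may be infinite, as in \<open>lam = (1, 1, -1)\<close>; an analytic function of the monomials with
  exponents in \<open>P\<close> is an analytic function of finitely many of them.
\<close>

definition analytic_function_of_monomials ::
    "(nat ^ 'n) set \<Rightarrow> (complex ^ 'n \<Rightarrow> complex) \<Rightarrow> bool" where
  "analytic_function_of_monomials P g \<longleftrightarrow>
     (\<exists>M G. M \<subseteq> P \<and> analytic0_vars M G \<and> (\<forall>\<^sub>F y in nhds 0. g y = G (mpow y)))"

definition higher_order :: "(complex ^ 'n \<Rightarrow> complex ^ 'n) \<Rightarrow> bool" where
  "higher_order f \<longleftrightarrow> (\<lambda>x. norm (f x)) \<in> O[nhds 0](\<lambda>x. norm x ^ 2)"


subsection \<open>First integrals\<close>

definition cgrad :: "(complex ^ 'n \<Rightarrow> complex) \<Rightarrow> complex ^ 'n \<Rightarrow> complex ^ 'n" where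
  "cgrad H x = (\<chi> i. deriv (\<lambda>t. H (x + axis i t)) 0)"

text \<open>\<open>deriv_along H x v\<close> is the bilinear (unconjugated) pairing of the gradient with \<open>v\<close>.\<close>

definition deriv_along :: "(complex ^ 'n \<Rightarrow> complex) \<Rightarrow> complex ^ 'n \<Rightarrow> complex ^ 'n \<Rightarrow> complex" where
  "deriv_along H x v = (\<Sum>i\<in>UNIV. cgrad H x $ i * v $ i)"

definition analytic_first_integral ::
    "complex ^ 'n ^ 'n \<Rightarrow> (complex ^ 'n \<Rightarrow> complex ^ 'n) \<Rightarrow> (complex ^ 'n \<Rightarrow> complex) \<Rightarrow> bool" where
  "analytic_first_integral A f H \<longleftrightarrow>
     analytic0 H \<and> \<not> (\<exists>k. \<forall>\<^sub>F x in nhds 0. H x = k) \<and>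
     (\<forall>\<^sub>F x in nhds 0. deriv_along H x (A *v x + f x) = 0)"

definition functionally_independent :: "nat \<Rightarrow> (nat \<Rightarrow> complex ^ 'n \<Rightarrow> complex) \<Rightarrow> bool" where
  "functionally_independent k H \<longleftrightarrow>
     (\<exists>U D. open U \<and> 0 \<in> U \<and> open D \<and> D \<subseteq> U \<and> U \<subseteq> closure D \<and>
        (\<forall>x\<in>D. inj_on (\<lambda>i. cgrad (H i) x) {..<k} \<and>
                vec.independent ((\<lambda>i. cgrad (H i) x) ` {..<k})))"


subsection \<open>Resonances\<close>

definition resonant_set :: "complex ^ 'n \<Rightarrow> (nat ^ 'n) set" where
  "resonant_set lam = {m. mpair m lam = 0 \<and> mdeg m \<ge> 2}"

definition resonant_rank :: "complex ^ 'n \<Rightarrow> nat" where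
  "resonant_rank lam = dim ((\<lambda>m. (\<chi> i. real (m $ i)) :: real ^ 'n) ` resonant_set lam)"

definition resonant_monomial :: "complex ^ 'n \<Rightarrow> nat ^ 'n \<Rightarrow> 'n \<Rightarrow> bool" where
  "resonant_monomial lam m j \<longleftrightarrow> mdeg m \<ge> 2 \<and> lam $ j = mpair m lam"

text \<open>
  The exponents of the basic monomials on which \<open>g\<close> depends. If \<open>lam $ i = 0\<close>, the coordinate
  function \<open>y\<^sub>i\<close> is itself an invariant monomial with coprime exponents, but it is not in
  \<open>resonant_set lam\<close> because of \<open>mdeg m \<ge> 2\<close>. It has to be admitted: the system
  \<open>x\<^sub>1' = 0, x\<^sub>2' = x\<^sub>2 (1 + x\<^sub>1)\<close> is integrable and in normal form with \<open>g = y\<^sub>1\<close>, but it is not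
  linearizable. If no \<open>lam $ i\<close> vanishes the second set is empty.
\<close>

definition basic_exponents :: "complex ^ 'n \<Rightarrow> (nat ^ 'n) set" where
  "basic_exponents lam =
     {m \<in> resonant_set lam \<union> {axis i 1 | i. lam $ i = 0}. Gcd (range (($) m)) = 1}"


subsection \<open>Normal forms\<close>

text \<open>
  Jordan matrices are upper triangular in the library, hence the transposition; \<open>card {..<i}\<close> is
  the position of \<open>i\<close> in the order of the index type.
\<close>

definition lower_jordan :: "complex ^ 'n::{finite,wellorder} ^ 'n::{finite,wellorder} \<Rightarrow> bool" where
  "lower_jordan A \<longleftrightarrow>
     (\<exists>n_as. sum_list (map fst n_as) = CARD('n) \<and>
        (\<forall>i j. A $ i $ j =
           transpose_mat (jordan_matrix n_as) $$ (card {..<i}, card {..<j})))"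

text \<open>For a triangular matrix the diagonal is the tuple of eigenvalues, in the order in which they
  belong to the coordinates.\<close>

definition eigenvalue_tuple :: "complex ^ 'n ^ 'n \<Rightarrow> complex ^ 'n" where
  "eigenvalue_tuple A = (\<chi> i. A $ i $ i)"

definition in_normal_form ::
    "complex ^ 'n::{finite,wellorder} ^ 'n::{finite,wellorder} \<Rightarrow>
     (complex ^ 'n::{finite,wellorder} \<Rightarrow> complex ^ 'n::{finite,wellorder}) \<Rightarrow> bool" where
  "in_normal_form A h \<longleftrightarrow> lower_jordan A \<and>
     (\<forall>j. \<exists>c. has_taylor (\<lambda>y. h y $ j) c \<and>
        (\<forall>m. c m \<noteq> 0 \<longrightarrow> resonant_monomial (eigenvalue_tuple A) m j))"

text \<open>
  \<open>y = \<Psi>(x)\<close> is an analytic change of variables, tangent to the identity, which transforms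
  \<open>x' = A x + f(x)\<close> into the normal form \<open>y' = A y + h(y)\<close>.
\<close>

definition analytic_normalization ::
    "complex ^ 'n::{finite,wellorder} ^ 'n::{finite,wellorder} \<Rightarrow>
     (complex ^ 'n::{finite,wellorder} \<Rightarrow> complex ^ 'n::{finite,wellorder}) \<Rightarrow>
     (complex ^ 'n::{finite,wellorder} \<Rightarrow> complex ^ 'n::{finite,wellorder}) \<Rightarrow>
     (complex ^ 'n::{finite,wellorder} \<Rightarrow> complex ^ 'n::{finite,wellorder}) \<Rightarrow> bool" where
  "analytic_normalization A f h \<Psi> \<longleftrightarrow>
     analytic0_map h \<and> higher_order h \<and> in_normal_form A h \<and>
     analytic0_map \<Psi> \<and> higher_order (\<lambda>x. \<Psi> x - x) \<and>
     (\<forall>\<^sub>F x in nhds 0. \<forall>i.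
        deriv_along (\<lambda>x. \<Psi> x $ i) x (A *v x + f x) = (A *v \<Psi> x + h (\<Psi> x)) $ i)"

text \<open>
  The transformation is written as \<open>x = \<Phi>(y) = y + \<phi>(y)\<close>, with \<open>\<Phi>\<close> the inverse of \<open>\<Psi>\<close>, and is
  distinguished if \<open>\<phi>\<close> contains no resonant monomial \<open>y\<^sup>m e\<^sub>j\<close>, i.e. none with
  \<open>lam $ j = mpair m lam\<close>. The condition is put on \<open>\<Phi>\<close>, not on \<open>\<Psi>\<close>: a formal normalization whose
  \<open>\<Psi>\<close> contains no resonant monomials can diverge for an integrable analytic system.
\<close>

definition distinguished_normalization ::
    "complex ^ 'n::{finite,wellorder} ^ 'n::{finite,wellorder} \<Rightarrow>
     (complex ^ 'n::{finite,wellorder} \<Rightarrow> complex ^ 'n::{finite,wellorder}) \<Rightarrow>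
     (complex ^ 'n::{finite,wellorder} \<Rightarrow> complex ^ 'n::{finite,wellorder}) \<Rightarrow>
     (complex ^ 'n::{finite,wellorder} \<Rightarrow> complex ^ 'n::{finite,wellorder}) \<Rightarrow> bool" where
  "distinguished_normalization A f h \<Psi> \<longleftrightarrow>
     analytic_normalization A f h \<Psi> \<and>
     (\<exists>\<Phi>. (\<forall>\<^sub>F x in nhds 0. \<Phi> (\<Psi> x) = x) \<and> (\<forall>\<^sub>F y in nhds 0. \<Psi> (\<Phi> y) = y) \<and>
        (\<forall>j. \<exists>c. has_taylor (\<lambda>y. \<Phi> y $ j - y $ j) c \<and>
           (\<forall>m. c m \<noteq> 0 \<longrightarrow>
              mdeg m \<ge> 2 \<and> \<not> resonant_monomial (eigenvalue_tuple A) m j)))"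

end

theory Submission
  imports Defs "HOL-Complex_Analysis.Cauchy_Integral_Formula"
begin

text \<open>
  Let \<open>S\<close> be the diagonal linear field with eigenvalues \<open>lam\<close> and write \<open>\<Phi> = id + \<phi>\<close>, with \<open>\<phi>\<close>
  nonresonant, for the formal distinguished normalization. Integrals of a formal normal form contain
  only monomials \<open>y\<^sup>m\<close> with \<open>\<langle>m, lam\<rangle> = 0\<close>, hence are also killed by \<open>S\<close>. Two fields killed by \<open>n - 1\<close>
  independent integrals are parallel; so the normal form is \<open>(1 + g) S\<close>, and every diagonal linear
  field orthogonal to the resonances is a multiple of \<open>S\<close>, which gives the rank. Full rank makes the
  eigenvalues commensurable, so there are no small divisors, and since \<open>\<phi>\<close> is differentiated only
  along \<open>S\<close>, the conjugacy equation \<open>D\<Phi> (1 + g) S = X \<circ> \<Phi>\<close> loses no derivatives in the unknown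
  \<open>D\<phi> S - S \<phi>\<close>: a majorant argument shows that \<open>\<phi>\<close> and \<open>g\<close> converge. Conversely, \<open>n - 1\<close>
  independent resonant monomials, pulled back by the normalization, are the integrals.
\<close>

text \<open>\<open>A\<close> is not assumed diagonalizable. Its nilpotent part is kept in the
  unknown \<open>h\<close> beside the nonlinear terms, and only parallelism removes it:
  \<open>h j = diagf lam j * g\<close> with \<open>coef g 0 = 0\<close> has no linear terms. Fields
  are compared in the ring of formal power series. It is an integral domain, so a nonzero
  determinant can be cancelled without fractions, and convergence is not yet at issue. There are
  only n - 1 integrals; a constant row, a unit vector, completes their gradients to a square matrix.
  In the conjugacy equation the derivative of \<open>\<phi> j\<close> along \<open>S\<close> has at
  \<open>m\<close> the coefficient of \<open>D\<phi> S - S \<phi>\<close> times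
  \<open>mpair m lam / (mpair m lam - lam $ j)\<close>. The norm of this ratio is at most
  \<open>1 + norm (lam $ j) / \<delta>\<close>, where \<open>\<delta>\<close> bounds the nonzero
  divisors from below: this is why no derivative is lost. Nonresonance is demanded of the inverse
  \<open>\<Phi>\<close> of the normalization, so the formal theory works with \<open>\<Phi>\<close>,
  and \<open>\<Psi>\<close> arises by inversion after convergence is known.\<close>

declare One_nat_def [simp del]

no_notation Infinite_Set_Sum.abs_summable_on (infix "abs'_summable'_on" 50)

section \<open>Multi-indices and their pairing with the eigenvalues\<close>

lemma mdeg_add: "mdeg (a + b) = mdeg a + mdeg b"
  by (simp add: mdeg_def sum.distrib)

lemma mdeg_0 [simp]: "mdeg 0 = 0"
  by (simp add: mdeg_def)

lemma mdeg_axis [simp]: "mdeg (axis i k) = k"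
  by (simp add: mdeg_def axis_def)

lemma mdeg_eq_0_iff: "mdeg m = 0 \<longleftrightarrow> m = 0"
  by (auto simp: mdeg_def vec_eq_iff)

lemma nth_le_mdeg: "m $ i \<le> mdeg m"
  unfolding mdeg_def by (rule member_le_sum) auto

text \<open>The source of all finiteness in the formal theory: Cauchy products and the coefficients
  of a substitution are sums over exponents of bounded degree.\<close>

lemma finite_mdeg_le: "finite {m :: nat ^ 'n. mdeg m \<le> k}"
proof -
  have "{m :: nat ^ 'n. mdeg m \<le> k} \<subseteq> (\<lambda>f. \<chi> i. f i) ` (UNIV \<rightarrow>\<^sub>E {..k})"
  proof
    fix m :: "nat ^ 'n" assume "m \<in> {m. mdeg m \<le> k}"
    hence "\<And>i. m $ i \<le> k" using nth_le_mdeg order_trans by blast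
    thus "m \<in> (\<lambda>f. \<chi> i. f i) ` (UNIV \<rightarrow>\<^sub>E {..k})"
      by (intro image_eqI[where x = "($) m"]) auto
  qed
  thus ?thesis by (rule finite_subset) (intro finite_imageI finite_PiE, auto)
qed

lemma mdeg_pos_split:
  assumes "mdeg m = Suc k" obtains i m' where "m = m' + axis i 1" "mdeg m' = k"
proof -
  have "m \<noteq> 0" using assms by auto
  then obtain i where i: "m $ i \<noteq> 0" by (auto simp: vec_eq_iff)
  define m' where "m' = (\<chi> j. if j = i then m $ i - 1 else m $ j)"
  have "m = m' + axis i 1" using i by (auto simp: vec_eq_iff m'_def axis_def)
  thus ?thesis using that[of m' i] assms by (auto simp: mdeg_add)
qed

lemma mdeg_1_axis: assumes "mdeg m = 1" obtains i where "m = axis i 1"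
  using mdeg_pos_split[of m 0] assms by (auto simp: mdeg_eq_0_iff)

lemma nat_vec_le_add:
  fixes a m :: "nat ^ 'n"
  assumes "\<And>i. a $ i \<le> m $ i" obtains b where "m = a + b"
  using assms by (intro that[of "\<chi> i. m $ i - a $ i"]) (auto simp: vec_eq_iff)

lemma mpair_add: "mpair (a + b) lam = mpair a lam + mpair b lam"
  by (simp add: mpair_def sum.distrib algebra_simps)

lemma mpair_axis [simp]: "mpair (axis i k) lam = of_nat k * lam $ i"
proof -
  have "mpair (axis i k) lam = (\<Sum>j\<in>UNIV. if j = i then of_nat k * lam $ i else 0)"
    unfolding mpair_def by (intro sum.cong) (auto simp: axis_def)
  thus ?thesis by simp
qed

lemma mpair_0 [simp]: "mpair 0 lam = 0"
  by (simp add: mpair_def)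

subsection \<open>Formal power series in several variables\<close>

text \<open>A separate type rather than the coefficient functions themselves, so that the Cauchy
  product becomes the ring multiplication and determinants over power series are instances of the
  general ones.\<close>

typedef 'n mps = "UNIV :: (nat ^ 'n::finite \<Rightarrow> complex) set" morphisms coef Mps by simp

lemma coef_Mps [simp]: "coef (Mps c) = c" by (simp add: Mps_inverse)

lemma mps_eqI: "(\<And>m. coef F m = coef G m) \<Longrightarrow> F = G"
  by (metis coef_inverse ext)

definition splits :: "nat ^ 'n \<Rightarrow> ((nat ^ 'n) \<times> (nat ^ 'n)) set" where
  "splits m = {(a, b). a + b = m}"

lemma mem_splits [simp]: "(a, b) \<in> splits m \<longleftrightarrow> a + b = m"
  by (simp add: splits_def)

lemma finite_splits [simp]: "finite (splits m)"
proof -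
  have "splits m \<subseteq> {a. mdeg a \<le> mdeg m} \<times> {a. mdeg a \<le> mdeg m}"
    by (auto simp: mdeg_add)
  thus ?thesis by (rule finite_subset) (simp add: finite_mdeg_le)
qed

lemma sum_splits_single:
  fixes h :: "nat ^ 'n::finite \<Rightarrow> nat ^ 'n \<Rightarrow> 'b::comm_monoid_add"
  assumes "u + v = m" "\<And>a b. a + b = m \<Longrightarrow> a \<noteq> u \<Longrightarrow> h a b = 0"
  shows "(\<Sum>(a, b)\<in>splits m. h a b) = h u v"
proof -
  have "(\<Sum>(a, b)\<in>splits m. h a b) = (\<Sum>(a, b)\<in>{(u, v)}. h a b)"
  proof (intro sum.mono_neutral_right ballI)
    fix p assume p: "p \<in> splits m - {(u, v)}"
    obtain a b where ab: "p = (a, b)" by force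
    have "a \<noteq> u" using p ab assms(1) by auto
    thus "(case p of (a, b) \<Rightarrow> h a b) = 0" using p ab assms(2)[of a b] by auto
  qed (use assms in auto)
  thus ?thesis by simp
qed

instantiation mps :: (finite) comm_ring_1
begin
definition "0 = Mps (\<lambda>_. 0)"
definition "1 = Mps (\<lambda>m. if m = 0 then 1 else 0)"
definition "F + G = Mps (\<lambda>m. coef F m + coef G m)"
definition "F - G = Mps (\<lambda>m. coef F m - coef G m)"
definition "- F = Mps (\<lambda>m. - coef F m)"
definition "F * G = Mps (\<lambda>m. \<Sum>(a, b)\<in>splits m. coef F a * coef G b)"
instance
proof
  fix F G H :: "'a mps"
  show "F * G * H = F * (G * H)"
  proof (rule mps_eqI)
    fix m
    have "coef (F * G * H) m = (\<Sum>(x, c)\<in>splits m. \<Sum>(a, b)\<in>splits x. coef F a * coef G b * coef H c)"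
      by (simp add: times_mps_def sum_distrib_right case_prod_unfold)
    also have "\<dots> = (\<Sum>((x, c), (a, b))\<in>Sigma (splits m) (\<lambda>(x, c). splits x). coef F a * coef G b * coef H c)"
      by (subst sum.Sigma[symmetric]) (auto simp: case_prod_unfold)
    also have "\<dots> = (\<Sum>((a, y), (b, c))\<in>Sigma (splits m) (\<lambda>(a, y). splits y). coef F a * coef G b * coef H c)"
      by (rule sum.reindex_bij_witness[where i = "\<lambda>((a, y), (b, c)). ((a + b, c), (a, b))"
            and j = "\<lambda>((x, c), (a, b)). ((a, b + c), (b, c))"]) (auto simp: add.assoc)
    also have "\<dots> = (\<Sum>(a, y)\<in>splits m. \<Sum>(b, c)\<in>splits y. coef F a * coef G b * coef H c)"
      by (subst sum.Sigma[symmetric]) (auto simp: case_prod_unfold)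
    also have "\<dots> = coef (F * (G * H)) m"
      by (simp add: times_mps_def sum_distrib_left case_prod_unfold mult.assoc)
    finally show "coef (F * G * H) m = coef (F * (G * H)) m" .
  qed
  show "F * G = G * F"
    by (rule mps_eqI, simp add: times_mps_def,
        rule sum.reindex_bij_witness[where i = prod.swap and j = prod.swap]) (auto simp: add.commute)
  show "1 * F = F"
  proof (rule mps_eqI)
    fix m
    show "coef (1 * F) m = coef F m"
      unfolding times_mps_def one_mps_def by (simp, subst sum_splits_single[where u = 0 and v = m]) auto
  qed
  show "(F + G) * H = F * H + G * H"
    by (rule mps_eqI) (simp add: times_mps_def plus_mps_def case_prod_unfold ring_distribs sum.distrib)
  show "F + G + H = F + (G + H)" by (simp add: plus_mps_def add.assoc)
  show "F + G = G + F" by (simp add: plus_mps_def add.commute)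
  show "0 + F = F" by (simp add: plus_mps_def zero_mps_def coef_inverse)
  show "- F + F = 0" by (simp add: plus_mps_def uminus_mps_def zero_mps_def)
  show "F - G = F + - G" by (simp add: plus_mps_def uminus_mps_def minus_mps_def)
  have "coef (0 :: 'a mps) 0 \<noteq> coef 1 0" by (simp add: zero_mps_def one_mps_def)
  thus "(0 :: 'a mps) \<noteq> 1" by metis
qed
end

lemma coef_0 [simp]: "coef 0 m = 0"
  and coef_1: "coef 1 m = (if m = 0 then 1 else 0)"
  and coef_add [simp]: "coef (F + G) m = coef F m + coef G m"
  and coef_diff [simp]: "coef (F - G) m = coef F m - coef G m"
  and coef_uminus [simp]: "coef (- F) m = - coef F m"
  and coef_mult: "coef (F * G) m = (\<Sum>(a, b)\<in>splits m. coef F a * coef G b)"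
  by (simp_all add: zero_mps_def one_mps_def plus_mps_def minus_mps_def uminus_mps_def times_mps_def)

lemma coef_sum [simp]: "coef (sum F A) m = (\<Sum>x\<in>A. coef (F x) m)"
  by (induction A rule: infinite_finite_induct) auto

definition mon :: "nat ^ 'n::finite \<Rightarrow> 'n mps" where
  "mon a = Mps (\<lambda>m. if m = a then 1 else 0)"

definition cst :: "complex \<Rightarrow> 'n::finite mps" where
  "cst c = Mps (\<lambda>m. if m = 0 then c else 0)"

abbreviation Y :: "'n::finite \<Rightarrow> 'n mps" where
  "Y i \<equiv> mon (axis i 1)"

lemma coef_mon: "coef (mon a) m = (if m = a then 1 else 0)"
  by (simp add: mon_def)

lemma coef_cst_mult [simp]: "coef (cst c * F) m = c * coef F m"
  unfolding coef_mult cst_def by (simp, subst sum_splits_single[where u = 0 and v = m]) auto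

lemma coef_cst: "coef (cst c) m = (if m = 0 then c else 0)"
  by (simp add: cst_def)

lemma cst_hom: "cst (a + b) = cst a + cst b" "cst (a * b) = cst a * cst b" "cst 0 = 0" "cst 1 = 1"
  by (auto intro!: mps_eqI simp: coef_cst coef_1)

lemma coef_mon_mult [simp]: "coef (mon a * F) (a + m) = coef F m" "coef (mon a * F) (m + a) = coef F m"
proof -
  show "coef (mon a * F) (a + m) = coef F m"
    unfolding coef_mult mon_def by (simp, subst sum_splits_single[where u = a and v = m]) auto
  thus "coef (mon a * F) (m + a) = coef F m" by (simp add: add.commute)
qed

lemma coef_mon_mult_0: "(\<And>b. m \<noteq> a + b) \<Longrightarrow> coef (mon a * F) m = 0"
  unfolding coef_mult mon_def by (intro sum.neutral) (auto simp: splits_def)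

lemma coef_Y_mult: "coef (Y i * F) m = (if m $ i = 0 then 0 else coef F (\<chi> j. m $ j - (if j = i then 1 else 0)))"
proof (cases "m $ i = 0")
  case True
  have "m \<noteq> axis i 1 + b" for b using True by (auto simp: vec_eq_iff axis_def)
  thus ?thesis using True by (simp add: coef_mon_mult_0)
next
  case False
  define m' where "m' = (\<chi> j. m $ j - (if j = i then 1 else 0))"
  have "m = axis i 1 + m'" using False by (auto simp: vec_eq_iff axis_def m'_def)
  thus ?thesis using False unfolding m'_def[symmetric] by (metis coef_mon_mult(1))
qed

lemma mon_add: "mon (a + b) = mon a * mon b"
proof (rule mps_eqI)
  fix m
  show "coef (mon (a + b)) m = coef (mon a * mon b) m"
  proof (cases "\<exists>c. m = a + c")
    case True thus ?thesis by (auto simp: coef_mon)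
  next
    case False thus ?thesis by (auto simp: coef_mon coef_mon_mult_0)
  qed
qed

lemma mon_0 [simp]: "mon 0 = 1"
  by (rule mps_eqI) (simp add: coef_mon coef_1)

lemma mon_mult_eq_0: "mon a * F = 0 \<Longrightarrow> F = 0"
  by (metis coef_0 coef_mon_mult(1) mps_eqI)

text \<open>The prime factorisation embeds the exponents, as a monoid, into the well-ordered positive
  integers; the product of the terms with least code cannot cancel.\<close>

lemma exponent_code:
  obtains N :: "nat ^ 'n::finite \<Rightarrow> nat" where "inj N" "\<And>a b. N (a + b) = N a * N b" "\<And>a. N a > 0"
proof -
  have "infinite {p :: nat. prime p}" by (rule primes_infinite)
  then obtain P where P: "P \<subseteq> {p :: nat. prime p}" "card P = CARD('n)" "finite P"
    using infinite_arbitrarily_large by metis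
  then obtain e where e: "bij_betw e (UNIV :: 'n set) P"
    by (metis finite finite_same_card_bij)
  have pr: "prime (e i)" for i using e P by (auto simp: bij_betw_def)
  have nz: "e i \<noteq> 0" for i using pr by (metis not_prime_0)
  have inje: "inj e" using e by (simp add: bij_betw_def)
  define N where "N m = (\<Prod>i\<in>UNIV. e i ^ (m $ i))" for m :: "nat ^ 'n"
  have mult: "multiplicity (e j) (N m) = m $ j" for m j
  proof -
    have "multiplicity (e j) (N m) = (\<Sum>i\<in>UNIV. multiplicity (e j) (e i ^ (m $ i)))"
      unfolding N_def using pr by (intro prime_elem_multiplicity_prod_distrib) (auto simp: nz)
    also have "\<dots> = (\<Sum>i\<in>UNIV. if i = j then m $ j else 0)"
      using pr inje by (intro sum.cong) (auto simp: prime_elem_multiplicity_power_distrib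
          inj_eq multiplicity_distinct_prime_power)
    finally show ?thesis by simp
  qed
  show ?thesis
  proof (rule that[of N])
    show "inj N" by (metis injI mult vec_eq_iff)
    show "N (a + b) = N a * N b" for a b by (simp add: N_def power_add prod.distrib)
    show "N a > 0" for a unfolding N_def using pr by (intro prod_pos) (auto simp: prime_gt_0_nat)
  qed
qed

instance mps :: (finite) idom
proof
  fix F G :: "'a mps"
  assume "F \<noteq> 0" "G \<noteq> 0"
  obtain N :: "nat ^ 'a \<Rightarrow> nat" where N: "inj N" "\<And>a b. N (a + b) = N a * N b" "\<And>a. N a > 0"
    using exponent_code by blast
  have ex: "\<exists>a. coef F a \<noteq> 0 \<and> (\<forall>b. coef F b \<noteq> 0 \<longrightarrow> N a \<le> N b)" if "F \<noteq> 0" for F :: "'a mps"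
  proof -
    have "\<exists>a. coef F a \<noteq> 0" using that by (metis coef_0 mps_eqI)
    thus ?thesis using ex_has_least_nat[of "\<lambda>a. coef F a \<noteq> 0" _ N] by blast
  qed
  obtain a where a: "coef F a \<noteq> 0" "\<And>b. coef F b \<noteq> 0 \<Longrightarrow> N a \<le> N b" using ex[OF \<open>F \<noteq> 0\<close>] by blast
  obtain b where b: "coef G b \<noteq> 0" "\<And>c. coef G c \<noteq> 0 \<Longrightarrow> N b \<le> N c" using ex[OF \<open>G \<noteq> 0\<close>] by blast
  have key: "coef F a' * coef G b' = (if (a', b') = (a, b) then coef F a * coef G b else 0)"
    if "(a', b') \<in> splits (a + b)" for a' b'
  proof (cases "coef F a' * coef G b' = 0")
    case True thus ?thesis using a b by auto
  next
    case False
    hence le: "N a \<le> N a'" "N b \<le> N b'" using a b by auto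
    have eq: "N a' * N b' = N a * N b" using that N(2) by (metis mem_splits)
    have "N a' = N a"
    proof (rule ccontr)
      assume "N a' \<noteq> N a"
      hence "N a * N b < N a' * N b'" using le N(3)[of b] by (intro mult_less_le_imp_less) auto
      thus False using eq by simp
    qed
    hence "a' = a" using N(1) by (simp add: inj_eq)
    thus ?thesis using that by auto
  qed
  have "coef (F * G) (a + b) = (\<Sum>p\<in>splits (a + b). if p = (a, b) then coef F a * coef G b else 0)"
    unfolding coef_mult
  proof (rule sum.cong[OF refl])
    fix p assume "p \<in> splits (a + b)"
    thus "(case p of (a', b') \<Rightarrow> coef F a' * coef G b') = (if p = (a, b) then coef F a * coef G b else 0)"
      using key[of "fst p" "snd p"] by (simp only: prod.collapse case_prod_unfold)
  qed
  hence "coef (F * G) (a + b) \<noteq> 0" using a b by simp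
  thus "F * G \<noteq> 0" by auto
qed

subsection \<open>Weighted orders and composition\<close>

text \<open>Two kinds of weights occur: the constant weight 1, which gives the usual order of
  vanishing, and weights decreasing along Jordan chains, for which a nilpotent linear field also
  raises the order.\<close>

definition wdeg :: "('n \<Rightarrow> nat) \<Rightarrow> nat ^ 'n \<Rightarrow> nat" where
  "wdeg w m = (\<Sum>i\<in>UNIV. w i * m $ i)"

lemma wdeg_add: "wdeg w (a + b) = wdeg w a + wdeg w b"
  by (simp add: wdeg_def sum.distrib algebra_simps)

lemma wdeg_1: "wdeg (\<lambda>_. 1) m = mdeg m" "wdeg (\<lambda>_. Suc 0) m = mdeg m"
  by (simp_all add: wdeg_def mdeg_def)

lemma wdeg_axis [simp]: "wdeg w (axis i k) = w i * k"
proof -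
  have "wdeg w (axis i k) = (\<Sum>j\<in>UNIV. if j = i then w i * k else 0)"
    unfolding wdeg_def by (intro sum.cong) (auto simp: axis_def)
  thus ?thesis by simp
qed

definition ord_ge :: "('n \<Rightarrow> nat) \<Rightarrow> nat \<Rightarrow> 'n::finite mps \<Rightarrow> bool" where
  "ord_ge w k F \<longleftrightarrow> (\<forall>m. wdeg w m < k \<longrightarrow> coef F m = 0)"

lemma ord_geI: "(\<And>m. coef F m \<noteq> 0 \<Longrightarrow> k \<le> wdeg w m) \<Longrightarrow> ord_ge w k F"
  unfolding ord_ge_def by (metis not_le)

lemma ord_geD: "ord_ge w k F \<Longrightarrow> wdeg w m < k \<Longrightarrow> coef F m = 0"
  by (simp add: ord_ge_def)

lemma ord_ge_le: "ord_ge w k F \<Longrightarrow> l \<le> k \<Longrightarrow> ord_ge w l F"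
  by (simp add: ord_ge_def)

lemma ord_ge_0 [simp]: "ord_ge w 0 F" "ord_ge w k 0"
  by (simp_all add: ord_ge_def)

lemma ord_ge_add: "ord_ge w k F \<Longrightarrow> ord_ge w k G \<Longrightarrow> ord_ge w k (F + G)"
  and ord_ge_cst_mult: "ord_ge w k F \<Longrightarrow> ord_ge w k (cst c * F)"
  by (simp_all add: ord_ge_def)

lemma ord_ge_sum: "(\<And>x. x \<in> A \<Longrightarrow> ord_ge w k (F x)) \<Longrightarrow> ord_ge w k (sum F A)"
  by (induction A rule: infinite_finite_induct) (auto intro: ord_ge_add)

lemma ord_ge_mult: assumes "ord_ge w k F" "ord_ge w l G" shows "ord_ge w (k + l) (F * G)"
  unfolding ord_ge_def coef_mult
proof (intro allI impI sum.neutral ballI)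
  fix m p assume "wdeg w m < k + l" "p \<in> splits m"
  thus "(case p of (a, b) \<Rightarrow> coef F a * coef G b) = 0"
    using assms unfolding ord_ge_def splits_def
    by (cases p, simp) (metis add_mono_thms_linordered_semiring(1) not_le wdeg_add)
qed

lemma ord_ge_power: "ord_ge w k F \<Longrightarrow> ord_ge w (k * n) (F ^ n)"
proof (induction n)
  case (Suc n)
  thus ?case using ord_ge_mult[of w k F "k * n" "F ^ n"] by simp
qed simp

lemma ord_ge_prod: "(\<And>x. x \<in> A \<Longrightarrow> ord_ge w (k x) (F x)) \<Longrightarrow> ord_ge w (sum k A) (prod F A)"
  by (induction A rule: infinite_finite_induct) (auto intro: ord_ge_mult)

lemma ord_ge_mon: "ord_ge w (wdeg w a) (mon a)"
  by (rule ord_geI) (auto simp: coef_mon split: if_splits)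

text \<open>Telescoping: a perturbation of relative order \<open>N\<close> in the factors stays one
  of relative order \<open>N\<close> in the product.\<close>

lemma ord_ge_power_diff:
  assumes "ord_ge w k F" "ord_ge w k G" "ord_ge w (k + N) (F - G)"
  shows "ord_ge w (k * n + N) (F ^ n - G ^ n)"
proof (induction n)
  case (Suc n)
  have eq: "F ^ Suc n - G ^ Suc n = (F - G) * F ^ n + G * (F ^ n - G ^ n)" by (simp add: algebra_simps)
  have "ord_ge w ((k + N) + k * n) ((F - G) * F ^ n)" "ord_ge w (k + (k * n + N)) (G * (F ^ n - G ^ n))"
    using assms Suc by (auto intro!: ord_ge_mult ord_ge_power)
  thus ?case unfolding eq by (intro ord_ge_add) (simp_all add: algebra_simps)
qed simp

lemma ord_ge_prod_diff:
  assumes "finite A" "\<And>x. x \<in> A \<Longrightarrow> ord_ge w (k x) (F x)" "\<And>x. x \<in> A \<Longrightarrow> ord_ge w (k x) (G x)"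
    "\<And>x. x \<in> A \<Longrightarrow> ord_ge w (k x + N) (F x - G x)"
  shows "ord_ge w (sum k A + N) (prod F A - prod G A)"
  using assms
proof (induction A rule: finite_induct)
  case (insert x A)
  have eq: "prod F (insert x A) - prod G (insert x A) = (F x - G x) * prod F A + G x * (prod F A - prod G A)"
    using insert by (simp add: algebra_simps)
  have "ord_ge w ((k x + N) + sum k A) ((F x - G x) * prod F A)"
    "ord_ge w (k x + (sum k A + N)) (G x * (prod F A - prod G A))"
    using insert by (auto intro!: ord_ge_mult ord_ge_prod)
  thus ?case unfolding eq using insert by (intro ord_ge_add) (simp_all add: algebra_simps)
qed simp

section \<open>Substitution of power series\<close>

definition mprod :: "('n \<Rightarrow> 'n mps) \<Rightarrow> nat ^ 'n::finite \<Rightarrow> 'n mps" where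
  "mprod P m = (\<Prod>i\<in>UNIV. P i ^ (m $ i))"

lemma mprod_add: "mprod P (a + b) = mprod P a * mprod P b"
  by (simp add: mprod_def power_add prod.distrib)

lemma mprod_0 [simp]: "mprod P 0 = 1"
  by (simp add: mprod_def)

lemma mprod_axis [simp]: "mprod P (axis i k) = P i ^ k"
proof -
  have "mprod P (axis i k) = (\<Prod>j\<in>UNIV. if j = i then P i ^ k else 1)"
    unfolding mprod_def by (intro prod.cong) (auto simp: axis_def)
  thus ?thesis by simp
qed

lemma mprod_Y: "mprod Y m = mon m"
proof (induction "mdeg m" arbitrary: m)
  case 0
  hence "m = 0" using mdeg_eq_0_iff by metis
  thus ?case by simp
next
  case (Suc k)
  obtain i m' where m: "m = m' + axis i 1" "mdeg m' = k" using Suc(2) mdeg_pos_split by metis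
  thus ?case using Suc(1)[of m'] by (simp add: mprod_add mon_add)
qed

lemma ord_ge_mprod: "(\<And>i. ord_ge w (w i) (P i)) \<Longrightarrow> ord_ge w (wdeg w m) (mprod P m)"
  unfolding mprod_def wdeg_def by (intro ord_ge_prod ord_ge_power)

lemma ord_ge_mprod_diff:
  assumes "\<And>i. ord_ge w (w i) (P i)" "\<And>i. ord_ge w (w i) (Q i)" "\<And>i. ord_ge w (w i + N) (P i - Q i)"
  shows "ord_ge w (wdeg w m + N) (mprod P m - mprod Q m)"
  unfolding mprod_def wdeg_def using assms
  by (intro ord_ge_prod_diff ord_ge_power ord_ge_power_diff) auto

definition no_const :: "('n \<Rightarrow> 'n::finite mps) \<Rightarrow> bool" where
  "no_const P \<longleftrightarrow> (\<forall>i. coef (P i) 0 = 0)"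

lemma ncI: "(\<And>i. coef (P i) 0 = 0) \<Longrightarrow> no_const P" by (simp add: no_const_def)

lemma no_const_ord_ge: "no_const P \<longleftrightarrow> (\<forall>i. ord_ge (\<lambda>_. 1) 1 (P i))"
  by (auto simp: no_const_def ord_ge_def wdeg_1 mdeg_eq_0_iff)

lemma no_const_mprod: "no_const P \<Longrightarrow> mdeg k < mdeg m \<Longrightarrow> coef (mprod P m) k = 0"
  using ord_ge_mprod[of "\<lambda>_. 1" P m] unfolding no_const_ord_ge by (auto simp: wdeg_1 ord_ge_def)

text \<open>The cut-off makes every coefficient a finite sum. It is harmless for tuples without
  constant terms, because then \<open>mprod P m\<close> starts in degree
  \<open>mdeg m\<close>.\<close>

definition mcomp :: "'n mps \<Rightarrow> ('n \<Rightarrow> 'n mps) \<Rightarrow> 'n::finite mps" where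
  "mcomp F P = Mps (\<lambda>k. \<Sum>m | mdeg m \<le> mdeg k. coef F m * coef (mprod P m) k)"

lemma coef_mcomp:
  assumes "no_const P" "finite A" "{m. mdeg m \<le> mdeg k} \<subseteq> A"
  shows "coef (mcomp F P) k = (\<Sum>m\<in>A. coef F m * coef (mprod P m) k)"
  unfolding mcomp_def using assms by (simp, intro sum.mono_neutral_left) (auto simp: no_const_mprod)

text \<open>A coefficient of degree \<open>mdeg k\<close> sees only finitely many terms of
  \<open>F\<close>, and one set \<open>A\<close> serves for all factors of the product. Thus product
  and chain rules reduce to the powers \<open>mprod P m\<close>.\<close>

lemma coef_mcomp_mult:
  assumes "no_const P" "finite A" "{m. mdeg m \<le> mdeg k} \<subseteq> A"
  shows "coef (mcomp F P * G) k = (\<Sum>m\<in>A. coef F m * coef (mprod P m * G) k)"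
proof -
  have "coef (mcomp F P * G) k = (\<Sum>p\<in>splits k. \<Sum>m\<in>A. coef F m * (coef (mprod P m) (fst p) * coef G (snd p)))"
    unfolding coef_mult
  proof (rule sum.cong[OF refl])
    fix p assume "p \<in> splits k"
    hence "mdeg (fst p) \<le> mdeg k" by (auto simp: splits_def mdeg_add)
    hence "{m. mdeg m \<le> mdeg (fst p)} \<subseteq> A" using assms(3) by auto
    thus "(case p of (a, b) \<Rightarrow> coef (mcomp F P) a * coef G b) =
       (\<Sum>m\<in>A. coef F m * (coef (mprod P m) (fst p) * coef G (snd p)))"
      using coef_mcomp[OF assms(1,2), of "fst p" F] by (simp add: case_prod_unfold sum_distrib_right mult.assoc)
  qed
  also have "\<dots> = (\<Sum>m\<in>A. coef F m * coef (mprod P m * G) k)"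
    by (subst sum.swap) (simp add: coef_mult sum_distrib_left case_prod_unfold)
  finally show ?thesis .
qed

lemma mcomp_add: "mcomp (F + G) P = mcomp F P + mcomp G P"
  and mcomp_cst_mult: "mcomp (cst c * F) P = cst c * mcomp F P"
  and mcomp_0: "mcomp 0 P = 0"
  by (rule mps_eqI, simp add: mcomp_def ring_distribs sum.distrib sum_subtractf sum_distrib_left mult.assoc)+

lemma mcomp_sum: "mcomp (sum F A) P = (\<Sum>x\<in>A. mcomp (F x) P)"
  by (induction A rule: infinite_finite_induct) (auto simp: mcomp_add mcomp_0)

lemma mcomp_mon:
  fixes a :: "nat ^ 'a::finite"
  assumes "no_const P" shows "mcomp (mon a) P = mprod P a"
proof (rule mps_eqI)
  fix k :: "nat ^ 'a"
  have "coef (mcomp (mon a) P) k = (\<Sum>m\<in>insert a {m. mdeg m \<le> mdeg k}. coef (mon a) m * coef (mprod P m) k)"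
    using assms by (intro coef_mcomp) (auto simp: finite_mdeg_le)
  also have "\<dots> = (\<Sum>m\<in>{a}. coef (mon a) m * coef (mprod P m) k)"
    by (intro sum.mono_neutral_right) (auto simp: finite_mdeg_le coef_mon)
  finally show "coef (mcomp (mon a) P) k = coef (mprod P a) k" by (simp add: coef_mon)
qed

lemma mcomp_1: "no_const P \<Longrightarrow> mcomp 1 P = 1"
  using mcomp_mon[of P 0] by simp

lemma mcomp_mult:
  fixes F G :: "'a::finite mps"
  assumes no_const: "no_const P" shows "mcomp (F * G) P = mcomp F P * mcomp G P"
proof (rule mps_eqI)
  fix k :: "nat ^ 'a"
  define A where "A = {m :: nat ^ 'a. mdeg m \<le> mdeg k}"
  have A: "finite A" "{m. mdeg m \<le> mdeg k} \<subseteq> A" by (auto simp: A_def finite_mdeg_le)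
  have "coef (mcomp F P * mcomp G P) k = (\<Sum>a\<in>A. coef F a * coef (mcomp G P * mprod P a) k)"
    using coef_mcomp_mult[OF no_const A, of F "mcomp G P"] by (simp add: mult.commute)
  also have "\<dots> = (\<Sum>a\<in>A. \<Sum>b\<in>A. coef F a * coef G b * coef (mprod P (a + b)) k)"
    by (simp add: coef_mcomp_mult[OF no_const A, of G] sum_distrib_left mprod_add ac_simps)
  also have "\<dots> = (\<Sum>p\<in>A \<times> A. coef F (fst p) * coef G (snd p) * coef (mprod P (fst p + snd p)) k)"
    by (simp add: sum.cartesian_product case_prod_unfold)
  \<comment> \<open>Pairs whose sum leaves \<open>A\<close> have degree above \<open>mdeg k\<close>,
    where \<open>mprod P\<close> has no coefficient at \<open>k\<close>.\<close>
  also have "\<dots> = (\<Sum>p\<in>{p. fst p + snd p \<in> A}. coef F (fst p) * coef G (snd p) * coef (mprod P (fst p + snd p)) k)"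
    using A(1) by (intro sum.mono_neutral_right) (auto simp: A_def mdeg_add no_const_mprod[OF no_const])
  also have "\<dots> = (\<Sum>q\<in>Sigma A splits. coef F (fst (snd q)) * coef G (snd (snd q)) * coef (mprod P (fst q)) k)"
    by (rule sum.reindex_bij_witness[where i = snd and j = "\<lambda>p. (fst p + snd p, p)"]) (auto simp: splits_def)
  also have "\<dots> = (\<Sum>m\<in>A. coef (F * G) m * coef (mprod P m) k)"
    by (subst sum.Sigma[symmetric, unfolded split_def])
       (use A in \<open>auto simp: coef_mult case_prod_unfold sum_distrib_right\<close>)
  also have "\<dots> = coef (mcomp (F * G) P) k" using coef_mcomp[OF no_const A] by simp
  finally show "coef (mcomp (F * G) P) k = coef (mcomp F P * mcomp G P) k" by simp
qed

lemma mcomp_Y: "no_const P \<Longrightarrow> mcomp (Y i) P = P i"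
  using mcomp_mon[of P "axis i 1"] by simp

lemma mcomp_power: "no_const P \<Longrightarrow> mcomp (F ^ n) P = mcomp F P ^ n"
  by (induction n) (auto simp: mcomp_1 mcomp_mult)

lemma mcomp_prod: "no_const P \<Longrightarrow> mcomp (prod F A) P = (\<Prod>x\<in>A. mcomp (F x) P)"
  by (induction A rule: infinite_finite_induct) (auto simp: mcomp_1 mcomp_mult)

lemma mcomp_mprod: "no_const P \<Longrightarrow> mcomp (mprod Q m) P = mprod (\<lambda>i. mcomp (Q i) P) m"
  by (simp add: mprod_def mcomp_prod mcomp_power)

lemma no_const_Y: "no_const Y"
  by (rule ncI) (auto simp: coef_mon vec_eq_iff axis_def)

lemma mcomp_id [simp]: "mcomp (F :: 'a::finite mps) Y = F"
proof (rule mps_eqI)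
  fix k :: "nat ^ 'a"
  have "coef (mcomp F Y) k = (\<Sum>m\<in>{m. mdeg m \<le> mdeg k}. if m = k then coef F k else 0)"
    unfolding mcomp_def by (auto simp: mprod_Y coef_mon intro!: sum.cong)
  thus "coef (mcomp F Y) k = coef F k" by (simp add: finite_mdeg_le)
qed

lemma coef_mcomp_0: "coef (mcomp F P) 0 = coef F 0"
  by (simp add: mcomp_def mdeg_eq_0_iff coef_1)

lemma no_const_mcomp: "no_const Q \<Longrightarrow> no_const (\<lambda>i. mcomp (Q i) P)"
  by (simp add: no_const_def coef_mcomp_0)

lemma mcomp_assoc:
  fixes F :: "'a::finite mps"
  assumes "no_const P" "no_const Q" shows "mcomp (mcomp F Q) P = mcomp F (\<lambda>i. mcomp (Q i) P)"
proof (rule mps_eqI)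
  fix k :: "nat ^ 'a"
  define A where "A = {m :: nat ^ 'a. mdeg m \<le> mdeg k}"
  have A: "finite A" "{m. mdeg m \<le> mdeg k} \<subseteq> A" by (auto simp: A_def finite_mdeg_le)
  have "coef (mcomp (mcomp F Q) P) k = (\<Sum>m\<in>A. (\<Sum>a\<in>A. coef F a * coef (mprod Q a) m) * coef (mprod P m) k)"
    unfolding coef_mcomp[OF assms(1) A]
  proof (rule sum.cong[OF refl])
    fix m assume "m \<in> A"
    hence "{a. mdeg a \<le> mdeg m} \<subseteq> A" by (auto simp: A_def)
    thus "coef (mcomp F Q) m * coef (mprod P m) k = (\<Sum>a\<in>A. coef F a * coef (mprod Q a) m) * coef (mprod P m) k"
      using coef_mcomp[OF assms(2) A(1)] by simp
  qed
  also have "\<dots> = (\<Sum>a\<in>A. coef F a * (\<Sum>m\<in>A. coef (mprod Q a) m * coef (mprod P m) k))"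
    unfolding sum_distrib_right sum_distrib_left by (subst sum.swap) (simp add: mult.assoc)
  also have "\<dots> = (\<Sum>a\<in>A. coef F a * coef (mprod (\<lambda>i. mcomp (Q i) P) a) k)"
    by (simp add: coef_mcomp[OF assms(1) A, symmetric] mcomp_mprod[OF assms(1)])
  also have "\<dots> = coef (mcomp F (\<lambda>i. mcomp (Q i) P)) k"
    using coef_mcomp[OF no_const_mcomp[OF assms(2)] A, of F P] by simp
  finally show "coef (mcomp (mcomp F Q) P) k = coef (mcomp F (\<lambda>i. mcomp (Q i) P)) k" .
qed

text \<open>A term of \<open>F\<close> of weight at least \<open>K\<close> turns a change of
  relative order \<open>N\<close> into one of order \<open>K + N\<close>. Applied with
  \<open>K\<close> larger than the weight of the component by one, this makes the fixed-point
  operators below triangular.\<close>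

lemma ord_ge_mcomp_diff:
  assumes "no_const P" "no_const Q" "\<And>i. ord_ge w (w i) (P i)" "\<And>i. ord_ge w (w i) (Q i)"
    "\<And>i. ord_ge w (w i + N) (P i - Q i)" "ord_ge w K F"
  shows "ord_ge w (K + N) (mcomp F P - mcomp F Q)"
proof (rule ord_geI, rule ccontr)
  fix k assume nz: "coef (mcomp F P - mcomp F Q) k \<noteq> 0" and lt: "\<not> K + N \<le> wdeg w k"
  have "coef (mcomp F P - mcomp F Q) k
      = (\<Sum>m | mdeg m \<le> mdeg k. coef F m * coef (mprod P m - mprod Q m) k)"
    by (simp add: mcomp_def sum_subtractf algebra_simps)
  also have "\<dots> = 0"
  proof (intro sum.neutral ballI)
    fix m
    have "coef F m = 0 \<or> coef (mprod P m - mprod Q m) k = 0"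
      using ord_geD[OF ord_ge_mprod_diff[of w P Q N m, OF assms(3-5)], of k] ord_geD[OF assms(6), of m] lt
      by (cases "wdeg w m < K") auto
    thus "coef F m * coef (mprod P m - mprod Q m) k = 0" by auto
  qed
  finally show False using nz by simp
qed

subsection \<open>Partial and Lie derivatives\<close>

definition pd :: "'n \<Rightarrow> 'n::finite mps \<Rightarrow> 'n mps" where
  "pd i F = Mps (\<lambda>m. of_nat (m $ i + 1) * coef F (m + axis i 1))"

lemma coef_pd: "coef (pd i F) m = of_nat (m $ i + 1) * coef F (m + axis i 1)"
  by (simp add: pd_def)

lemma coef_Y_pd: "coef (Y i * pd i F) m = of_nat (m $ i) * coef F m"
proof (cases "m $ i = 0")
  case False
  obtain b where m: "m = axis i 1 + b"
    by (rule nat_vec_le_add[of "axis i 1" m]) (use False in \<open>auto simp: axis_def split: if_splits\<close>)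
  show ?thesis unfolding m by (simp add: coef_pd add.commute axis_def)
qed (simp add: coef_Y_mult)

lemma pd_add: "pd i (F + G) = pd i F + pd i G"
  and pd_diff: "pd i (F - G) = pd i F - pd i G"
  by (rule mps_eqI, simp add: coef_pd algebra_simps)+

text \<open>The Euler operator \<open>Y i * pd i\<close> multiplies the coefficient at
  \<open>m\<close> by \<open>m $ i\<close>, which is additive over the splittings of
  \<open>m\<close>; hence it is a derivation, and the monomial \<open>Y i\<close> can be
  cancelled.\<close>

lemma pd_mult: "pd i (F * G) = pd i F * G + F * pd i G"
proof -
  have "Y i * pd i (F * G) = Y i * pd i F * G + F * (Y i * pd i G)"
  proof (rule mps_eqI)
    fix m
    have "coef (Y i * pd i (F * G)) m = (\<Sum>(a, b)\<in>splits m. of_nat (m $ i) * (coef F a * coef G b))"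
      by (simp add: coef_Y_pd coef_mult[of F] sum_distrib_left case_prod_unfold)
    also have "\<dots> = (\<Sum>(a, b)\<in>splits m. of_nat (a $ i) * coef F a * coef G b + coef F a * (of_nat (b $ i) * coef G b))"
      by (intro sum.cong) (auto simp: splits_def algebra_simps)
    also have "\<dots> = coef (Y i * pd i F * G + F * (Y i * pd i G)) m"
      by (simp add: coef_mult[of "Y i * pd i F"] coef_mult[of F] coef_Y_pd case_prod_unfold sum.distrib)
    finally show "coef (Y i * pd i (F * G)) m = coef (Y i * pd i F * G + F * (Y i * pd i G)) m" .
  qed
  hence "Y i * (pd i (F * G) - (pd i F * G + F * pd i G)) = 0" by (simp add: algebra_simps)
  hence "pd i (F * G) - (pd i F * G + F * pd i G) = 0" by (rule mon_mult_eq_0)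
  thus ?thesis by simp
qed

lemma pd_1 [simp]: "pd i 1 = 0"
  by (rule mps_eqI) (auto simp: coef_pd coef_1 vec_eq_iff axis_def)

lemma pd_Y: "pd i (Y j) = (if i = j then 1 else 0)"
proof (rule mps_eqI)
  fix m
  show "coef (pd i (Y j)) m = coef (if i = j then 1 else 0) m"
    by (auto simp: coef_pd coef_mon coef_1 vec_eq_iff axis_def)
qed

lemma pd_power: "pd i (F ^ n) = cst (of_nat n) * F ^ (n - 1) * pd i F"
proof (induction n)
  case (Suc n)
  have c: "cst (of_nat (Suc n)) = 1 + cst (of_nat n)" by (simp only: of_nat_Suc cst_hom)
  have "cst (of_nat n) * (F * F ^ (n - 1)) = cst (of_nat n) * F ^ n" by (cases n) (simp_all add: cst_hom)
  hence "F * (cst (of_nat n) * F ^ (n - 1) * pd i F) = cst (of_nat n) * F ^ n * pd i F"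
    by (simp add: mult_ac) (metis mult.assoc mult.commute)
  thus ?case unfolding c by (simp add: pd_mult Suc algebra_simps)
qed (simp add: cst_hom)

lemma pd_prod:
  "finite A \<Longrightarrow> pd i (prod F A) = (\<Sum>x\<in>A. prod F (A - {x}) * pd i (F x))"
proof (induction A rule: finite_induct)
  case (insert x A)
  have "(\<Sum>y\<in>A. prod F (insert x A - {y}) * pd i (F y)) = (\<Sum>y\<in>A. F x * (prod F (A - {y}) * pd i (F y)))"
  proof (rule sum.cong[OF refl])
    fix y assume "y \<in> A"
    hence "insert x A - {y} = insert x (A - {y})" "x \<notin> A - {y}" using insert by auto
    thus "prod F (insert x A - {y}) * pd i (F y) = F x * (prod F (A - {y}) * pd i (F y))"
      using insert by (simp add: mult.assoc)
  qed
  thus ?case using insert by (simp add: pd_mult sum_distrib_left mult.commute insert_Diff_if)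
qed simp

definition dec :: "'n \<Rightarrow> nat ^ 'n \<Rightarrow> nat ^ 'n" where
  "dec j m = (\<chi> i. m $ i - (if i = j then 1 else 0))"

lemma dec_add [simp]: "dec j (m + axis j 1) = m"
  by (simp add: dec_def vec_eq_iff axis_def)

lemma add_dec: "m $ j \<noteq> 0 \<Longrightarrow> dec j m + axis j 1 = m"
  by (auto simp: dec_def vec_eq_iff axis_def)

lemma pd_mprod: "pd i (mprod P m) = (\<Sum>j\<in>UNIV. cst (of_nat (m $ j)) * mprod P (dec j m) * pd i (P j))"
proof -
  have "prod (\<lambda>k. P k ^ (m $ k)) (UNIV - {j}) * P j ^ (m $ j - 1) = mprod P (dec j m)" for j
  proof -
    have "mprod P (dec j m) = P j ^ (dec j m $ j) * (\<Prod>k\<in>UNIV - {j}. P k ^ (dec j m $ k))"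
      unfolding mprod_def by (rule prod.remove) auto
    also have "(\<Prod>k\<in>UNIV - {j}. P k ^ (dec j m $ k)) = (\<Prod>k\<in>UNIV - {j}. P k ^ (m $ k))"
      by (intro prod.cong) (auto simp: dec_def)
    finally show ?thesis by (simp add: dec_def mult.commute)
  qed
  note * = this
  have "pd i (mprod P m) = (\<Sum>j\<in>UNIV. cst (of_nat (m $ j)) * (prod (\<lambda>k. P k ^ (m $ k)) (UNIV - {j}) * P j ^ (m $ j - 1)) * pd i (P j))"
    unfolding mprod_def by (subst pd_prod) (simp_all add: pd_power mult_ac)
  thus ?thesis by (simp add: *)
qed

lemma pd_mcomp:
  fixes F :: "'a::finite mps"
  assumes "no_const P" shows "pd i (mcomp F P) = (\<Sum>j\<in>UNIV. mcomp (pd j F) P * pd i (P j))"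
proof (rule mps_eqI)
  fix k :: "nat ^ 'a"
  \<comment> \<open>One degree more than \<open>B\<close>, since \<open>pd i\<close> at
    \<open>k\<close> reads the coefficient at \<open>k + axis i 1\<close>.\<close>
  define A where "A = {m :: nat ^ 'a. mdeg m \<le> mdeg k + 1}"
  define B where "B = {m :: nat ^ 'a. mdeg m \<le> mdeg k}"
  have A: "finite A" and B: "finite B" by (auto simp: A_def B_def finite_mdeg_le)
  have "coef (pd i (mcomp F P)) k = of_nat (k $ i + 1) * (\<Sum>m\<in>A. coef F m * coef (mprod P m) (k + axis i 1))"
    unfolding coef_pd using A by (subst coef_mcomp[OF assms, of A]) (auto simp: A_def mdeg_add)
  also have "\<dots> = (\<Sum>m\<in>A. coef F m * coef (pd i (mprod P m)) k)"
    by (simp add: coef_pd sum_distrib_left mult_ac)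
  also have "\<dots> = (\<Sum>m\<in>A. \<Sum>j\<in>UNIV. of_nat (m $ j) * coef F m * coef (mprod P (dec j m) * pd i (P j)) k)"
    by (simp add: pd_mprod mult.assoc sum_distrib_left mult.left_commute)
  also have "\<dots> = (\<Sum>j\<in>UNIV. \<Sum>m\<in>A. of_nat (m $ j) * coef F m * coef (mprod P (dec j m) * pd i (P j)) k)"
    by (rule sum.swap)
  also have "\<dots> = (\<Sum>j\<in>UNIV. coef (mcomp (pd j F) P * pd i (P j)) k)"
  proof (rule sum.cong[OF refl])
    fix j
    have "(\<Sum>m\<in>A. of_nat (m $ j) * coef F m * coef (mprod P (dec j m) * pd i (P j)) k)
        = (\<Sum>m\<in>{m \<in> A. m $ j \<noteq> 0}. of_nat (m $ j) * coef F m * coef (mprod P (dec j m) * pd i (P j)) k)"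
      using A by (intro sum.mono_neutral_right) auto
    also have "\<dots> = (\<Sum>m\<in>B. coef (pd j F) m * coef (mprod P m * pd i (P j)) k)"
    proof (rule sum.reindex_bij_witness[where i = "\<lambda>m. m + axis j 1" and j = "dec j"])
      fix m assume "m \<in> {m \<in> A. m $ j \<noteq> 0}"
      hence m: "m $ j \<noteq> 0" "mdeg m \<le> mdeg k + 1" by (auto simp: A_def)
      show "dec j m + axis j 1 = m" using m add_dec by blast
      have "mdeg (dec j m) + 1 = mdeg m" using add_dec[OF m(1)] mdeg_add mdeg_axis by metis
      thus "dec j m \<in> B" using m by (simp add: B_def)
      have "dec j m $ j + 1 = m $ j" using m by (simp add: dec_def)
      thus "coef (pd j F) (dec j m) * coef (mprod P (dec j m) * pd i (P j)) k =
          of_nat (m $ j) * coef F m * coef (mprod P (dec j m) * pd i (P j)) k"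
        using add_dec[OF m(1)] unfolding coef_pd by metis
    next
      fix m assume "m \<in> B"
      thus "m + axis j 1 \<in> {m \<in> A. m $ j \<noteq> 0}" by (auto simp: A_def B_def mdeg_add)
    qed simp
    also have "\<dots> = coef (mcomp (pd j F) P * pd i (P j)) k"
      using B by (subst coef_mcomp_mult[OF assms, of B]) (auto simp: B_def)
    finally show "(\<Sum>m\<in>A. of_nat (m $ j) * coef F m * coef (mprod P (dec j m) * pd i (P j)) k)
      = coef (mcomp (pd j F) P * pd i (P j)) k" .
  qed
  finally show "coef (pd i (mcomp F P)) k = coef (\<Sum>j\<in>UNIV. mcomp (pd j F) P * pd i (P j)) k" by simp
qed

section \<open>Lie derivatives along formal vector fields\<close>

definition lie :: "('n \<Rightarrow> 'n mps) \<Rightarrow> 'n::finite mps \<Rightarrow> 'n mps" where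
  "lie V F = (\<Sum>i\<in>UNIV. V i * pd i F)"

lemma lie_add: "lie V (F + G) = lie V F + lie V G"
  and lie_diff: "lie V (F - G) = lie V F - lie V G"
  and lie_add_left: "lie (\<lambda>i. V i + W i) F = lie V F + lie W F"
  and lie_diff_left: "lie (\<lambda>i. V i - W i) F = lie V F - lie W F"
  and lie_mult_left: "lie (\<lambda>i. G * V i) F = G * lie V F"
  by (simp_all add: lie_def pd_add pd_diff ring_distribs sum.distrib sum_subtractf sum_distrib_left mult.assoc)

lemma lie_Y: "lie V (Y j) = V j"
proof -
  have "lie V (Y j) = (\<Sum>i\<in>UNIV. if i = j then V j else 0)"
    unfolding lie_def by (intro sum.cong) (auto simp: pd_Y)
  thus ?thesis by simp
qed

lemma lie_mcomp: "no_const P \<Longrightarrow> lie V (mcomp F P) = (\<Sum>j\<in>UNIV. mcomp (pd j F) P * lie V (P j))"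
  unfolding lie_def sum_distrib_left pd_mcomp
  by (subst sum.swap) (simp add: mult_ac)

definition diagf :: "complex ^ 'n \<Rightarrow> 'n \<Rightarrow> 'n::finite mps" where
  "diagf lam i = cst (lam $ i) * Y i"

text \<open>The origin of resonances and of the small divisors: monomials are the eigenvectors of a
  diagonal linear field.\<close>

lemma coef_lie_diagf: "coef (lie (diagf lam) F) m = mpair m lam * coef F m"
proof -
  have "coef (lie (diagf lam) F) m = (\<Sum>i\<in>UNIV. lam $ i * (of_nat (m $ i) * coef F m))"
    unfolding lie_def diagf_def by (simp add: mult.assoc coef_Y_pd)
  thus ?thesis by (simp add: mpair_def sum_distrib_right sum_distrib_left mult_ac)
qed

lemma ord_ge_pd: "ord_ge w k F \<Longrightarrow> ord_ge w (k - w i) (pd i F)"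
  by (auto simp: ord_ge_def coef_pd wdeg_add)

lemma ord_ge_lie:
  assumes "\<And>i. ord_ge w (w i + a) (V i)" "ord_ge w k F" shows "ord_ge w (k + a) (lie V F)"
  unfolding lie_def
proof (rule ord_ge_sum)
  fix i
  \<comment> \<open>The subtraction \<open>k - w i\<close> is truncated; the total is at least
    \<open>k + a\<close> in either case.\<close>
  have "ord_ge w ((w i + a) + (k - w i)) (V i * pd i F)" using assms by (intro ord_ge_mult ord_ge_pd)
  thus "ord_ge w (k + a) (V i * pd i F)" by (rule ord_ge_le) simp
qed

lemma axis_0 [simp]: "axis i 0 = 0"
  by (simp add: axis_def vec_eq_iff)

lemma axis_same [simp]: "axis i k $ i = k"
  by (simp add: axis_def)

subsection \<open>Majorants\<close>

text \<open>The weighted \<open>l\<^sup>1\<close> norm with radius \<open>r\<close> is at most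
  \<open>B\<close>. Bounding finite partial sums needs no summability condition, so it applies to
  formal series whose convergence is still to be shown.\<close>

definition bnd :: "real \<Rightarrow> 'n::finite mps \<Rightarrow> real \<Rightarrow> bool" where
  "bnd r F B \<longleftrightarrow> (\<forall>A. finite A \<longrightarrow> (\<Sum>m\<in>A. norm (coef F m) * r ^ mdeg m) \<le> B)"

lemma bndI: "(\<And>A. finite A \<Longrightarrow> (\<Sum>m\<in>A. norm (coef F m) * r ^ mdeg m) \<le> B) \<Longrightarrow> bnd r F B"
  by (simp add: bnd_def)

lemma bndD: "bnd r F B \<Longrightarrow> finite A \<Longrightarrow> (\<Sum>m\<in>A. norm (coef F m) * r ^ mdeg m) \<le> B"
  by (simp add: bnd_def)

lemma bnd_nonneg: "bnd r F B \<Longrightarrow> 0 \<le> B"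
  using bndD[of r F B "{}"] by simp

lemma bnd_weaken: "bnd r F B \<Longrightarrow> B \<le> C \<Longrightarrow> bnd r F C"
  unfolding bnd_def by (meson order_trans)

lemma bnd_scale:
  assumes "bnd r F B" "\<And>m. norm (coef G m) \<le> c * norm (coef F m)" "0 \<le> c" "0 \<le> r"
  shows "bnd r G (c * B)"
proof (rule bndI)
  fix A :: "(nat ^ 'a) set" assume A: "finite A"
  have "(\<Sum>m\<in>A. norm (coef G m) * r ^ mdeg m) \<le> (\<Sum>m\<in>A. c * (norm (coef F m) * r ^ mdeg m))"
    using assms by (intro sum_mono) (simp add: mult_right_mono flip: mult.assoc)
  also have "\<dots> \<le> c * B"
    unfolding sum_distrib_left[symmetric] using assms A by (intro mult_left_mono bndD)
  finally show "(\<Sum>m\<in>A. norm (coef G m) * r ^ mdeg m) \<le> c * B" .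
qed

lemma bnd_add: "0 \<le> r \<Longrightarrow> bnd r F B \<Longrightarrow> bnd r G C \<Longrightarrow> bnd r (F + G) (B + C)"
proof (rule bndI)
  fix A :: "(nat ^ 'a) set" assume *: "0 \<le> r" "bnd r F B" "bnd r G C" "finite A"
  have "(\<Sum>m\<in>A. norm (coef (F + G) m) * r ^ mdeg m)
      \<le> (\<Sum>m\<in>A. norm (coef F m) * r ^ mdeg m + norm (coef G m) * r ^ mdeg m)"
    using *(1) by (intro sum_mono) (simp add: norm_triangle_ineq mult_right_mono flip: distrib_right)
  also have "\<dots> \<le> B + C" unfolding sum.distrib using * by (intro add_mono bndD)
  finally show "(\<Sum>m\<in>A. norm (coef (F + G) m) * r ^ mdeg m) \<le> B + C" .
qed

lemma bnd_uminus: "bnd r F B \<Longrightarrow> bnd r (- F) B"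
  by (simp add: bnd_def)

lemma bnd_diff: "0 \<le> r \<Longrightarrow> bnd r F B \<Longrightarrow> bnd r G C \<Longrightarrow> bnd r (F - G) (B + C)"
  using bnd_add[of r F B "- G" C] by (simp add: bnd_uminus)

lemma bnd_cst_mult: "0 \<le> r \<Longrightarrow> bnd r F B \<Longrightarrow> bnd r (cst c * F) (norm c * B)"
  by (rule bnd_scale) (auto simp: norm_mult)

lemma bnd_mon: "0 \<le> r \<Longrightarrow> bnd r (mon a) (r ^ mdeg a)"
proof (rule bndI)
  fix A :: "(nat ^ 'a) set" assume *: "0 \<le> r" "finite A"
  have "(\<Sum>m\<in>A. norm (coef (mon a) m) * r ^ mdeg m) = (\<Sum>m\<in>A. if m = a then r ^ mdeg a else 0)"
    by (intro sum.cong) (auto simp: coef_mon)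
  thus "(\<Sum>m\<in>A. norm (coef (mon a) m) * r ^ mdeg m) \<le> r ^ mdeg a" using * by simp
qed

lemma bnd_1: "bnd r 1 1"
proof (rule bndI)
  fix A :: "(nat ^ 'a) set" assume *: "finite A"
  have "(\<Sum>m\<in>A. norm (coef 1 m) * r ^ mdeg m) = (\<Sum>m\<in>A. if m = 0 then 1 else 0)"
    by (intro sum.cong) (auto simp: coef_1)
  thus "(\<Sum>m\<in>A. norm (coef 1 m) * r ^ mdeg m) \<le> 1" using * by simp
qed

lemma bnd_mult:
  assumes "0 \<le> r" "bnd r F B" "bnd r G C" shows "bnd r (F * G) (B * C)"
proof (rule bndI)
  fix A :: "(nat ^ 'a) set" assume A: "finite A"
  define D where "D = (\<Union>m\<in>A. fst ` splits m \<union> snd ` splits m)"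
  have D: "finite D" using A by (simp add: D_def)
  let ?f = "\<lambda>m. norm (coef F m) * r ^ mdeg m" and ?g = "\<lambda>m. norm (coef G m) * r ^ mdeg m"
  have "(\<Sum>m\<in>A. norm (coef (F * G) m) * r ^ mdeg m) \<le> (\<Sum>m\<in>A. \<Sum>(a, b)\<in>splits m. ?f a * ?g b)"
  proof (rule sum_mono)
    fix m
    have "norm (coef (F * G) m) \<le> (\<Sum>(a, b)\<in>splits m. norm (coef F a) * norm (coef G b))"
      unfolding coef_mult by (rule order_trans[OF norm_sum]) (simp add: case_prod_unfold norm_mult)
    hence "norm (coef (F * G) m) * r ^ mdeg m \<le> (\<Sum>(a, b)\<in>splits m. norm (coef F a) * norm (coef G b)) * r ^ mdeg m"
      using assms(1) by (intro mult_right_mono) auto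
    also have "\<dots> = (\<Sum>(a, b)\<in>splits m. ?f a * ?g b)"
      unfolding sum_distrib_right by (intro sum.cong) (auto simp: mdeg_add power_add splits_def)
    finally show "norm (coef (F * G) m) * r ^ mdeg m \<le> (\<Sum>(a, b)\<in>splits m. ?f a * ?g b)" .
  qed
  also have "\<dots> = (\<Sum>(m, p)\<in>Sigma A splits. ?f (fst p) * ?g (snd p))"
    using A by (subst sum.Sigma[symmetric]) (auto simp: case_prod_unfold)
  also have "\<dots> = (\<Sum>p\<in>snd ` Sigma A splits. ?f (fst p) * ?g (snd p))"
    by (subst sum.reindex) (auto simp: inj_on_def splits_def case_prod_unfold)
  also have "\<dots> \<le> (\<Sum>p\<in>D \<times> D. ?f (fst p) * ?g (snd p))"
  proof (rule sum_mono2)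
    show "snd ` Sigma A splits \<subseteq> D \<times> D"
    proof
      fix p assume "p \<in> snd ` Sigma A splits"
      then obtain m where "m \<in> A" "p \<in> splits m" by auto
      thus "p \<in> D \<times> D" unfolding D_def by (auto simp: mem_Times_iff)
    qed
  qed (use assms(1) D in auto)
  also have "\<dots> = (\<Sum>a\<in>D. ?f a) * (\<Sum>b\<in>D. ?g b)"
    by (simp add: sum_product sum.cartesian_product case_prod_unfold)
  also have "\<dots> \<le> B * C"
    using assms D bnd_nonneg[OF assms(2)] by (intro mult_mono bndD sum_nonneg) auto
  finally show "(\<Sum>m\<in>A. norm (coef (F * G) m) * r ^ mdeg m) \<le> B * C" .
qed

lemma bnd_power: "0 \<le> r \<Longrightarrow> bnd r F B \<Longrightarrow> bnd r (F ^ n) (B ^ n)"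
  by (induction n) (auto simp: bnd_1 intro: bnd_mult)

lemma bnd_prod: "0 \<le> r \<Longrightarrow> (\<And>x. x \<in> A \<Longrightarrow> bnd r (F x) (B x)) \<Longrightarrow> bnd r (prod F A) (prod B A)"
  by (induction A rule: infinite_finite_induct) (auto simp: bnd_1 intro: bnd_mult)

lemma bnd_mprod:
  assumes "0 \<le> r" "\<And>i. bnd r (P i) s" shows "bnd r (mprod P m) (s ^ mdeg m)"
  using bnd_prod[of r UNIV "\<lambda>i. P i ^ (m $ i)" "\<lambda>i. s ^ (m $ i)"] assms
  by (auto simp: mprod_def mdeg_def power_sum intro: bnd_power)

text \<open>Controls the double series of a substitution on finite rectangles. It serves twice: for
  the norm of the composite, and for the absolute summability behind
  \<open>eval_mcomp\<close>.\<close>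

lemma bnd_mcomp_rect:
  assumes "0 \<le> r" "\<And>i. bnd r (P i) s" "bnd s F M" "finite A" "finite D"
  shows "(\<Sum>m\<in>D. \<Sum>k\<in>A. norm (coef F m) * (norm (coef (mprod P m) k) * r ^ mdeg k)) \<le> M"
proof -
  have "(\<Sum>m\<in>D. \<Sum>k\<in>A. norm (coef F m) * (norm (coef (mprod P m) k) * r ^ mdeg k))
      \<le> (\<Sum>m\<in>D. norm (coef F m) * s ^ mdeg m)"
    unfolding sum_distrib_left[symmetric] using assms
    by (intro sum_mono mult_left_mono bndD[OF bnd_mprod]) auto
  also have "\<dots> \<le> M" using assms by (intro bndD)
  finally show ?thesis .
qed

lemma bnd_mcomp:
  assumes "0 \<le> r" "\<And>i. bnd r (P i) s" "bnd s F M" shows "bnd r (mcomp F P) M"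
proof (rule bndI)
  fix A :: "(nat ^ 'a) set" assume A: "finite A"
  define D where "D = (\<Union>k\<in>A. {m :: nat ^ 'a. mdeg m \<le> mdeg k})"
  have D: "finite D" using A by (simp add: D_def finite_mdeg_le)
  have "(\<Sum>k\<in>A. norm (coef (mcomp F P) k) * r ^ mdeg k)
      \<le> (\<Sum>k\<in>A. \<Sum>m\<in>D. norm (coef F m) * (norm (coef (mprod P m) k) * r ^ mdeg k))"
  proof (rule sum_mono)
    fix k assume k: "k \<in> A"
    have "norm (coef (mcomp F P) k) \<le> (\<Sum>m | mdeg m \<le> mdeg k. norm (coef F m) * norm (coef (mprod P m) k))"
      unfolding mcomp_def coef_Mps by (rule order_trans[OF norm_sum]) (simp add: norm_mult)
    also have "\<dots> \<le> (\<Sum>m\<in>D. norm (coef F m) * norm (coef (mprod P m) k))"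
      using D k by (intro sum_mono2) (auto simp: D_def)
    finally have "norm (coef (mcomp F P) k) * r ^ mdeg k \<le> (\<Sum>m\<in>D. norm (coef F m) * norm (coef (mprod P m) k)) * r ^ mdeg k"
      using assms(1) by (intro mult_right_mono) auto
    thus "norm (coef (mcomp F P) k) * r ^ mdeg k \<le> (\<Sum>m\<in>D. norm (coef F m) * (norm (coef (mprod P m) k) * r ^ mdeg k))"
      by (simp add: sum_distrib_right mult.assoc)
  qed
  also have "\<dots> \<le> M"
    by (subst sum.swap) (intro bnd_mcomp_rect[OF assms A D])
  finally show "(\<Sum>k\<in>A. norm (coef (mcomp F P) k) * r ^ mdeg k) \<le> M" .
qed

text \<open>The analogue of the Schwarz lemma: all exponents have degree at least \<open>k\<close>,
  so shrinking the radius gains \<open>(r / s) ^ k\<close>. With \<open>k = 2\<close> this gain is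
  what makes small balls invariant.\<close>

lemma bnd_of_ord_ge:
  assumes "ord_ge (\<lambda>_. 1) k F" "bnd s F M" "0 \<le> r" "r \<le> s" "0 < s"
  shows "bnd r F (M * (r / s) ^ k)"
proof (rule bndI)
  fix A :: "(nat ^ 'a) set" assume A: "finite A"
  have "(\<Sum>m\<in>A. norm (coef F m) * r ^ mdeg m) \<le> (\<Sum>m\<in>A. (norm (coef F m) * s ^ mdeg m) * (r / s) ^ k)"
  proof (rule sum_mono)
    fix m
    show "norm (coef F m) * r ^ mdeg m \<le> (norm (coef F m) * s ^ mdeg m) * (r / s) ^ k"
    proof (cases "mdeg m < k")
      case True thus ?thesis using assms(1) by (simp add: ord_ge_def wdeg_1)
    next
      case False
      have "(r / s) ^ mdeg m \<le> (r / s) ^ k"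
        using False assms by (intro power_decreasing) auto
      hence "s ^ mdeg m * (r / s) ^ mdeg m \<le> s ^ mdeg m * (r / s) ^ k"
        using assms by (intro mult_left_mono) auto
      moreover have "s ^ mdeg m * (r / s) ^ mdeg m = r ^ mdeg m" using assms by (simp add: power_divide)
      ultimately show ?thesis by (simp add: mult_left_mono mult.assoc)
    qed
  qed
  also have "\<dots> \<le> M * (r / s) ^ k"
    unfolding sum_distrib_right[symmetric] using assms A by (intro mult_right_mono bndD) auto
  finally show "(\<Sum>m\<in>A. norm (coef F m) * r ^ mdeg m) \<le> M * (r / s) ^ k" .
qed

lemma bnd_smaller: "bnd s F M \<Longrightarrow> 0 \<le> r \<Longrightarrow> r \<le> s \<Longrightarrow> bnd r F M"
proof (rule bndI)
  fix A :: "(nat ^ 'a) set" assume *: "bnd s F M" "0 \<le> r" "r \<le> s" "finite A"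
  have "(\<Sum>m\<in>A. norm (coef F m) * r ^ mdeg m) \<le> (\<Sum>m\<in>A. norm (coef F m) * s ^ mdeg m)"
    using * by (intro sum_mono mult_left_mono power_mono) auto
  thus "(\<Sum>m\<in>A. norm (coef F m) * r ^ mdeg m) \<le> M" using * bndD order_trans by blast
qed

text \<open>A Cauchy estimate: halving the radius absorbs the factor \<open>m $ i + 1\<close>, which
  is at most \<open>2 ^ mdeg m\<close>.\<close>

lemma bnd_pd:
  assumes "bnd r F B" "0 < r" shows "bnd (r / 2) (pd i F) (B / r)"
proof (rule bndI)
  fix A :: "(nat ^ 'a) set" assume A: "finite A"
  have "(\<Sum>m\<in>A. norm (coef (pd i F) m) * (r / 2) ^ mdeg m)
      \<le> (\<Sum>m\<in>A. norm (coef F (m + axis i 1)) * r ^ mdeg (m + axis i 1) / r)"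
  proof (rule sum_mono)
    fix m
    have "m $ i + 1 \<le> 2 ^ (m $ i)" using Suc_leI[OF less_exp, of "m $ i"] by simp
    also have "\<dots> \<le> 2 ^ mdeg m" using nth_le_mdeg[of m i] by (intro power_increasing) auto
    finally have "real (m $ i + 1) \<le> 2 ^ mdeg m" by (metis of_nat_le_iff of_nat_numeral of_nat_power)
    hence "norm (coef F (m + axis i 1)) * r ^ mdeg m * (real (m $ i + 1) / 2 ^ mdeg m) \<le> norm (coef F (m + axis i 1)) * r ^ mdeg m * 1"
      using assms by (intro mult_left_mono) auto
    moreover have "norm (coef (pd i F) m) = real (m $ i + 1) * norm (coef F (m + axis i 1))"
      unfolding coef_pd norm_mult norm_of_nat ..
    ultimately show "norm (coef (pd i F) m) * (r / 2) ^ mdeg m \<le> norm (coef F (m + axis i 1)) * r ^ mdeg (m + axis i 1) / r"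
      using assms by (simp add: mdeg_add power_divide power_add mult_ac)
  qed
  also have "\<dots> = (\<Sum>m\<in>(\<lambda>m. m + axis i 1) ` A. norm (coef F m) * r ^ mdeg m) / r"
    by (subst sum.reindex) (auto simp: inj_on_def sum_divide_distrib)
  also have "\<dots> \<le> B / r" using A assms by (intro divide_right_mono bndD) auto
  finally show "(\<Sum>m\<in>A. norm (coef (pd i F) m) * (r / 2) ^ mdeg m) \<le> B / r" .
qed

subsection \<open>Evaluation\<close>

definition eval :: "'n::finite mps \<Rightarrow> complex ^ 'n \<Rightarrow> complex" where
  "eval F x = (\<Sum>\<^sub>\<infinity>m. coef F m * mpow x m)"

lemma mpow_add: "mpow x (a + b) = mpow x a * mpow x b"
  by (simp add: mpow_def power_add prod.distrib)

lemma mpow_0 [simp]: "mpow x 0 = 1"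
  by (simp add: mpow_def)

lemma mpow_axis [simp]: "mpow x (axis i k) = x $ i ^ k"
proof -
  have "mpow x (axis i k) = (\<Prod>j\<in>UNIV. if j = i then x $ i ^ k else 1)"
    unfolding mpow_def by (intro prod.cong) (auto simp: axis_def)
  thus ?thesis by simp
qed

lemma mpow_zero: "mpow 0 m = (if m = 0 then 1 else 0)"
proof (cases "m = 0")
  case False
  then obtain i where "m $ i \<noteq> 0" by (auto simp: vec_eq_iff)
  thus ?thesis using False unfolding mpow_def by (auto intro!: bexI[of _ i])
qed simp

lemma norm_mpow_le: "(\<And>i. norm (x $ i) \<le> r) \<Longrightarrow> norm (mpow x m) \<le> r ^ mdeg m"
  unfolding mpow_def mdeg_def power_sum prod_norm[symmetric] norm_power by (intro prod_mono) (auto intro: power_mono)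

lemma bnd_summable:
  assumes "bnd r F B" "0 \<le> r" shows "(\<lambda>m. norm (coef F m) * r ^ mdeg m) summable_on UNIV"
  by (rule nonneg_bdd_above_summable_on) (use assms bndD in \<open>auto intro!: bdd_aboveI2\<close>)

lemma bnd_infsum:
  assumes "(\<lambda>m. norm (coef F m) * r ^ mdeg m) summable_on UNIV" "0 \<le> r"
  shows "bnd r F (\<Sum>\<^sub>\<infinity>m. norm (coef F m) * r ^ mdeg m)"
  using assms by (intro bndI finite_sum_le_infsum) auto

lemma eval_abs_summable:
  assumes "bnd r F B" "0 \<le> r" "\<And>i. norm (x $ i) \<le> r"
  shows "(\<lambda>m. coef F m * mpow x m) abs_summable_on UNIV"
  by (rule Infinite_Sum.abs_summable_on_comparison_test'[OF bnd_summable[OF assms(1,2)]])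
     (use assms in \<open>auto simp: norm_mult intro!: mult_left_mono norm_mpow_le\<close>)

lemma eval_has_sum:
  assumes "bnd r F B" "0 \<le> r" "\<And>i. norm (x $ i) \<le> r"
  shows "((\<lambda>m. coef F m * mpow x m) has_sum eval F x) UNIV"
  unfolding eval_def using abs_summable_summable[OF eval_abs_summable[OF assms]] by (rule has_sum_infsum)

lemma eval_add:
  assumes "bnd r F B" "bnd r G C" "0 \<le> r" "\<And>i. norm (x $ i) \<le> r"
  shows "eval (F + G) x = eval F x + eval G x"
  unfolding eval_def[of "F + G"] using has_sum_add[OF eval_has_sum[OF assms(1,3,4)] eval_has_sum[OF assms(2,3,4)]]
  by (auto intro!: infsumI simp: ring_distribs)

lemma eval_mon: "eval (mon a) x = mpow x a"
  unfolding eval_def by (intro infsumI has_sum_finite_neutralI[where B = "{a}"]) (auto simp: coef_mon)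

lemma eval_cst: "eval (cst c) x = c"
  unfolding eval_def by (intro infsumI has_sum_finite_neutralI[where B = "{0}"]) (auto simp: coef_cst)

text \<open>The absolutely summable double series is regrouped along the fibres of
  \<open>(a, b) \<mapsto> a + b\<close>.\<close>

lemma eval_mult:
  assumes "bnd r F B" "bnd r G C" "0 \<le> r" "\<And>i. norm (x $ i) \<le> r"
  shows "eval (F * G) x = eval F x * eval G x"
proof -
  let ?f = "\<lambda>m. coef F m * mpow x m" and ?g = "\<lambda>m. coef G m * mpow x m"
  have f: "?f abs_summable_on UNIV" and g: "?g abs_summable_on UNIV"
    using eval_abs_summable assms by blast+
  have fg: "(\<lambda>(a, b). ?f a * ?g b) abs_summable_on (UNIV \<times> UNIV)"
    unfolding Infinite_Sum.abs_summable_on_Sigma_iff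
    using f g by (auto simp: norm_mult infsum_cmult_right' abs_mult intro!: summable_on_cmult_right summable_on_cmult_left)
  have bij: "bij_betw snd (Sigma UNIV splits) (UNIV \<times> UNIV :: ((nat ^ 'a) \<times> (nat ^ 'a)) set)"
    by (rule bij_betwI[where g = "\<lambda>p. (fst p + snd p, p)"]) (auto simp: splits_def)
  have sg: "(\<lambda>p. case snd p of (a, b) \<Rightarrow> ?f a * ?g b) summable_on Sigma UNIV splits"
    using abs_summable_summable[OF fg] summable_on_reindex_bij_betw[OF bij] by blast
  have "eval F x * eval G x = (\<Sum>\<^sub>\<infinity>a. \<Sum>\<^sub>\<infinity>b. ?f a * ?g b)"
    unfolding eval_def by (simp add: infsum_cmult_right' infsum_cmult_left')
  also have "\<dots> = (\<Sum>\<^sub>\<infinity>(a, b)\<in>UNIV \<times> UNIV. ?f a * ?g b)"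
    using abs_summable_summable[OF fg] by (rule infsum_Sigma'_banach)
  also have "\<dots> = (\<Sum>\<^sub>\<infinity>p\<in>Sigma UNIV splits. case snd p of (a, b) \<Rightarrow> ?f a * ?g b)"
    by (rule infsum_reindex_bij_betw[OF bij, symmetric])
  also have "\<dots> = (\<Sum>\<^sub>\<infinity>m. \<Sum>\<^sub>\<infinity>p\<in>splits m. case p of (a, b) \<Rightarrow> ?f a * ?g b)"
    using infsum_Sigma_banach[OF sg] by simp
  also have "\<dots> = eval (F * G) x"
    unfolding eval_def
  proof (rule infsum_cong)
    fix m
    show "(\<Sum>\<^sub>\<infinity>p\<in>splits m. case p of (a, b) \<Rightarrow> ?f a * ?g b) = coef (F * G) m * mpow x m"
      unfolding coef_mult sum_distrib_right
      by simp (intro sum.cong, auto simp: splits_def mpow_add)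
  qed
  finally show ?thesis by simp
qed

lemma eval_power:
  assumes "bnd r F B" "0 \<le> r" "\<And>i. norm (x $ i) \<le> r" shows "eval (F ^ n) x = eval F x ^ n"
proof (induction n)
  case 0 show ?case using eval_mon[of 0 x] by simp
next
  case (Suc n) thus ?case using eval_mult[OF assms(1) bnd_power[OF assms(2,1)] assms(2,3)] by simp
qed

lemma eval_prod:
  assumes "\<And>j. j \<in> A \<Longrightarrow> bnd r (F j) (B j)" "0 \<le> r" "\<And>i. norm (x $ i) \<le> r"
  shows "eval (prod F A) x = (\<Prod>j\<in>A. eval (F j) x)"
  using assms
proof (induction A rule: infinite_finite_induct)
  case (insert j A)
  have "eval (F j * prod F A) x = eval (F j) x * eval (prod F A) x"
    using insert by (intro eval_mult[of r _ "B j" _ "prod B A"] bnd_prod) auto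
  thus ?case using insert by simp
qed (use eval_mon[of 0 x] in simp_all)

lemma eval_mprod:
  assumes "\<And>j. bnd r (P j) s" "0 \<le> r" "\<And>i. norm (x $ i) \<le> r"
  shows "eval (mprod P m) x = mpow (\<chi> i. eval (P i) x) m"
proof -
  have "eval (mprod P m) x = (\<Prod>i\<in>UNIV. eval (P i ^ (m $ i)) x)"
    unfolding mprod_def using assms by (intro eval_prod[of _ r _ "\<lambda>i. s ^ (m $ i)"] bnd_power) auto
  also have "\<dots> = (\<Prod>i\<in>UNIV. eval (P i) x ^ (m $ i))"
    by (intro prod.cong eval_power[OF assms(1)]) (use assms in auto)
  finally show ?thesis by (simp add: mpow_def)
qed

text \<open>The sums over \<open>m\<close> and \<open>k\<close> are interchanged; afterwards the sum
  over \<open>m\<close> is finite because \<open>P\<close> has no constant terms.\<close>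

lemma eval_mcomp:
  assumes "no_const P" "\<And>i. bnd r (P i) s" "bnd s F M" "0 \<le> r" "\<And>i. norm (x $ i) \<le> r"
  shows "eval (mcomp F P) x = eval F (\<chi> i. eval (P i) x)"
proof -
  let ?h = "\<lambda>m k. coef F m * (coef (mprod P m) k * mpow x k)"
  have "(\<lambda>(m, k). ?h m k) abs_summable_on (UNIV \<times> UNIV)"
  proof (rule nonneg_bdd_above_summable_on)
    show "bdd_above (sum (\<lambda>p. norm (case p of (m, k) \<Rightarrow> ?h m k)) ` {F. F \<subseteq> UNIV \<times> UNIV \<and> finite F})"
    proof (rule bdd_aboveI2)
      fix E :: "((nat ^ 'a) \<times> (nat ^ 'a)) set" assume "E \<in> {F. F \<subseteq> UNIV \<times> UNIV \<and> finite F}"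
      hence E: "finite E" by simp
      have "(\<Sum>p\<in>E. norm (case p of (m, k) \<Rightarrow> ?h m k))
          \<le> (\<Sum>p\<in>E. norm (coef F (fst p)) * (norm (coef (mprod P (fst p)) (snd p)) * r ^ mdeg (snd p)))"
        using norm_mpow_le[of x r] assms(5)
        by (intro sum_mono) (auto simp: norm_mult case_prod_unfold intro!: mult_left_mono)
      also have "\<dots> \<le> (\<Sum>p\<in>fst ` E \<times> snd ` E. norm (coef F (fst p)) * (norm (coef (mprod P (fst p)) (snd p)) * r ^ mdeg (snd p)))"
      proof (rule sum_mono2)
        show "E \<subseteq> fst ` E \<times> snd ` E" by (auto intro: rev_image_eqI)
      qed (use E assms(4) in auto)
      also have "\<dots> = (\<Sum>m\<in>fst ` E. \<Sum>k\<in>snd ` E. norm (coef F m) * (norm (coef (mprod P m) k) * r ^ mdeg k))"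
        by (simp add: sum.cartesian_product case_prod_unfold)
      also have "\<dots> \<le> M" using E by (intro bnd_mcomp_rect[OF assms(4,2,3)]) auto
      finally show "(\<Sum>p\<in>E. norm (case p of (m, k) \<Rightarrow> ?h m k)) \<le> M" .
    qed
  qed auto
  hence sm: "(\<lambda>(m, k). ?h m k) summable_on (UNIV \<times> UNIV)" by (rule abs_summable_summable)
  have "eval F (\<chi> i. eval (P i) x) = (\<Sum>\<^sub>\<infinity>m. \<Sum>\<^sub>\<infinity>k. ?h m k)"
    unfolding eval_def[of F] eval_mprod[OF assms(2,4,5), symmetric]
    by (simp add: eval_def infsum_cmult_right')
  also have "\<dots> = (\<Sum>\<^sub>\<infinity>k. \<Sum>\<^sub>\<infinity>m. ?h m k)" by (rule infsum_swap_banach[OF sm])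
  also have "\<dots> = eval (mcomp F P) x"
    unfolding eval_def
  proof (rule infsum_cong)
    fix k
    have "((\<lambda>m. ?h m k) has_sum (\<Sum>m | mdeg m \<le> mdeg k. ?h m k)) UNIV"
      by (rule has_sum_finite_neutralI) (auto simp: finite_mdeg_le no_const_mprod[OF assms(1)])
    thus "(\<Sum>\<^sub>\<infinity>m. ?h m k) = coef (mcomp F P) k * mpow x k"
      by (simp add: infsumI mcomp_def sum_distrib_right mult.assoc)
  qed
  finally show ?thesis by simp
qed

lemma norm_eval_le:
  assumes "bnd r F B" "0 \<le> r" "\<And>i. norm (x $ i) \<le> r" shows "norm (eval F x) \<le> B"
proof -
  have "norm (eval F x) \<le> (\<Sum>\<^sub>\<infinity>m. norm (coef F m) * r ^ mdeg m)"
    by (rule norm_infsum_le[OF eval_has_sum[OF assms] has_sum_infsum[OF bnd_summable[OF assms(1,2)]]])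
       (use assms in \<open>auto simp: norm_mult intro!: mult_left_mono norm_mpow_le\<close>)
  also have "\<dots> \<le> B"
    by (rule infsum_le_finite_sums[OF bnd_summable[OF assms(1,2)]]) (use bndD[OF assms(1)] in auto)
  finally show ?thesis .
qed

lemma eval_uniform_limit:
  assumes "bnd r F B" "0 \<le> r" "\<And>x i. x \<in> S \<Longrightarrow> norm (x $ i) \<le> r"
  shows "uniform_limit S (\<lambda>X x. \<Sum>m\<in>X. coef F m * mpow x m) (eval F) (finite_subsets_at_top UNIV)"
  unfolding eval_def
  by (rule Weierstrass_m_test_general[OF _ bnd_summable[OF assms(1,2)]])
     (use assms in \<open>auto simp: norm_mult intro!: mult_left_mono norm_mpow_le\<close>)

lemma continuous_on_eval:
  assumes "bnd r F B" "0 \<le> r" "\<And>x i. x \<in> S \<Longrightarrow> norm (x $ i) \<le> r"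
  shows "continuous_on S (eval F)"
  by (rule uniform_limit_theorem[OF _ eval_uniform_limit[OF assms]])
     (auto simp: mpow_def intro!: continuous_intros always_eventually)

lemma has_field_derivative_mpow:
  "((\<lambda>t. mpow (x + axis i t) m) has_field_derivative of_nat (m $ i) * mpow (x + axis i t) (dec i m)) (at t)"
proof -
  define C where "C = (\<Prod>j\<in>UNIV - {i}. x $ j ^ (m $ j))"
  have e: "mpow (x + axis i t) m' = (x $ i + t) ^ (m' $ i) * (\<Prod>j\<in>UNIV - {i}. x $ j ^ (m' $ j))" for t m'
    unfolding mpow_def by (subst prod.remove[of _ i]) (auto simp: axis_def intro!: prod.cong)
  have d: "(\<Prod>j\<in>UNIV - {i}. x $ j ^ (dec i m $ j)) = C"
    unfolding C_def by (intro prod.cong) (auto simp: dec_def)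
  have "((\<lambda>t. (x $ i + t) ^ (m $ i) * C) has_field_derivative (of_nat (m $ i) * (x $ i + t) ^ (m $ i - 1) * C)) (at t)"
    by (auto intro!: derivative_eq_intros simp: One_nat_def)
  thus ?thesis unfolding e d by (simp add: C_def dec_def mult.assoc)
qed

lemma pd_has_sum:
  assumes "bnd r F B" "0 < r" "\<And>j. norm (x $ j) \<le> r / 2"
  shows "((\<lambda>m. coef F m * (of_nat (m $ i) * mpow x (dec i m))) has_sum eval (pd i F) x) UNIV"
proof -
  let ?h = "\<lambda>m :: nat ^ 'a. m + axis i 1" and ?g = "\<lambda>m. coef F m * (of_nat (m $ i) * mpow x (dec i m))"
  have "((\<lambda>m. coef (pd i F) m * mpow x m) has_sum eval (pd i F) x) UNIV"
    using assms by (intro eval_has_sum[OF bnd_pd[OF assms(1,2)]]) auto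
  also have "(\<lambda>m. coef (pd i F) m * mpow x m) = ?g \<circ> ?h"
    by (rule ext) (simp add: coef_pd mult_ac)
  finally have "(?g \<circ> ?h has_sum eval (pd i F) x) UNIV" .
  moreover have "inj ?h" by (simp add: inj_on_def)
  ultimately have "(?g has_sum eval (pd i F) x) (range ?h)"
    using has_sum_reindex by blast
  moreover have "?g m = 0" if "m \<notin> range ?h" for m
  proof -
    have "m $ i = 0" using that add_dec[of m i] by (metis rangeI)
    thus ?thesis by simp
  qed
  ultimately show ?thesis
    by (subst has_sum_cong_neutral[where S = UNIV and T = "range ?h" and g = ?g]) auto
qed

text \<open>In one coordinate the finite partial sums converge uniformly on a closed disc, so by
  Weierstrass their derivatives converge to the derivative of the limit; \<open>pd_has_sum\<close>
  identifies that limit.\<close>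

lemma has_field_derivative_eval:
  assumes "bnd r F B" "0 < r" "\<And>j. norm (x $ j) < r / 2"
  shows "((\<lambda>t. eval F (x + axis i t)) has_field_derivative eval (pd i F) x) (at 0)"
proof -
  \<comment> \<open>Moving coordinate \<open>i\<close> by at most \<open>\<rho>\<close> keeps it
    within \<open>r / 2\<close>.\<close>
  define \<rho> where "\<rho> = r / 2 - norm (x $ i)"
  have \<rho>: "\<rho> > 0" using assms(3)[of i] by (simp add: \<rho>_def)
  have small: "norm ((x + axis i t) $ j) \<le> r / 2" if "t \<in> cball 0 \<rho>" for t j
  proof (cases "j = i")
    case True
    have "norm (x $ i + t) \<le> norm (x $ i) + norm t" by (rule norm_triangle_ineq)
    thus ?thesis using True that by (simp add: \<rho>_def axis_def)
  next
    case False
    thus ?thesis using assms(3)[of j] by (simp add: axis_def)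
  qed
  have small': "norm ((x + axis i t) $ j) \<le> r" if "t \<in> cball 0 \<rho>" for t j
    using small[OF that, of j] assms(2) by linarith
  obtain g' where g': "\<And>t. t \<in> ball 0 \<rho> \<Longrightarrow> ((\<lambda>t. eval F (x + axis i t)) has_field_derivative g' t) (at t) \<and>
     ((\<lambda>X. \<Sum>m\<in>X. coef F m * (of_nat (m $ i) * mpow (x + axis i t) (dec i m))) \<longlongrightarrow> g' t) (finite_subsets_at_top UNIV)"
  proof (rule has_complex_derivative_uniform_limit[where z = 0 and r = \<rho> and F = "finite_subsets_at_top UNIV"
        and f = "\<lambda>X t. \<Sum>m\<in>X. coef F m * mpow (x + axis i t) m"
        and f' = "\<lambda>X t. \<Sum>m\<in>X. coef F m * (of_nat (m $ i) * mpow (x + axis i t) (dec i m))"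
        and g = "\<lambda>t. eval F (x + axis i t)"])
    have d: "((\<lambda>t. \<Sum>m\<in>X. coef F m * mpow (x + axis i t) m) has_field_derivative
          (\<Sum>m\<in>X. coef F m * (of_nat (m $ i) * mpow (x + axis i t) (dec i m)))) (at t)" for X t
      by (intro DERIV_sum DERIV_cmult has_field_derivative_mpow)
    show "\<forall>\<^sub>F X in finite_subsets_at_top UNIV.
       continuous_on (cball 0 \<rho>) (\<lambda>t. \<Sum>m\<in>X. coef F m * mpow (x + axis i t) m) \<and>
       (\<forall>t\<in>ball 0 \<rho>. ((\<lambda>t. \<Sum>m\<in>X. coef F m * mpow (x + axis i t) m) has_field_derivative
          (\<Sum>m\<in>X. coef F m * (of_nat (m $ i) * mpow (x + axis i t) (dec i m)))) (at t))"
      using d by (intro always_eventually allI conjI ballI)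
         (blast intro: DERIV_isCont continuous_at_imp_continuous_on)+
    show "uniform_limit (cball 0 \<rho>) (\<lambda>X t. \<Sum>m\<in>X. coef F m * mpow (x + axis i t) m)
        (\<lambda>t. eval F (x + axis i t)) (finite_subsets_at_top UNIV)"
      unfolding eval_def
      by (rule Weierstrass_m_test_general[OF _ bnd_summable[OF assms(1)]])
         (use assms(2) small' in \<open>auto simp: norm_mult intro!: mult_left_mono norm_mpow_le\<close>)
  qed (use \<rho> in auto)
  have 1: "((\<lambda>t. eval F (x + axis i t)) has_field_derivative g' 0) (at 0)"
    and 2: "((\<lambda>X. \<Sum>m\<in>X. coef F m * (of_nat (m $ i) * mpow x (dec i m))) \<longlongrightarrow> g' 0) (finite_subsets_at_top UNIV)"
    using g'[of 0] \<rho> by (simp_all only: axis_0 add_0_right centre_in_ball simp_thms)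
  have 3: "((\<lambda>X. \<Sum>m\<in>X. coef F m * (of_nat (m $ i) * mpow x (dec i m))) \<longlongrightarrow> eval (pd i F) x) (finite_subsets_at_top UNIV)"
    using pd_has_sum[OF assms(1,2), of x i] assms(3) less_imp_le unfolding has_sum_def by blast
  have "g' 0 = eval (pd i F) x" by (rule tendsto_unique[OF finite_subsets_at_top_neq_bot 2 3])
  thus ?thesis using 1 by simp
qed

subsection \<open>Germs and their Taylor series\<close>

definition conv :: "'n::finite mps \<Rightarrow> bool" where
  "conv F \<longleftrightarrow> (\<exists>r>0. \<exists>B. bnd r F B)"

lemma convI: "bnd r F B \<Longrightarrow> 0 < r \<Longrightarrow> conv F"
  by (auto simp: conv_def)

lemma eventually_polydisc: "r > 0 \<Longrightarrow> \<forall>\<^sub>F x :: complex ^ 'n in nhds 0. \<forall>i. norm (x $ i) < r"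
  unfolding eventually_nhds_metric
  by (intro exI[of _ r]) (auto simp: dist_norm intro: le_less_trans[OF Finite_Cartesian_Product.norm_nth_le])

text \<open>Pointwise convergence already gives a majorant: unconditional summability of complex
  numbers is absolute, and at a point with all coordinates equal to \<open>r > 0\<close> it is
  finiteness of the weighted \<open>l\<^sup>1\<close> norm.\<close>

lemma has_taylor_iff:
  "has_taylor f (coef F) \<longleftrightarrow> conv F \<and> (\<forall>\<^sub>F x in nhds 0. f x = eval F x)"
proof
  assume "has_taylor f (coef F)"
  hence ev: "\<forall>\<^sub>F x in nhds 0. ((\<lambda>m. coef F m * mpow x m) has_sum f x) UNIV" by (simp add: has_taylor_def)
  then obtain d where d: "d > 0" "\<And>x. norm x < d \<Longrightarrow> ((\<lambda>m. coef F m * mpow x m) has_sum f x) UNIV"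
    unfolding eventually_nhds_metric by (auto simp: dist_norm)
  \<comment> \<open>The vector with all coordinates \<open>r\<close> then has norm at most
    \<open>d / 2\<close>.\<close>
  define r where "r = d / (2 * CARD('a))"
  define x :: "complex ^ 'a" where "x = (\<chi> i. of_real r)"
  have r: "r > 0" using d by (simp add: r_def)
  have "norm x \<le> (\<Sum>i\<in>UNIV. norm (x $ i))" unfolding norm_vec_def by (rule L2_set_le_sum) simp
  also have "\<dots> = CARD('a) * r" using r by (simp add: x_def)
  also have "\<dots> = d / 2" by (simp add: r_def)
  also have "\<dots> < d" using d by simp
  finally have "(\<lambda>m. coef F m * mpow x m) summable_on UNIV" using d(2) has_sum_imp_summable by blast
  hence "(\<lambda>m. norm (coef F m * mpow x m)) summable_on UNIV"
    by (subst summable_on_iff_abs_summable_on_complex[symmetric])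
  moreover have "norm (mpow x m) = r ^ mdeg m" for m
    using r unfolding mpow_def prod_norm[symmetric] mdeg_def power_sum by (simp add: x_def norm_power)
  ultimately have "(\<lambda>m. norm (coef F m) * r ^ mdeg m) summable_on UNIV" by (simp add: norm_mult)
  hence "conv F" using bnd_infsum[of F r] r convI by auto
  moreover have "\<forall>\<^sub>F x in nhds 0. f x = eval F x"
    using ev by eventually_elim (simp add: eval_def infsumI)
  ultimately show "conv F \<and> (\<forall>\<^sub>F x in nhds 0. f x = eval F x)" ..
next
  assume *: "conv F \<and> (\<forall>\<^sub>F x in nhds 0. f x = eval F x)"
  then obtain r B where r: "r > 0" "bnd r F B" by (auto simp: conv_def)
  from * have "\<forall>\<^sub>F x in nhds 0. f x = eval F x" by blast
  thus "has_taylor f (coef F)"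
    unfolding has_taylor_def using eventually_polydisc[OF r(1)]
    by eventually_elim (use eval_has_sum[OF r(2)] r(1) in \<open>auto simp: less_imp_le\<close>)
qed

lemma ht_eval: "conv F \<Longrightarrow> has_taylor (eval F) (coef F)"
  by (simp add: has_taylor_iff)

lemma ht_conv: "has_taylor f (coef F) \<Longrightarrow> conv F"
  by (simp add: has_taylor_iff)

lemma ht_eventually_eq:
  "has_taylor f (coef F) \<Longrightarrow> has_taylor g (coef F) \<Longrightarrow> \<forall>\<^sub>F x in nhds 0. f x = g x"
  unfolding has_taylor_iff by (auto elim: eventually_elim2)

lemma ht_cong: "has_taylor f c \<Longrightarrow> \<forall>\<^sub>F x in nhds 0. f x = g x \<Longrightarrow> has_taylor g c"
  unfolding has_taylor_def by (auto elim: eventually_elim2)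

lemma analytic0_mps: "analytic0 f \<longleftrightarrow> (\<exists>F. has_taylor f (coef F))"
  unfolding analytic0_def by (metis coef_Mps)

lemma ht_add:
  assumes "has_taylor f (coef F)" "has_taylor g (coef G)"
  shows "has_taylor (\<lambda>x. f x + g x) (coef (F + G))"
proof -
  obtain r B s C where r: "r > 0" "bnd r F B" and s: "s > 0" "bnd s G C"
    using assms unfolding has_taylor_iff conv_def by blast
  define t where "t = min r s"
  have t: "t > 0" "bnd t F B" "bnd t G C" 
    using r s bnd_smaller[OF r(2), of t] bnd_smaller[OF s(2), of t] by (auto simp: t_def)
  have "\<forall>\<^sub>F x in nhds 0. f x = eval F x" "\<forall>\<^sub>F x in nhds 0. g x = eval G x"
    using assms by (auto simp: has_taylor_iff)
  hence "\<forall>\<^sub>F x in nhds 0. f x + g x = eval (F + G) x" using eventually_polydisc[OF t(1)]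
    by eventually_elim (subst eval_add[OF t(2,3)], use t in \<open>auto simp: less_imp_le\<close>)
  moreover have "conv (F + G)" using bnd_add[of t F B G C] t convI by auto
  ultimately show ?thesis by (simp add: has_taylor_iff)
qed

lemma ht_mult:
  assumes "has_taylor f (coef F)" "has_taylor g (coef G)"
  shows "has_taylor (\<lambda>x. f x * g x) (coef (F * G))"
proof -
  obtain r B s C where r: "r > 0" "bnd r F B" and s: "s > 0" "bnd s G C"
    using assms unfolding has_taylor_iff conv_def by blast
  define t where "t = min r s"
  have t: "t > 0" "bnd t F B" "bnd t G C" 
    using r s bnd_smaller[OF r(2), of t] bnd_smaller[OF s(2), of t] by (auto simp: t_def)
  have "\<forall>\<^sub>F x in nhds 0. f x = eval F x" "\<forall>\<^sub>F x in nhds 0. g x = eval G x"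
    using assms by (auto simp: has_taylor_iff)
  hence "\<forall>\<^sub>F x in nhds 0. f x * g x = eval (F * G) x" using eventually_polydisc[OF t(1)]
    by eventually_elim (subst eval_mult[OF t(2,3)], use t in \<open>auto simp: less_imp_le\<close>)
  moreover have "conv (F * G)" using bnd_mult[of t F B G C] t convI by auto
  ultimately show ?thesis by (simp add: has_taylor_iff)
qed

lemma ht_mon: "has_taylor (\<lambda>x. mpow x a) (coef (mon a))"
  using bnd_mon[of 1 a] by (auto simp: has_taylor_iff eval_mon intro!: convI[of 1])

lemma ht_Y: "has_taylor (\<lambda>x. x $ i) (coef (Y i))"
  using ht_mon[of "axis i 1"] by simp

lemma ht_1: "has_taylor (\<lambda>x. 1) (coef 1)"
  using ht_mon[of 0] by simp

lemma ht_cst: "has_taylor (\<lambda>x. c) (coef (cst c))"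
proof -
  have "bnd 1 (cst c * 1) (norm c * 1)" by (intro bnd_cst_mult bnd_1) auto
  thus ?thesis by (auto simp: has_taylor_iff eval_cst intro!: convI[of 1])
qed

lemma ht_cst_mult: "has_taylor f (coef F) \<Longrightarrow> has_taylor (\<lambda>x. c * f x) (coef (cst c * F))"
  by (intro ht_mult ht_cst)

lemma ht_diff:
  assumes "has_taylor f (coef F)" "has_taylor g (coef G)"
  shows "has_taylor (\<lambda>x. f x - g x) (coef (F - G))"
proof -
  have "has_taylor (\<lambda>x. f x + (- 1) * g x) (coef (F + cst (- 1) * G))"
    using assms by (intro ht_add ht_cst_mult)
  moreover have "F + cst (- 1) * G = F - G" by (rule mps_eqI) simp
  ultimately show ?thesis by simp
qed

lemma ht_sum:
  "(\<And>j. j \<in> A \<Longrightarrow> has_taylor (f j) (coef (F j))) \<Longrightarrow> has_taylor (\<lambda>x. \<Sum>j\<in>A. f j x) (coef (sum F A))"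
proof (induction A rule: infinite_finite_induct)
  case (insert x A)
  thus ?case using ht_add[of "f x" "F x" "\<lambda>y. \<Sum>j\<in>A. f j y" "sum F A"] by (simp del: coef_sum coef_add)
qed (use ht_cst[of 0] in \<open>simp_all add: cst_hom\<close>)

lemma ht_prod:
  "(\<And>j. j \<in> A \<Longrightarrow> has_taylor (f j) (coef (F j))) \<Longrightarrow> has_taylor (\<lambda>x. \<Prod>j\<in>A. f j x) (coef (prod F A))"
proof (induction A rule: infinite_finite_induct)
  case (insert x A)
  thus ?case using ht_mult[of "f x" "F x" "\<lambda>y. \<Prod>j\<in>A. f j y" "prod F A"] by simp
qed (use ht_1 in simp_all)

lemma ht_power: "has_taylor f (coef F) \<Longrightarrow> has_taylor (\<lambda>x. f x ^ n) (coef (F ^ n))"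
  using ht_prod[of "{..<n}" "\<lambda>_. f" "\<lambda>_. F"] by simp

lemma ht_mprod:
  "(\<And>i. has_taylor (\<lambda>x. \<phi> x $ i) (coef (P i))) \<Longrightarrow> has_taylor (\<lambda>x. mpow (\<phi> x) m) (coef (mprod P m))"
  unfolding mpow_def mprod_def by (intro ht_prod ht_power)

lemma ht_isCont:
  assumes "has_taylor f (coef F)" shows "\<forall>\<^sub>F x in nhds 0. isCont f x"
proof -
  obtain r B where r: "r > 0" "bnd r F B" and f: "\<forall>\<^sub>F x in nhds 0. f x = eval F x"
    using assms unfolding has_taylor_iff conv_def by blast
  let ?S = "{x :: complex ^ 'a. \<forall>i. norm (x $ i) < r}"
  have "?S = (\<Inter>i. {x. norm (x $ i) < r})" by auto
  moreover have "open (\<Inter>i. {x :: complex ^ 'a. norm (x $ i) < r})"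
    by (intro open_INT ballI open_Collect_less continuous_intros) auto
  ultimately have "open ?S" by simp
  moreover have "continuous_on ?S (eval F)" using r by (intro continuous_on_eval[OF r(2)]) (auto simp: less_imp_le)
  ultimately have c: "isCont (eval F) x" if "x \<in> ?S" for x
    using that continuous_on_eq_continuous_at by blast
  have "\<forall>\<^sub>F x in nhds 0. \<forall>\<^sub>F y in nhds x. f y = eval F y" using f by (simp add: eventually_eventually)
  thus ?thesis using eventually_polydisc[OF r(1)]
    by eventually_elim (use c isCont_cong in blast)
qed

lemma ht_at_0: assumes "has_taylor f (coef F)" shows "f 0 = coef F 0"
proof -
  have "f 0 = eval F 0" using assms eventually_nhds_x_imp_x by (auto simp: has_taylor_iff)
  also have "\<dots> = coef F 0"
    unfolding eval_def by (intro infsumI has_sum_finite_neutralI[where B = "{0}"]) (auto simp: mpow_zero)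
  finally show ?thesis .
qed

lemma ht_filterlim:
  fixes \<phi> :: "complex ^ 'n \<Rightarrow> complex ^ 'n"
  assumes "\<And>i. has_taylor (\<lambda>x. \<phi> x $ i) (coef (P i))" "no_const P"
  shows "filterlim \<phi> (nhds 0) (nhds 0)"
proof (rule vec_tendstoI)
  fix i
  have "isCont (\<lambda>x. \<phi> x $ i) 0" using ht_isCont[OF assms(1)] eventually_nhds_x_imp_x by blast
  hence "((\<lambda>x. \<phi> x $ i) \<longlongrightarrow> \<phi> 0 $ i) (nhds 0)" by (rule isCont_tendsto_compose) (rule filterlim_ident)
  thus "((\<lambda>x. \<phi> x $ i) \<longlongrightarrow> 0 $ i) (nhds 0)"
    using ht_at_0[OF assms(1)[of i]] assms(2) by (simp add: no_const_def)
qed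

lemma bnd_nc_small:
  fixes P :: "'n::finite \<Rightarrow> 'n mps"
  assumes "no_const P" "\<And>i. conv (P i)" "s > 0"
  obtains r where "r > 0" "\<And>i. bnd r (P i) s"
proof -
  have "\<exists>r>0. \<forall>r'. 0 < r' \<and> r' \<le> r \<longrightarrow> bnd r' (P i) s" for i
  proof -
    obtain r B where r: "r > 0" "bnd r (P i) B" using assms(2)[of i] unfolding conv_def by blast
    have B: "0 \<le> B" using r bnd_nonneg by blast
    \<comment> \<open>Order at least 1 gives the bound \<open>B * r' / r\<close>, which this choice
      of \<open>r'\<close> keeps below \<open>s\<close>; the summand 1 covers
      \<open>B = 0\<close>.\<close>
    have "bnd r' (P i) s" if "0 < r'" "r' \<le> min r (s * r / (B + 1))" for r'
    proof -
      have "bnd r' (P i) (B * (r' / r) ^ 1)" using that r assms(1) by (intro bnd_of_ord_ge) (auto simp: no_const_ord_ge)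
      moreover have "B * r' / r \<le> s"
      proof -
        have "B * r' \<le> (B + 1) * (s * r / (B + 1))" using that B r assms(3) by (intro mult_mono) auto
        also have "\<dots> = s * r" using B by simp
        finally show ?thesis using r by (simp add: pos_divide_le_eq)
      qed
      ultimately show ?thesis by (auto intro: bnd_weaken)
    qed
    moreover have "min r (s * r / (B + 1)) > 0" using r B assms(3) by simp
    ultimately show ?thesis by blast
  qed
  then obtain r where r: "\<And>i. r i > 0" "\<And>i r'. 0 < r' \<Longrightarrow> r' \<le> r i \<Longrightarrow> bnd r' (P i) s" by metis
  define r0 where "r0 = Min (range r)"
  have a: "r0 > 0" using r by (simp add: r0_def)
  have b: "r0 \<le> r i" for i by (simp add: r0_def)
  show ?thesis by (rule that[OF a r(2)[OF a b]])
qed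

lemma ht_mcomp:
  fixes \<phi> :: "complex ^ 'n \<Rightarrow> complex ^ 'n"
  assumes "has_taylor f (coef F)" "\<And>i. has_taylor (\<lambda>x. \<phi> x $ i) (coef (P i))" "no_const P"
  shows "has_taylor (\<lambda>x. f (\<phi> x)) (coef (mcomp F P))"
proof -
  obtain s M where s: "s > 0" "bnd s F M" and f: "\<forall>\<^sub>F x in nhds 0. f x = eval F x"
    using assms(1) unfolding has_taylor_iff conv_def by blast
  obtain r where r: "r > 0" "\<And>i. bnd r (P i) s" using bnd_nc_small[OF assms(3) _ s(1)] assms(2) ht_conv by metis
  have "\<forall>\<^sub>F x in nhds 0. \<forall>i. \<phi> x $ i = eval (P i) x"
    using assms(2) by (intro eventually_all_finite) (auto simp: has_taylor_iff)
  moreover have "\<forall>\<^sub>F x in nhds 0. f (\<phi> x) = eval F (\<phi> x)"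
    by (rule eventually_compose_filterlim[OF f ht_filterlim[OF assms(2,3)]])
  ultimately have "\<forall>\<^sub>F x in nhds 0. f (\<phi> x) = eval (mcomp F P) x"
    using eventually_polydisc[OF r(1)]
  proof eventually_elim
    case (elim x)
    have "\<phi> x = (\<chi> i. eval (P i) x)" using elim by (simp add: vec_eq_iff)
    thus ?case using elim eval_mcomp[OF assms(3) r(2) s(2), of x] r(1) by (simp add: less_imp_le)
  qed
  moreover have "conv (mcomp F P)" using bnd_mcomp[OF _ r(2) s(2)] r(1) convI by (meson less_imp_le)
  ultimately show ?thesis by (simp add: has_taylor_iff)
qed

section \<open>Derivatives of germs and uniqueness of Taylor series\<close>

lemma filterlim_axis: "filterlim (\<lambda>t. x + axis i t) (nhds x) (nhds (0 :: complex))"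
proof (rule vec_tendstoI)
  fix j
  have "((\<lambda>t :: complex. t) \<longlongrightarrow> 0) (nhds 0)" by (rule filterlim_ident)
  thus "((\<lambda>t. (x + axis i t) $ j) \<longlongrightarrow> x $ j) (nhds 0)"
    by (cases "i = j") (auto simp: axis_def intro!: tendsto_eq_intros)
qed

lemma ht_has_field_derivative:
  assumes "has_taylor f (coef F)"
  shows "\<forall>\<^sub>F x in nhds 0. ((\<lambda>t. f (x + axis i t)) has_field_derivative eval (pd i F) x) (at 0)"
proof -
  obtain r B where r: "r > 0" "bnd r F B" and f: "\<forall>\<^sub>F x in nhds 0. f x = eval F x"
    using assms unfolding has_taylor_iff conv_def by blast
  have r2: "r / 2 > 0" using r by simp
  have "\<forall>\<^sub>F x in nhds 0. \<forall>\<^sub>F y in nhds x. f y = eval F y" using f by (simp add: eventually_eventually)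
  thus ?thesis using eventually_polydisc[OF r2]
  proof eventually_elim
    case (elim x)
    have "\<forall>\<^sub>F t in nhds 0. f (x + axis i t) = eval F (x + axis i t)"
      by (rule eventually_compose_filterlim[OF elim(1) filterlim_axis])
    moreover have "((\<lambda>t. eval F (x + axis i t)) has_field_derivative eval (pd i F) x) (at 0)"
      using elim r by (intro has_field_derivative_eval[OF r(2,1)]) auto
    ultimately show ?case by (subst DERIV_cong_ev[OF refl _ refl])
  qed
qed

lemma ht_cgrad:
  assumes "has_taylor f (coef F)" shows "has_taylor (\<lambda>x. cgrad f x $ i) (coef (pd i F))"
proof -
  obtain r B where r: "r > 0" "bnd r F B" using assms unfolding has_taylor_iff conv_def by blast
  have "conv (pd i F)" using bnd_pd[OF r(2,1), of i] r by (auto intro: convI)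
  moreover have "\<forall>\<^sub>F x in nhds 0. cgrad f x $ i = eval (pd i F) x"
    using ht_has_field_derivative[OF assms, of i] by eventually_elim (simp add: cgrad_def DERIV_imp_deriv)
  ultimately show ?thesis by (simp add: has_taylor_iff)
qed

text \<open>The identity theorem by induction on the degree: up to a positive integer factor, the
  coefficient at \<open>m' + axis i 1\<close> is that of a partial derivative at \<open>m'\<close>,
  and the partial derivative again represents the zero germ.\<close>

lemma ht_zero: assumes "has_taylor (\<lambda>_. 0) (coef F)" shows "F = 0"
proof -
  have "has_taylor (\<lambda>_. 0) (coef F) \<Longrightarrow> mdeg m = k \<Longrightarrow> coef F m = 0" for k m and F :: "'a mps"
  proof (induction k arbitrary: m F)
    case 0 thus ?case using ht_at_0 mdeg_eq_0_iff by metis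
  next
    case (Suc k)
    obtain i m' where m: "m = m' + axis i 1" "mdeg m' = k" using Suc(3) mdeg_pos_split by metis
    have "(\<lambda>x :: complex ^ 'a. cgrad (\<lambda>_. 0) x $ i) = (\<lambda>_. 0)" by (simp add: cgrad_def)
    hence "has_taylor (\<lambda>_. 0) (coef (pd i F))" using ht_cgrad[OF Suc(2), of i] by simp
    hence "coef (pd i F) m' = 0" using Suc(1) m by blast
    moreover have "complex_of_nat (m' $ i + 1) \<noteq> 0" by (simp only: of_nat_eq_0_iff)
    ultimately show ?case unfolding coef_pd m by simp
  qed
  thus ?thesis using assms by (intro mps_eqI) auto
qed

lemma ht_unique:
  assumes "has_taylor f (coef F)" "has_taylor f (coef G)" shows "F = G"
  using ht_zero[of "F - G"] ht_diff[OF assms] by simp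

lemma ht_unique_ev:
  assumes "has_taylor f (coef F)" "has_taylor g (coef G)" "\<forall>\<^sub>F x in nhds 0. f x = g x" shows "F = G"
  using ht_unique ht_cong assms by metis

lemma ht_deriv_along:
  assumes "has_taylor H (coef F)" "\<And>i. has_taylor (\<lambda>x. v x $ i) (coef (V i))"
  shows "has_taylor (\<lambda>x. deriv_along H x (v x)) (coef (lie V F))"
  unfolding deriv_along_def lie_def mult.commute[of "V _"]
  by (intro ht_sum ht_mult ht_cgrad assms)

text \<open>The signs of permutations enter a determinant through \<open>of_int\<close>; as constant
  series they can be evaluated and substituted into.\<close>

lemma of_int_cst: "of_int k = cst (of_int k)"
proof -
  have n: "of_nat n = cst (of_nat n)" for n
    by (induction n) (simp_all add: cst_hom)
  have "- cst c = cst (- c)" for c by (rule mps_eqI) (simp add: coef_cst)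
  thus ?thesis by (cases k) (simp_all only: of_int_minus of_int_of_nat_eq n)
qed

lemma ht_det:
  assumes "\<And>i j. has_taylor (\<lambda>x. M x $ i $ j) (coef (N $ i $ j))"
  shows "has_taylor (\<lambda>x. Determinants.det (M x)) (coef (Determinants.det N))"
  unfolding Determinants.det_def of_int_cst
  by (intro ht_sum ht_cst_mult ht_prod assms)

lemma mcomp_det:
  "no_const P \<Longrightarrow> mcomp (Determinants.det N) P = Determinants.det (\<chi> i j. mcomp (N $ i $ j) P)"
  by (simp add: Determinants.det_def mcomp_sum of_int_cst mcomp_cst_mult mcomp_prod)

section \<open>Order of vanishing and the Landau condition\<close>

lemma norm_axis_vec: "norm (axis i t :: complex ^ 'n) = norm t"
proof -
  have "(\<Sum>j\<in>UNIV. (norm ((axis i t :: complex ^ 'n) $ j))\<^sup>2) = (\<Sum>j\<in>UNIV. if j = i then (norm t)\<^sup>2 else 0)"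
    by (intro sum.cong) (auto simp: axis_def)
  thus ?thesis by (simp add: norm_vec_def L2_set_def)
qed

text \<open>The quadratic bound at 0 forces \<open>f 0 = 0\<close>; along each coordinate axis,
  after division by \<open>t\<close>, it forces the first derivatives to vanish.\<close>

lemma higher_order_ord_ge:
  assumes "\<And>j. has_taylor (\<lambda>x. f x $ j) (coef (F j))" "higher_order f"
  shows "ord_ge (\<lambda>_. 1) 2 (F j)"
proof -
  obtain c where O: "\<forall>\<^sub>F x in nhds 0. norm (norm (f x)) \<le> c * norm (norm x ^ 2)"
    using assms(2) unfolding higher_order_def by (auto elim!: landau_o.bigE)
  have f0: "f 0 = 0" using eventually_nhds_x_imp_x[OF O] by simp
  have c0: "coef (F j) 0 = 0" using ht_at_0[OF assms(1)[of j]] f0 by simp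
  have c: "coef (F j) (axis i 1) = 0" for i
  proof -
    have d: "((\<lambda>t. f (0 + axis i t) $ j) has_field_derivative eval (pd i (F j)) 0) (at 0)"
      using eventually_nhds_x_imp_x[OF ht_has_field_derivative[OF assms(1)[of j], of i]] .
    have b: "\<forall>\<^sub>F t in nhds 0. norm (norm (f (0 + axis i t))) \<le> c * norm (norm (0 + axis i t :: complex ^ 'a) ^ 2)"
      by (rule eventually_compose_filterlim[OF O filterlim_axis])
    have "((\<lambda>t. f (0 + axis i t) $ j / t) \<longlongrightarrow> 0) (at 0)"
    proof (rule Lim_null_comparison)
      show "\<forall>\<^sub>F t in at 0. norm (f (0 + axis i t) $ j / t) \<le> c * norm t"
        using filter_leD[OF at_within_le_nhds b] eventually_neq_at_within[of 0]
      proof eventually_elim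
        case (elim t)
        have "norm (f (0 + axis i t) $ j) \<le> norm (f (0 + axis i t))"
          by (rule Finite_Cartesian_Product.norm_nth_le)
        also have "\<dots> \<le> c * norm t ^ 2" using elim by (simp add: norm_axis_vec)
        finally show ?case using elim by (simp add: norm_divide field_simps power2_eq_square)
      qed
      show "((\<lambda>t :: complex. c * norm t) \<longlongrightarrow> 0) (at 0)" by (auto intro!: tendsto_eq_intros)
    qed
    moreover have "((\<lambda>t. f (0 + axis i t) $ j / t) \<longlongrightarrow> eval (pd i (F j)) 0) (at 0)"
      using d f0 unfolding DERIV_def by simp
    ultimately have "eval (pd i (F j)) 0 = 0" using LIM_unique by blast
    moreover have "eval (pd i (F j)) 0 = coef (pd i (F j)) 0"
      using ht_at_0[OF ht_eval[OF ht_conv[OF ht_cgrad[OF assms(1)[of j], of i]]]] .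
    ultimately show ?thesis by (simp add: coef_pd)
  qed
  hence "coef (F j) m = 0" if "mdeg m < 2" for m
  proof (cases "mdeg m = 0")
    case False
    hence "mdeg m = 1" using that by linarith
    thus ?thesis using c mdeg_1_axis[of m] by metis
  qed (use c0 mdeg_eq_0_iff[of m] in auto)
  thus ?thesis by (simp add: ord_ge_def wdeg_1)
qed

lemma ord_ge_higher_order:
  fixes f :: "complex ^ 'n \<Rightarrow> complex ^ 'n"
  assumes "\<And>j. has_taylor (\<lambda>x. f x $ j) (coef (F j))" "\<And>j. ord_ge (\<lambda>_. 1) 2 (F j)"
  shows "higher_order f"
proof -
  have "\<exists>C. \<forall>\<^sub>F x in nhds 0. norm (f x $ j) \<le> C * norm x ^ 2" for j
  proof -
    obtain s M where s: "s > 0" "bnd s (F j) M" and f: "\<forall>\<^sub>F x in nhds 0. f x $ j = eval (F j) x"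
      using assms(1)[of j] unfolding has_taylor_iff conv_def by blast
    have "\<forall>\<^sub>F x :: complex ^ 'n in nhds 0. norm x < s"
      unfolding eventually_nhds_metric using s by (auto simp: dist_norm)
    hence "\<forall>\<^sub>F x in nhds 0. norm (f x $ j) \<le> (M / s ^ 2) * norm x ^ 2" using f
    proof eventually_elim
      case (elim x)
      \<comment> \<open>The Schwarz-type bound is used with the radius \<open>norm x\<close>
        itself.\<close>
      have "norm (eval (F j) x) \<le> M * (norm x / s) ^ 2"
        using elim s assms(2) by (intro norm_eval_le[OF bnd_of_ord_ge] Finite_Cartesian_Product.norm_nth_le) auto
      thus ?case using elim by (simp add: power_divide)
    qed
    thus ?thesis by blast
  qed
  then obtain C where C: "\<And>j. \<forall>\<^sub>F x in nhds 0. norm (f x $ j) \<le> C j * norm x ^ 2" by metis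
  have "\<forall>\<^sub>F x in nhds 0. \<forall>j. norm (f x $ j) \<le> C j * norm x ^ 2"
    using C by (intro eventually_all_finite) auto
  hence "\<forall>\<^sub>F x in nhds 0. norm (norm (f x)) \<le> (\<Sum>j\<in>UNIV. C j) * norm (norm x ^ 2)"
  proof eventually_elim
    case (elim x)
    have "norm (f x) \<le> (\<Sum>j\<in>UNIV. norm (f x $ j))" unfolding norm_vec_def by (rule L2_set_le_sum) simp
    also have "\<dots> \<le> (\<Sum>j\<in>UNIV. C j * norm x ^ 2)" using elim by (intro sum_mono) auto
    finally show ?case by (simp add: sum_distrib_right)
  qed
  thus ?thesis unfolding higher_order_def by (rule bigoI)
qed

subsection \<open>Triangular fixed points\<close>

text \<open>Each application of \<open>T\<close> settles one further level of \<open>\<mu>\<close>,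
  whatever the starting point. So a fixed point is unique, and bounds valid for all iterates pass to
  it.\<close>

lemma tri_iterate:
  fixes T :: "('i \<Rightarrow> 'a) \<Rightarrow> 'i \<Rightarrow> 'a" and \<mu> :: "'i \<Rightarrow> nat"
  assumes "\<And>p q i. (\<And>k. \<mu> k < \<mu> i \<Longrightarrow> p k = q k) \<Longrightarrow> T p i = T q i" "T p = p" "\<mu> i < N"
  shows "(T ^^ N) z i = p i"
  using assms(3)
proof (induction N arbitrary: i)
  case (Suc N)
  have "T ((T ^^ N) z) i = T p i" using Suc by (intro assms(1)) auto
  thus ?case using assms(2) by simp
qed simp

text \<open>The iterates become stationary in every coordinate, and the stationary values form a
  fixed point; no topology is involved.\<close>

lemma tri_fix:
  fixes T :: "('i \<Rightarrow> 'a) \<Rightarrow> 'i \<Rightarrow> 'a" and \<mu> :: "'i \<Rightarrow> nat"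
  assumes tri: "\<And>p q i. (\<And>k. \<mu> k < \<mu> i \<Longrightarrow> p k = q k) \<Longrightarrow> T p i = T q i"
  obtains p where "T p = p"
proof -
  fix z :: "'i \<Rightarrow> 'a"
  have stable: "\<mu> i < N \<Longrightarrow> (T ^^ Suc N) z i = (T ^^ N) z i" for N i
  proof (induction N arbitrary: i)
    case (Suc N)
    have "T ((T ^^ Suc N) z) i = T ((T ^^ N) z) i" using Suc by (intro tri) auto
    thus ?case by simp
  qed simp
  define p where "p i = (T ^^ Suc (\<mu> i)) z i" for i
  have p: "\<mu> i < N \<Longrightarrow> (T ^^ N) z i = p i" for N i
  proof (induction N)
    case (Suc N)
    show ?case
    proof (cases "\<mu> i = N")
      case False thus ?thesis using Suc stable[of i N] by simp
    qed (simp add: p_def)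
  qed simp
  have "T p i = p i" for i
  proof -
    have "T p i = T ((T ^^ \<mu> i) z) i" using p by (intro tri) auto
    thus ?thesis by (simp add: p_def)
  qed
  thus ?thesis using that by blast
qed

subsection \<open>Linear algebra\<close>

text \<open>Cramer's rule without division: replacing column \<open>k\<close> by \<open>u k\<close>
  times itself, a combination of the other columns, gives \<open>u k * det M = 0\<close>. Over an
  integral domain this suffices.\<close>

lemma det_kernel:
  fixes M :: "'a::idom ^ 'n ^ 'n"
  assumes "\<And>i. (\<Sum>j\<in>UNIV. M $ i $ j * u j) = 0" "Determinants.det M \<noteq> 0"
  shows "u k = 0"
proof -
  define c where "c j = (\<chi> i. M $ i $ j)" for j
  have tr: "Determinants.det (\<chi> j. c j) = Determinants.det M"
  proof -
    have "(\<chi> j. c j) = Finite_Cartesian_Product.transpose M"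
      by (simp add: c_def Finite_Cartesian_Product.transpose_def vec_eq_iff)
    thus ?thesis by simp
  qed
  let ?d = "\<lambda>w. Determinants.det ((\<chi> j. if j = k then w else c j) :: 'a ^ 'n ^ 'n)"
  have eq: "u k *s c k = (\<Sum>j\<in>UNIV - {k}. (- u j) *s c j)"
  proof -
    have "(\<Sum>j\<in>UNIV. u j *s c j) = 0"
      using assms(1) by (simp add: vec_eq_iff c_def mult.commute)
    hence "u k *s c k + (\<Sum>j\<in>UNIV - {k}. u j *s c j) = 0" by (subst (asm) sum.remove[of _ k]) auto
    thus ?thesis by (simp add: sum_negf eq_neg_iff_add_eq_0 vec_eq_iff)
  qed
  have "?d (u k *s c k) = (\<Sum>j\<in>UNIV - {k}. ?d ((- u j) *s c j))"
    unfolding eq using det_linear_row_sum[of "UNIV - {k}" k "\<lambda>_ j. (- u j) *s c j" c] by simp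
  also have "\<dots> = 0"
  proof (intro sum.neutral ballI)
    fix j assume "j \<in> UNIV - {k}"
    hence "?d (c j) = 0"
      by (intro det_identical_rows[of k j]) (auto simp: Finite_Cartesian_Product.row_def vec_eq_iff)
    thus "?d ((- u j) *s c j) = 0" using det_row_mul[of k "- u j" "\<lambda>_. c j" c] by simp
  qed
  also have "?d (u k *s c k) = u k * ?d (c k)" using det_row_mul[of k "u k" "\<lambda>_. c k" c] by simp
  also have "(\<chi> j. if j = k then c k else c j) = (\<chi> j. c j)" by (simp add: vec_eq_iff)
  finally show ?thesis using tr assms(2) by simp
qed

lemma det_independent_rows:
  fixes r :: "'n::finite \<Rightarrow> 'a::field ^ 'n"
  assumes "inj r" "vec.independent (range r)" shows "Determinants.det (\<chi> i. r i) \<noteq> 0"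
proof -
  have "c i = 0" if s: "(\<Sum>i\<in>UNIV. c i *s r i) = 0" for c i
  proof -
    have "(\<Sum>w\<in>range r. c (inv_into UNIV r w) *s w) = 0"
      using s assms(1) by (subst sum.reindex) auto
    hence "c (inv_into UNIV r (r i)) = 0" using assms(2) by (intro vec.independentD[of "range r" "range r" "\<lambda>w. c (inv_into UNIV r w)"]) auto
    thus ?thesis using assms(1) by simp
  qed
  hence "\<exists>B. (\<chi> i. r i) ** B = mat 1"
    unfolding matrix_right_invertible_independent_rows by (simp add: Finite_Cartesian_Product.row_def)
  thus ?thesis using invertible_det_nz invertible_right_inverse by blast
qed

text \<open>Fewer than n vectors do not span, so some unit vector is outside their span. Unit
  vectors are taken because only finitely many candidates then arise when the vectors depend on a
  point.\<close>

lemma complete_rows: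
  fixes v :: "nat \<Rightarrow> 'a::field ^ 'n"
  assumes "inj_on v {..<CARD('n) - 1}" "vec.independent (v ` {..<CARD('n) - 1})"
    and e: "bij_betw e (UNIV :: 'n set) {..<CARD('n)}"
  obtains b where "Determinants.det (\<chi> i. if e i < CARD('n) - 1 then v (e i) else axis b 1) \<noteq> 0"
proof -
  let ?S = "v ` {..<CARD('n) - 1}"
  have "vec.dim ?S \<le> card ?S" by (rule vec.dim_le_card) (auto intro: vec.span_base)
  also have "\<dots> < CARD('n)" using card_image_le[of "{..<CARD('n) - 1}" v] zero_less_card_finite[where ?'a = 'n]
    by (simp del: zero_less_card_finite)
  finally have lt: "vec.dim ?S < CARD('n)" .
  have "vec.span ?S \<noteq> UNIV"
  proof
    assume "vec.span ?S = UNIV"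
    hence "vec.dim ?S = CARD('n)" using vec.dim_span[of ?S] vec_dim_card[where ?'n = 'n and ?'a = 'a] by metis
    thus False using lt by linarith
  qed
  have "\<exists>b. axis b 1 \<notin> vec.span ?S"
  proof (rule ccontr)
    assume "\<not> (\<exists>b. axis b 1 \<notin> vec.span ?S)"
    hence "(\<Sum>i\<in>UNIV. x $ i *s axis i 1) \<in> vec.span ?S" for x by (intro vec.span_sum vec.span_scale) blast
    hence "vec.span ?S = UNIV" unfolding basis_expansion by auto
    with \<open>vec.span ?S \<noteq> UNIV\<close> show False ..
  qed
  then obtain b where b: "axis b 1 \<notin> vec.span ?S" ..
  define \<rho> :: "'a ^ 'n" where "\<rho> = axis b 1"
  have \<rho>: "\<rho> \<notin> vec.span ?S" using b by (simp only: \<rho>_def not_False_eq_True)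
  let ?r = "\<lambda>i. if e i < CARD('n) - 1 then v (e i) else \<rho>"
  have \<rho>S: "\<rho> \<notin> ?S" using \<rho> vec.span_base[of \<rho> ?S] by (meson)
  have inje: "inj e" and ran: "e i < CARD('n)" for i using e by (auto simp: bij_betw_def)
  have "inj ?r"
  proof (rule injI)
    fix i j assume eq: "?r i = ?r j"
    show "i = j"
    proof (cases "e i < CARD('n) - 1"; cases "e j < CARD('n) - 1")
      assume "e i < CARD('n) - 1" "e j < CARD('n) - 1"
      thus ?thesis using eq assms(1) inje by (simp add: inj_on_eq_iff inj_eq)
    next
      assume "\<not> e i < CARD('n) - 1" "\<not> e j < CARD('n) - 1"
      hence "e i = e j" using ran[of i] ran[of j] by linarith
      thus ?thesis using inje by (simp add: inj_eq)
    qed (use eq \<rho>S in auto)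
  qed
  moreover have sub: "range ?r \<subseteq> insert \<rho> ?S" by auto
  have "vec.independent (range ?r)"
    by (rule vec.independent_mono[OF vec.independent_insertI[OF \<rho> assms(2)] sub])
  ultimately have "Determinants.det (\<chi> i. ?r i) \<noteq> 0" by (rule det_independent_rows)
  thus ?thesis unfolding \<rho>_def by (rule that)
qed

lemma independent_family:
  fixes v :: "nat \<Rightarrow> 'a::field ^ 'n"
  assumes "\<And>c k. (\<Sum>k<K. c k *s v k) = 0 \<Longrightarrow> k < K \<Longrightarrow> c k = 0"
  shows "inj_on v {..<K}" "vec.independent (v ` {..<K})"
proof -
  show inj: "inj_on v {..<K}"
  proof (rule inj_onI, rule ccontr)
    fix a b assume *: "a \<in> {..<K}" "b \<in> {..<K}" "v a = v b" "a \<noteq> b"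
    let ?c = "\<lambda>k. (if k = a then 1 else 0) - (if k = b then 1 else 0) :: 'a"
    have "(\<Sum>k<K. ?c k *s v k) = (\<Sum>k<K. if k = a then v a else 0) - (\<Sum>k<K. if k = b then v b else 0)"
      unfolding sum_subtractf[symmetric] using *(4) by (intro sum.cong) auto
    also have "\<dots> = 0" using * by simp
    finally have "?c a = 0" using assms[of ?c a] * by blast
    thus False using * by simp
  qed
  show "vec.independent (v ` {..<K})"
    unfolding vec.dependent_finite[OF finite_imageI[OF finite_lessThan]]
  proof (clarify)
    fix u k assume *: "u (v k) \<noteq> 0" "(\<Sum>w\<in>v ` {..<K}. u w *s w) = 0" "k < K"
    have "(\<Sum>k<K. u (v k) *s v k) = 0" using *(2) inj by (simp add: sum.reindex)
    thus False using assms[of "\<lambda>k. u (v k)" k] * by simp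
  qed
qed

subsection \<open>The formal normal form\<close>

text \<open>A substitution tangent to the identity keeps the terms of lowest degree.\<close>

lemma mcomp_nonzero:
  assumes "no_const P" "\<And>i. ord_ge (\<lambda>_. 1) 2 (P i - Y i)" "C \<noteq> 0" shows "mcomp C P \<noteq> 0"
proof -
  have "\<exists>m. coef C m \<noteq> 0" using assms(3) by (metis coef_0 mps_eqI)
  then obtain m where m: "coef C m \<noteq> 0" "\<And>m'. coef C m' \<noteq> 0 \<Longrightarrow> mdeg m \<le> mdeg m'"
    using ex_has_least_nat[of "\<lambda>m. coef C m \<noteq> 0" _ mdeg] by blast
  have C: "ord_ge (\<lambda>_. 1) (mdeg m) C" using m by (intro ord_geI) (auto simp: wdeg_1)
  have "ord_ge (\<lambda>_. 1) (mdeg m + 1) (mcomp C P - mcomp C Y)"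
    using assms no_const_Y by (intro ord_ge_mcomp_diff C) (auto simp: no_const_ord_ge)
  hence "coef (mcomp C P) m = coef C m" using ord_geD[of "\<lambda>_. 1" "mdeg m + 1" _ m] by (force simp: wdeg_1)
  thus ?thesis using m by auto
qed

lemma mprod_zero: "mprod (\<lambda>_. 0) m = (if m = 0 then 1 else 0)"
proof (cases "m = 0")
  case False
  then obtain i where "m $ i \<noteq> 0" by (auto simp: vec_eq_iff)
  thus ?thesis using False unfolding mprod_def by (auto intro!: bexI[of _ i])
qed simp

lemma mcomp_zero: "mcomp (F :: 'a::finite mps) (\<lambda>_. 0) = cst (coef F 0)"
proof (rule mps_eqI)
  fix k :: "nat ^ 'a"
  have "coef (mcomp F (\<lambda>_. 0)) k = (\<Sum>m\<in>{m :: nat ^ 'a. mdeg m \<le> mdeg k}. if m = 0 then coef F 0 * coef 1 k else 0)"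
    unfolding mcomp_def coef_Mps by (intro sum.cong) (auto simp: mprod_zero)
  thus "coef (mcomp F (\<lambda>_. 0)) k = coef (cst (coef F 0)) k"
    by (simp add: finite_mdeg_le coef_1 coef_cst)
qed

lemma tangent_coef_axis:
  assumes "ord_ge (\<lambda>_. 1) 2 (P - Y j)" shows "coef P (axis i 1) = (if i = j then 1 else 0)"
  using ord_geD[OF assms, of "axis i 1"] by (auto simp: coef_mon axis_eq_axis)

text \<open>Substituting the zero tuple is evaluation at the origin and a ring homomorphism, hence
  commutes with the determinant; the Jacobian matrix becomes the identity.\<close>

lemma coef_jacobian_0:
  assumes "\<And>j. ord_ge (\<lambda>_. 1) 2 (P j - Y j)"
  shows "coef (Determinants.det (\<chi> j i. pd i (P j))) 0 = 1"
proof -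
  let ?J = "(\<chi> j i. pd i (P j)) :: 'a mps ^ 'a ^ 'a"
  have "cst (coef (Determinants.det ?J) 0) = Determinants.det (\<chi> j i. mcomp (?J $ j $ i) (\<lambda>_. 0))"
    by (subst mcomp_det[symmetric]) (auto simp: mcomp_zero no_const_def)
  also have "(\<chi> j i. mcomp (?J $ j $ i) (\<lambda>_. 0)) = mat 1"
    by (auto simp: vec_eq_iff mcomp_zero coef_pd tangent_coef_axis[OF assms] mat_def cst_hom)
  finally have "cst (coef (Determinants.det ?J) 0) = (1 :: 'a mps)" by simp
  from arg_cong[OF this, of "\<lambda>F. coef F 0"] show ?thesis by (simp add: coef_cst coef_1)
qed

lemma jacobian_nonzero:
  assumes "\<And>j. ord_ge (\<lambda>_. 1) 2 (P j - Y j)"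
  shows "Determinants.det (\<chi> j i. pd i (P j)) \<noteq> 0"
  using coef_jacobian_0[of P, OF assms] by force

text \<open>Let \<open>\<alpha>\<close> and \<open>\<alpha>'\<close> be the derivatives along
  \<open>Z\<close> and \<open>Z'\<close> of the additional function with gradient row
  \<open>\<rho>\<close> in the variables \<open>P\<close>. Then
  \<open>\<alpha>' Z - \<alpha> Z'\<close> annihilates this function too, in all n functions with
  nonzero Jacobian, so it vanishes.\<close>

lemma parallel_fields:
  fixes Z Z' :: "'n::finite \<Rightarrow> 'n mps" and G :: "nat \<Rightarrow> 'n mps"
  assumes no_const: "no_const P" and tan: "\<And>i. ord_ge (\<lambda>_. 1) 2 (P i - Y i)"
    and det: "Determinants.det (\<chi> i j. if e i < K then pd j (G (e i)) else cst (\<rho> $ j)) \<noteq> 0"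
    and Z: "\<And>k. k < K \<Longrightarrow> lie Z (mcomp (G k) P) = 0"
    and Z': "\<And>k. k < K \<Longrightarrow> lie Z' (mcomp (G k) P) = 0"
  shows "Z a * Z' b = Z b * Z' a"
proof -
  let ?N = "(\<chi> i j. if e i < K then pd j (G (e i)) else cst (\<rho> $ j)) :: 'n mps ^ 'n ^ 'n"
  let ?M = "(\<chi> i j. mcomp (?N $ i $ j) P) :: 'n mps ^ 'n ^ 'n"
  have detM: "Determinants.det ?M \<noteq> 0"
    using mcomp_nonzero[OF no_const tan det] mcomp_det[OF no_const, of ?N] by simp
  have cst: "mcomp (cst c) P = cst c" for c
    using mcomp_cst_mult[of c 1 P] mcomp_1[OF no_const] by simp
  \<comment> \<open>By the chain rule the derivatives \<open>lie W (P j)\<close> solve a linear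
    system with matrix \<open>?M\<close>; \<open>kernel0\<close> then passes from them to
    \<open>W\<close> through the Jacobian of \<open>P\<close>.\<close>
  have kernel: "lie W (P j) = 0"
    if "\<And>k. k < K \<Longrightarrow> lie W (mcomp (G k) P) = 0" "(\<Sum>j\<in>UNIV. cst (\<rho> $ j) * lie W (P j)) = 0" for W j
  proof (rule det_kernel[OF _ detM])
    fix i
    show "(\<Sum>j\<in>UNIV. ?M $ i $ j * lie W (P j)) = 0"
      using that(1)[of "e i"] that(2) by (cases "e i < K") (auto simp: lie_mcomp[OF no_const] cst)
  qed
  have kernel0: "W i = 0" if "\<And>j. lie W (P j) = 0" for W i
    by (rule det_kernel[OF _ jacobian_nonzero[OF tan]]) (use that in \<open>simp add: lie_def mult.commute\<close>)
  let ?\<alpha> = "\<lambda>W. \<Sum>j\<in>UNIV. cst (\<rho> $ j) * lie W (P j)"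
  define \<alpha> where "\<alpha> = ?\<alpha> Z"
  define \<alpha>' where "\<alpha>' = ?\<alpha> Z'"
  have lin: "lie (\<lambda>i. A * Z i - B * Z' i) F = A * lie Z F - B * lie Z' F" for A B F
    by (simp add: lie_def sum_subtractf sum_distrib_left left_diff_distrib mult.assoc)
  have "?\<alpha> (\<lambda>i. A * Z i - B * Z' i) = A * \<alpha> - B * \<alpha>'" for A B
    unfolding \<alpha>_def \<alpha>'_def lin
    by (simp add: right_diff_distrib sum_subtractf sum_distrib_left mult.left_commute)
  hence "?\<alpha> (\<lambda>i. \<alpha>' * Z i - \<alpha> * Z' i) = 0" by (simp add: mult.commute)
  hence "lie (\<lambda>i. \<alpha>' * Z i - \<alpha> * Z' i) (P j) = 0" for j
    using Z Z' by (intro kernel) (simp_all add: lin mult.commute)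
  hence eq: "\<alpha>' * Z i = \<alpha> * Z' i" for i
    using kernel0[of "\<lambda>i. \<alpha>' * Z i - \<alpha> * Z' i" i] by simp
  show ?thesis
  proof (cases "\<alpha> = 0")
    case False
    have "\<alpha> * (Z a * Z' b) = Z a * (\<alpha>' * Z b)" by (simp add: eq mult_ac)
    also have "\<dots> = \<alpha> * (Z b * Z' a)" using eq[of a] by (simp add: mult_ac)
    finally show ?thesis using False by simp
  next
    \<comment> \<open>If \<open>\<alpha>'\<close> vanishes as well, \<open>Z'\<close> annihilates
      all n functions and is zero; otherwise \<open>\<alpha>' Z = 0\<close> makes \<open>Z\<close>
      zero.\<close>
    case True
    show ?thesis
    proof (cases "\<alpha>' = 0")
      case False
      hence "Z i = 0" for i using eq[of i] True by simp
      thus ?thesis by simp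
    next
      case True
      hence "(\<Sum>j\<in>UNIV. cst (\<rho> $ j) * lie Z' (P j)) = 0" by (simp only: \<alpha>'_def)
      hence "lie Z' (P j) = 0" for j using Z' by (intro kernel) auto
      hence "Z' i = 0" for i by (rule kernel0)
      thus ?thesis by simp
    qed
  qed
qed

text \<open>The homological equation is solved by weight: at a nonresonant place the divisor is
  nonzero and gives \<open>\<phi>\<close>, at a resonant one the remainder goes into
  \<open>h\<close>. The weights admit resonant linear terms in \<open>F\<close>, that is, a
  nilpotent part.\<close>

lemma poincare_dulac:
  fixes F :: "'n::finite \<Rightarrow> 'n mps"
  assumes w2: "\<And>m j. mdeg m \<ge> 2 \<Longrightarrow> w j < wdeg w m"
    and F: "\<And>j. ord_ge w (w j + 1) (F j)"
    and lin: "\<And>j m. mdeg m \<le> 1 \<Longrightarrow> coef (F j) m \<noteq> 0 \<Longrightarrow> mpair m lam = lam $ j"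
  obtains \<phi> h where
    "\<And>j m. coef (\<phi> j) m \<noteq> 0 \<Longrightarrow> mdeg m \<ge> 2 \<and> mpair m lam \<noteq> lam $ j"
    "\<And>j m. coef (h j) m \<noteq> 0 \<Longrightarrow> w j < wdeg w m \<and> mpair m lam = lam $ j"
    "\<And>j m. mdeg m \<le> 1 \<Longrightarrow> coef (h j) m = coef (F j) m"
    "\<And>j. lie (\<lambda>i. diagf lam i + h i) (Y j + \<phi> j)
        = diagf lam j + cst (lam $ j) * \<phi> j + mcomp (F j) (\<lambda>i. Y i + \<phi> i)"
proof -
  \<comment> \<open>One unknown family \<open>p\<close> encodes both \<open>\<phi>\<close> (nonresonant places) and \<open>h\<close> (resonant places).\<close>
  define \<phi> where "\<phi> p j = Mps (\<lambda>m. if mdeg m \<ge> 2 \<and> mpair m lam \<noteq> lam $ j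
      then p (m, j) / (mpair m lam - lam $ j) else 0)" for p j
  define h where "h p j = Mps (\<lambda>m. if mdeg m \<le> 1 then coef (F j) m
      else if mpair m lam = lam $ j then p (m, j) else 0)" for p j
  define E where "E p j = mcomp (F j) (\<lambda>i. Y i + \<phi> p i) - lie (h p) (\<phi> p j)" for p j
  define T where "T p = (\<lambda>(m, j). if mdeg m \<ge> 2 then coef (E p j) m else 0)" for p
  \<comment> \<open>The weight of the field with the single monomial \<open>m\<close> in component
    \<open>j\<close>. The truncation does not matter: by \<open>w2\<close> the difference is
    positive wherever \<open>T\<close> is not constantly 0.\<close>
  define \<mu> where "\<mu> = (\<lambda>(m, j). wdeg w m - w j)"
  have \<phi>_ord: "ord_ge w (w j + 1) (\<phi> p j)" "ord_ge (\<lambda>_. 1) 2 (\<phi> p j)" for p j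
  proof -
    have 2: "mdeg m \<ge> 2" if "coef (\<phi> p j) m \<noteq> 0" for m using that by (auto simp: \<phi>_def split: if_splits)
    show "ord_ge w (w j + 1) (\<phi> p j)"
    proof (rule ord_geI)
      fix m assume "coef (\<phi> p j) m \<noteq> 0"
      thus "w j + 1 \<le> wdeg w m" using w2[OF 2, of m j] by linarith
    qed
    show "ord_ge (\<lambda>_. 1) 2 (\<phi> p j)" using 2 by (intro ord_geI) (simp add: wdeg_1)
  qed
  have h_ord: "ord_ge w (w j + 1) (h p j)" for p j
  proof (rule ord_geI)
    fix m assume nz: "coef (h p j) m \<noteq> 0"
    show "w j + 1 \<le> wdeg w m"
    proof (cases "mdeg m \<le> 1")
      case True
      thus ?thesis using nz ord_geD[OF F[of j], of m] by (force simp: h_def not_less)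
    next
      case False
      hence "mdeg m \<ge> 2" by linarith
      thus ?thesis using w2[of m j] by linarith
    qed
  qed
  have F0: "coef (F j) 0 = 0" for j using ord_geD[OF F, of 0 j] by (simp add: wdeg_def)
  have no_const: "no_const (\<lambda>i. Y i + \<phi> p i)" for p
    using no_const_Y by (auto simp: no_const_def \<phi>_def)
  have Y_ord: "ord_ge w (w i) (Y i + \<phi> p i)" for p i
    using ord_ge_mon[of w "axis i 1"] ord_ge_le[OF \<phi>_ord(1)[of i p], of "w i"] by (auto intro: ord_ge_add)
  have tri: "T p (m, j) = T q (m, j)" if agree: "\<And>k. \<mu> k < \<mu> (m, j) \<Longrightarrow> p k = q k" for p q m j
  proof (cases "mdeg m \<ge> 2")
    case True
    define N where "N = wdeg w m - w j"
    have N: "wdeg w m = w j + N" using w2[OF True, of j] by (simp add: N_def)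
    have pq: "p (m', i) = q (m', i)" if "mdeg m' \<ge> 2" "wdeg w m' < w i + N" for m' i
      using agree[of "(m', i)"] that w2[OF that(1), of i] by (auto simp: \<mu>_def N)
    have d1: "ord_ge w (w i + N) (\<phi> p i - \<phi> q i)" for i
      unfolding ord_ge_def using pq by (auto simp: \<phi>_def)
    have d2: "ord_ge w (w i + N) (h p i - h q i)" for i
      unfolding ord_ge_def using pq by (auto simp: h_def)
    have "ord_ge w (w j + 1 + N) (mcomp (F j) (\<lambda>i. Y i + \<phi> p i) - mcomp (F j) (\<lambda>i. Y i + \<phi> q i))"
      using d1 by (intro ord_ge_mcomp_diff no_const Y_ord F) auto
    moreover have "ord_ge w (w j + 1 + N) (lie (\<lambda>i. h p i - h q i) (\<phi> p j))"
      by (intro ord_ge_lie d2 \<phi>_ord)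
    moreover have "ord_ge w (w j + N + 1) (lie (h q) (\<phi> p j - \<phi> q j))"
      by (intro ord_ge_lie d1) (use h_ord in \<open>simp add: add.commute\<close>)
    ultimately have "coef (E p j - E q j) m = 0"
      using N by (simp add: ord_ge_def E_def lie_diff_left lie_diff)
    thus ?thesis using True by (simp add: T_def)
  qed (simp add: T_def)
  obtain p where p: "T p = p"
  proof (rule tri_fix[of \<mu> T])
    fix p q :: "(nat ^ 'n) \<times> 'n \<Rightarrow> complex" and i assume *: "\<And>k. \<mu> k < \<mu> i \<Longrightarrow> p k = q k"
    obtain m j where i: "i = (m, j)" by (cases i)
    show "T p i = T q i" unfolding i by (rule tri) (use * i in simp)
  qed
  have eq: "coef (lie (diagf lam) (\<phi> p j) - cst (lam $ j) * \<phi> p j + h p j) m = coef (E p j) m" for j m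
  proof (cases "mdeg m \<ge> 2")
    case True
    have pE: "p (m, j) = coef (E p j) m"
    proof -
      have "p (m, j) = T p (m, j)" by (simp only: p)
      thus ?thesis using True by (simp add: T_def)
    qed
    have "coef (lie (diagf lam) (\<phi> p j) - cst (lam $ j) * \<phi> p j + h p j) m
        = (mpair m lam - lam $ j) * coef (\<phi> p j) m + coef (h p j) m"
      by (simp add: coef_lie_diagf left_diff_distrib)
    also have "\<dots> = coef (E p j) m"
      using True by (cases "mpair m lam = lam $ j") (simp_all add: \<phi>_def h_def pE)
    finally show ?thesis .
  next
    \<comment> \<open>In degree below 2 the terms with \<open>\<phi>\<close> drop out, and both
      sides are the linear part of \<open>F\<close>, which \<open>h\<close> contains by
      definition.\<close>
    case False
    hence le: "mdeg m < 2" by simp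
    have "coef (\<phi> p j) m = 0" using False by (simp add: \<phi>_def)
    moreover have "coef (mcomp (F j) (\<lambda>i. Y i + \<phi> p i)) m = coef (F j) m"
    proof -
      have "ord_ge (\<lambda>_. 1) (1 + 1) (mcomp (F j) (\<lambda>i. Y i + \<phi> p i) - mcomp (F j) Y)"
        using no_const no_const_Y \<phi>_ord(2) F0
        by (intro ord_ge_mcomp_diff) (auto simp: no_const_ord_ge ord_ge_def wdeg_1 mdeg_eq_0_iff)
      thus ?thesis using le by (auto simp: ord_ge_def wdeg_1)
    qed
    moreover have "coef (lie (h p) (\<phi> p j)) m = 0"
    proof -
      have "ord_ge (\<lambda>_. 1) 1 (h p i)" for i
        using F0 by (auto simp: ord_ge_def wdeg_1 mdeg_eq_0_iff h_def)
      hence "ord_ge (\<lambda>_. 1) (2 + 0) (lie (h p) (\<phi> p j))"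
        by (intro ord_ge_lie \<phi>_ord) auto
      thus ?thesis using le by (simp add: ord_ge_def wdeg_1)
    qed
    ultimately show ?thesis using False by (simp add: E_def coef_lie_diagf h_def)
  qed
  show ?thesis
  proof (rule that[of "\<phi> p" "h p"])
    show "mdeg m \<ge> 2 \<and> mpair m lam \<noteq> lam $ j" if "coef (\<phi> p j) m \<noteq> 0" for j m
      using that by (auto simp: \<phi>_def split: if_splits)
    show "w j < wdeg w m \<and> mpair m lam = lam $ j" if "coef (h p j) m \<noteq> 0" for j m
    proof
      have "\<not> wdeg w m < w j + 1" using ord_geD[OF h_ord, of m j p] that by blast
      thus "w j < wdeg w m" by linarith
      show "mpair m lam = lam $ j" using that lin[of m j] by (auto simp: h_def split: if_splits)
    qed
    show "coef (h p j) m = coef (F j) m" if "mdeg m \<le> 1" for j m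
      using that by (simp add: h_def)
    fix j
    have "lie (diagf lam) (\<phi> p j) - cst (lam $ j) * \<phi> p j + h p j = E p j"
      using eq by (rule mps_eqI)
    thus "lie (\<lambda>i. diagf lam i + h p i) (Y j + \<phi> p j)
        = diagf lam j + cst (lam $ j) * \<phi> p j + mcomp (F j) (\<lambda>i. Y i + \<phi> p i)"
      by (simp add: lie_add_left lie_add lie_Y E_def algebra_simps)
  qed
qed

text \<open>A resonant field preserves the eigenvalue \<open>mpair m lam\<close>, so the part
  \<open>K'\<close> of \<open>K\<close> with nonzero eigenvalue satisfies the equation on its own
  exponents. There \<open>h\<close> raises the weight, while the diagonal field multiplies a term of
  least weight by a nonzero number.\<close>

lemma normal_form_integral_invariant:
  assumes h: "\<And>j m. coef (h j) m \<noteq> 0 \<Longrightarrow> w j < wdeg w m \<and> mpair m lam = lam $ j"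
    and K: "lie (\<lambda>i. diagf lam i + h i) K = 0" and m: "coef K m \<noteq> 0"
  shows "mpair m lam = 0"
proof (rule ccontr)
  assume nz: "mpair m lam \<noteq> 0"
  define K' where "K' = Mps (\<lambda>m. if mpair m lam \<noteq> 0 then coef K m else 0)"
  \<comment> \<open>A resonant term of \<open>h i\<close> together with \<open>pd i\<close> leaves
    \<open>mpair m lam\<close> unchanged, so only \<open>K'\<close> contributes at such
    \<open>m\<close>.\<close>
  have lieh: "coef (lie h K') m = coef (lie h K) m" if "mpair m lam \<noteq> 0" for m
    unfolding lie_def coef_sum coef_mult
  proof (intro sum.cong refl)
    fix i p assume "p \<in> splits m"
    thus "(case p of (a, b) \<Rightarrow> coef (h i) a * coef (pd i K') b) = (case p of (a, b) \<Rightarrow> coef (h i) a * coef (pd i K) b)"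
      using that h[of i "fst p"] by (cases p) (auto simp: coef_pd K'_def mpair_add add.commute)
  qed
  have "coef K' m \<noteq> 0" using nz m by (simp add: K'_def)
  then obtain m0 where m0: "coef K' m0 \<noteq> 0" "\<And>m'. coef K' m' \<noteq> 0 \<Longrightarrow> wdeg w m0 \<le> wdeg w m'"
    using ex_has_least_nat[of "\<lambda>m. coef K' m \<noteq> 0" _ "wdeg w"] by blast
  have nz0: "mpair m0 lam \<noteq> 0" "coef K m0 = coef K' m0" using m0(1) by (auto simp: K'_def split: if_splits)
  have "ord_ge w (w i + 1) (h i)" for i
  proof (rule ord_geI)
    fix m assume "coef (h i) m \<noteq> 0"
    thus "w i + 1 \<le> wdeg w m" using h[of i m] by linarith
  qed
  moreover have "ord_ge w (wdeg w m0) K'" using m0(2) by (rule ord_geI)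
  ultimately have "ord_ge w (wdeg w m0 + 1) (lie h K')" by (rule ord_ge_lie)
  hence "coef (lie h K') m0 = 0" by (simp add: ord_ge_def)
  moreover have "coef (lie (\<lambda>i. diagf lam i + h i) K) m0 = 0" using K by simp
  ultimately show False using nz0 m0(1) lieh[OF nz0(1)] by (simp add: lie_add_left coef_lie_diagf)
qed

text \<open>The point is that \<open>Y a\<close> divides \<open>h a\<close>. If another eigenvalue
  \<open>lam $ b\<close> is nonzero, \<open>Y a\<close> divides \<open>Y b * h a\<close>. Otherwise
  an exponent without the variable \<open>a\<close> has pairing 0, and resonance would require
  \<open>lam $ a\<close>.\<close>

lemma parallel_factor:
  fixes h :: "'n::finite \<Rightarrow> 'n mps"
  assumes par: "\<And>a b. diagf lam a * h b = diagf lam b * h a"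
    and res: "\<And>j m. coef (h j) m \<noteq> 0 \<Longrightarrow> mpair m lam = lam $ j"
    and lam: "lam \<noteq> 0"
  obtains g where "\<And>j. h j = diagf lam j * g" "\<And>m. coef g m \<noteq> 0 \<Longrightarrow> mpair m lam = 0"
proof -
  obtain a where a: "lam $ a \<noteq> 0" using lam by (auto simp: vec_eq_iff)
  define g where "g = Mps (\<lambda>m. coef (h a) (m + axis a 1) / lam $ a)"
  have div: "coef (h a) m = 0" if m: "m $ a = 0" for m
  proof (cases "\<exists>b. b \<noteq> a \<and> lam $ b \<noteq> 0")
    case True
    then obtain b where b: "b \<noteq> a" "lam $ b \<noteq> 0" by blast
    have "coef (diagf lam b * h a) (axis b 1 + m) = coef (diagf lam a * h b) (axis b 1 + m)"
      using par[of b a] by simp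
    moreover have "coef (diagf lam a * h b) (axis b 1 + m) = 0"
    proof -
      have "(axis b 1 + m) $ a = 0" using m b by (simp add: axis_def)
      thus ?thesis by (simp add: diagf_def mult.assoc coef_Y_mult)
    qed
    moreover have "coef (diagf lam b * h a) (axis b 1 + m) = lam $ b * coef (h a) m"
      by (simp add: diagf_def mult.assoc)
    ultimately show ?thesis using b by simp
  next
    case False
    hence "of_nat (m $ i) * lam $ i = 0" for i using m by (cases "i = a") auto
    hence "mpair m lam = 0" unfolding mpair_def by (intro sum.neutral ballI)
    thus ?thesis using res[of a m] a by auto
  qed
  have ha: "h a = diagf lam a * g"
  proof (rule mps_eqI)
    fix m
    show "coef (h a) m = coef (diagf lam a * g) m"
    proof (cases "m $ a = 0")
      case True thus ?thesis using div by (simp add: diagf_def mult.assoc coef_Y_mult)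
    next
      case False
      obtain m' where "m = m' + axis a 1" using add_dec[of m a] False by metis
      thus ?thesis using a by (simp add: diagf_def mult.assoc g_def)
    qed
  qed
  have nz: "diagf lam a \<noteq> 0"
  proof
    assume "diagf lam a = 0"
    hence "coef (diagf lam a) (axis a 1) = 0" by simp
    thus False using a by (simp add: diagf_def coef_mon)
  qed
  have "h j = diagf lam j * g" for j
  proof -
    have "diagf lam a * h j = diagf lam a * (diagf lam j * g)" using par[of a j] ha by (simp add: mult_ac)
    thus ?thesis using nz by simp
  qed
  moreover have "mpair m lam = 0" if "coef g m \<noteq> 0" for m
    using res[of a "m + axis a 1"] that a by (simp add: g_def mpair_add)
  ultimately show ?thesis using that by blast
qed

subsection \<open>The rank of the resonant set\<close>

definition rvec :: "nat ^ 'n \<Rightarrow> real ^ 'n" where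
  "rvec m = (\<chi> i. real (m $ i))"

lemma resonant_rank_rvec: "resonant_rank lam = dim (rvec ` resonant_set lam)"
  by (simp add: resonant_rank_def rvec_def[abs_def])

lemma Re_mpair: "Re (mpair m lam) = rvec m \<bullet> (\<chi> i. Re (lam $ i))"
  and Im_mpair: "Im (mpair m lam) = rvec m \<bullet> (\<chi> i. Im (lam $ i))"
  by (simp_all add: mpair_def rvec_def inner_vec_def)

text \<open>The rank is a real dimension, so one nonzero real vector orthogonal to the resonances is
  extracted from the complex eigenvalues.\<close>

lemma resonant_real_part:
  fixes lam :: "complex ^ 'n"
  assumes "lam $ a \<noteq> 0"
  obtains part :: "complex \<Rightarrow> real" where "part = Re \<or> part = Im" "part (lam $ a) \<noteq> 0"
    "\<And>m. mpair m lam = 0 \<Longrightarrow> rvec m \<bullet> (\<chi> i. part (lam $ i)) = 0"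
proof (cases "Re (lam $ a) = 0")
  case True
  hence "Im (lam $ a) \<noteq> 0" using assms by (simp add: complex_eq_iff)
  thus ?thesis using that[of Im] by (auto simp flip: Im_mpair)
next
  case False
  thus ?thesis using that[of Re] by (auto simp flip: Re_mpair)
qed

text \<open>The resonances lie in the hyperplane orthogonal to a real or imaginary part
  \<open>u\<close> of \<open>lam\<close>. If they did not span it, some real
  \<open>v \<noteq> 0\<close> would be orthogonal to them and to \<open>u\<close>; but
  \<open>par\<close> makes \<open>v\<close> proportional to \<open>lam\<close>, hence to
  \<open>u\<close>.\<close>

lemma resonant_rank_eqI:
  fixes lam :: "complex ^ 'n"
  assumes "lam \<noteq> 0"
    and par: "\<And>v a b. (\<And>m. mpair m lam = 0 \<Longrightarrow> mpair m v = 0) \<Longrightarrow> lam $ a * v $ b = lam $ b * v $ a"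
  shows "resonant_rank lam = CARD('n) - 1"
proof -
  obtain a where a: "lam $ a \<noteq> 0" using assms(1) by (auto simp: vec_eq_iff)
  obtain part :: "complex \<Rightarrow> real" where part: "part = Re \<or> part = Im" "part (lam $ a) \<noteq> 0"
    "\<And>m. mpair m lam = 0 \<Longrightarrow> rvec m \<bullet> (\<chi> i. part (lam $ i)) = 0" using resonant_real_part[OF a] by metis
  define u where "u = (\<chi> i. part (lam $ i))"
  have u: "u \<noteq> 0" using part(2) by (auto simp: u_def vec_eq_iff)
  let ?S = "rvec ` resonant_set lam"
  have "?S \<subseteq> {x. u \<bullet> x = 0}" using part(3) by (auto simp: u_def resonant_set_def inner_commute)
  hence "dim ?S \<le> dim {x. u \<bullet> x = 0}" by (rule dim_subset)
  also have "\<dots> = CARD('n) - 1" using dim_hyperplane[OF u] by simp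
  finally have le: "dim ?S \<le> CARD('n) - 1" .
  have "\<not> dim ?S < CARD('n) - 1"
  proof
    assume lt: "dim ?S < CARD('n) - 1"
    have "dim (insert u ?S) \<le> dim ?S + 1" by (simp add: dim_insert)
    hence "dim (insert u ?S) < DIM(real ^ 'n)" using lt by simp
    then obtain v where v: "v \<noteq> 0" "\<And>y. y \<in> span (insert u ?S) \<Longrightarrow> orthogonal v y"
      using orthogonal_to_subspace_exists by blast
    have vS: "v \<bullet> rvec m = 0" if "m \<in> resonant_set lam" for m
      using v(2)[OF span_base, of "rvec m"] that by (auto simp: orthogonal_def)
    have vu: "v \<bullet> u = 0" using v(2)[OF span_base, of u] by (auto simp: orthogonal_def)
    define w :: "complex ^ 'n" where "w = (\<chi> i. of_real (v $ i))"
    have mw: "mpair m w = of_real (v \<bullet> rvec m)" for m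
      by (simp add: mpair_def w_def inner_vec_def rvec_def mult.commute)
    have "mpair m w = 0" if m: "mpair m lam = 0" for m
    proof -
      consider "mdeg m = 0" | "mdeg m = 1" | "mdeg m \<ge> 2" by linarith
      thus ?thesis
      proof cases
        case 1 thus ?thesis by (simp add: mdeg_eq_0_iff)
      next
        \<comment> \<open>A unit vector is not in \<open>resonant_set\<close> because of its degree,
          but its double is.\<close>
        case 2
        then obtain i where i: "m = axis i 1" using mdeg_1_axis by metis
        hence "axis i 2 \<in> resonant_set lam" using m by (simp add: resonant_set_def)
        hence "mpair (axis i 2) w = 0" using vS mw by simp
        thus ?thesis using i by simp
      next
        case 3 thus ?thesis using m vS mw by (simp add: resonant_set_def)
      qed
    qed
    hence "lam $ i * w $ j = lam $ j * w $ i" for i j using par by blast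
    hence "part (lam $ i * of_real (v $ j)) = part (lam $ j * of_real (v $ i))" for i j
      by (simp add: w_def)
    hence uv: "u $ i * v $ j = u $ j * v $ i" for i j using part(1) by (auto simp: u_def)
    have "(u \<bullet> u) * v $ j = u $ j * (v \<bullet> u)" for j
      unfolding inner_vec_def using uv by (simp add: sum_distrib_right sum_distrib_left mult_ac)
    hence "v $ j = 0" for j using vu u by simp
    thus False using v(1) by (simp add: vec_eq_iff)
  qed
  thus ?thesis using le by (simp add: resonant_rank_rvec)
qed

lemma det_Ints: "(\<And>i j. M $ i $ j \<in> \<int>) \<Longrightarrow> Determinants.det M \<in> \<int>"
  unfolding Determinants.det_def by (intro Ints_sum Ints_mult Ints_prod) auto

text \<open>Full rank makes the eigenvalues commensurable, so there are no small divisors.\<close>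

lemma resonant_rank_commensurable:
  fixes lam :: "complex ^ 'n"
  assumes rank: "resonant_rank lam = CARD('n) - 1" and a: "lam $ a \<noteq> 0"
  obtains D :: real and z :: "'n \<Rightarrow> int" where "D \<noteq> 0" "\<And>i. lam $ i = lam $ a * of_int (z i) / of_real D"
proof -
  let ?S = "rvec ` resonant_set lam"
  obtain B where B: "B \<subseteq> ?S" "independent B" "?S \<subseteq> span B" "card B = dim ?S" by (rule basis_exists)
  obtain part :: "complex \<Rightarrow> real" where part: "part = Re \<or> part = Im" "part (lam $ a) \<noteq> 0"
    "\<And>m. mpair m lam = 0 \<Longrightarrow> rvec m \<bullet> (\<chi> i. part (lam $ i)) = 0" using resonant_real_part[OF a] by metis
  let ?u = "\<chi> i. part (lam $ i)"
  let ?e = "axis a 1 :: real ^ 'n"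
  have "B \<subseteq> {x. ?u \<bullet> x = 0}" using B(1) part(3) by (auto simp: resonant_set_def inner_commute)
  hence "span B \<subseteq> {x. ?u \<bullet> x = 0}" by (rule span_minimal) (rule subspace_hyperplane)
  hence e: "?e \<notin> span B" using part(2) by (auto simp: inner_axis)
  have ind: "independent (insert ?e B)" using independent_insertI[OF e B(2)] .
  have finB: "finite B" using B(2) independent_imp_finite by blast
  have "?e \<notin> B" using e span_base by blast
  hence "card (insert ?e B) = CARD('n)"
    using finB B(4) rank zero_less_card_finite[where ?'a = 'n] by (simp add: resonant_rank_rvec del: zero_less_card_finite)
  then obtain r where r: "bij_betw r (UNIV :: 'n set) (insert ?e B)"
    using finite_same_card_bij[of "UNIV :: 'n set" "insert ?e B"] finB by auto
  \<comment> \<open>The rows are independent resonances and the unit vector \<open>?e\<close>, so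
    \<open>M\<close> is integral and nonsingular. A vector \<open>x\<close> orthogonal to the
    resonances solves \<open>M *v x = x $ a *s c\<close>, and Cramer's rule makes its entries
    \<open>x $ a\<close> times an integer over \<open>det M\<close>. Both the real and the imaginary
    part of \<open>lam\<close> are such vectors.\<close>
  define M where "M = (\<chi> i. r i)"
  have "inj r" "vec.independent (range r)" using r ind by (auto simp: bij_betw_def dependent_vec_eq)
  hence det: "Determinants.det M \<noteq> 0" unfolding M_def by (rule det_independent_rows)
  have rS: "r i = ?e \<or> r i \<in> ?S" for i using r B(1) by (auto simp: bij_betw_def)
  have int: "M $ i $ j \<in> \<int>" for i j using rS[of i] by (auto simp: M_def rvec_def axis_def)
  define c :: "real ^ 'n" where "c = (\<chi> i. if r i = ?e then 1 else 0)"
  define y where "y k = Determinants.det (\<chi> i j. if j = k then c $ i else M $ i $ j)" for k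
  have "y k \<in> \<int>" for k unfolding y_def by (rule det_Ints) (use int in \<open>auto simp: c_def\<close>)
  hence "\<forall>k. \<exists>z. y k = of_int z" by (auto elim!: Ints_cases)
  then obtain z where z: "\<And>k. y k = of_int (z k)" by metis
  have sol: "x $ k = x $ a * of_int (z k) / Determinants.det M"
    if x: "\<And>m. mpair m lam = 0 \<Longrightarrow> rvec m \<bullet> x = 0" for x :: "real ^ 'n" and k
  proof -
    have "M *v (\<chi> k. y k / Determinants.det M) = c" using cramer[OF det] by (simp add: y_def)
    hence "M *v (x $ a *s (\<chi> k. y k / Determinants.det M)) = x $ a *s c"
      by (simp add: vector_scalar_commute)
    also have "x $ a *s c = M *v x"
    proof (subst vec_eq_iff, intro allI)
      fix i
      have "(M *v x) $ i = r i \<bullet> x" by (simp add: matrix_vector_mult_def M_def inner_vec_def)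
      thus "(x $ a *s c) $ i = (M *v x) $ i"
        using rS[of i] x by (auto simp: c_def inner_axis' resonant_set_def)
    qed
    finally have "M *v (x $ a *s (\<chi> k. y k / Determinants.det M)) = M *v x" .
    moreover obtain N where N: "N ** M = mat 1"
      using det[folded invertible_det_nz, unfolded invertible_left_inverse] by blast
    ultimately have "N *v (M *v (x $ a *s (\<chi> k. y k / Determinants.det M))) = N *v (M *v x)"
      by (simp only:)
    hence "x = x $ a *s (\<chi> k. y k / Determinants.det M)"
      by (simp only: matrix_vector_mul_assoc N matrix_vector_mul_lid)
    hence "x $ k = (x $ a *s (\<chi> k. y k / Determinants.det M)) $ k" by simp
    thus ?thesis by (simp add: z)
  qed
  show ?thesis
  proof (rule that[of "Determinants.det M" z])
    fix i
    have "Re (lam $ i) = Re (lam $ a) * of_int (z i) / Determinants.det M"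
      using sol[of "\<chi> i. Re (lam $ i)" i] by (simp flip: Re_mpair)
    moreover have "Im (lam $ i) = Im (lam $ a) * of_int (z i) / Determinants.det M"
      using sol[of "\<chi> i. Im (lam $ i)" i] by (simp flip: Im_mpair)
    ultimately show "lam $ i = lam $ a * of_int (z i) / of_real (Determinants.det M)"
      by (simp add: complex_eq_iff)
  qed (rule det)
qed

text \<open>All divisors are integer multiples of the single number \<open>lam $ a / D\<close>, so a
  nonzero one is at least as large.\<close>

lemma no_small_divisors:
  fixes lam :: "complex ^ 'n"
  assumes rank: "resonant_rank lam = CARD('n) - 1" and "lam \<noteq> 0"
  obtains \<delta> where "\<delta> > 0" "\<And>m j. mpair m lam \<noteq> lam $ j \<Longrightarrow> \<delta> \<le> norm (mpair m lam - lam $ j)"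
proof -
  obtain a where a: "lam $ a \<noteq> 0" using assms(2) by (auto simp: vec_eq_iff)
  obtain D z where D: "D \<noteq> 0" and z: "\<And>i. lam $ i = lam $ a * of_int (z i) / of_real D"
    using resonant_rank_commensurable[OF rank a] by metis
  have "norm (lam $ a / of_real D) \<le> norm (mpair m lam - lam $ j)" if "mpair m lam \<noteq> lam $ j" for m j
  proof -
    define k where "k = (\<Sum>i\<in>UNIV. int (m $ i) * z i) - z j"
    have "mpair m lam = (\<Sum>i\<in>UNIV. lam $ a / of_real D * (of_nat (m $ i) * of_int (z i)))"
      unfolding mpair_def by (intro sum.cong refl) (subst z, simp)
    also have "\<dots> - lam $ j = lam $ a / of_real D * of_int k"
      unfolding sum_distrib_left[symmetric] by (subst z) (simp add: k_def algebra_simps diff_divide_distrib)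
    finally have eq: "mpair m lam - lam $ j = lam $ a / of_real D * of_int k" .
    hence "k \<noteq> 0" using that by auto
    hence "1 \<le> norm (of_int k :: complex)" by simp
    thus ?thesis unfolding eq norm_mult[of _ "of_int k"]
      using mult_left_mono[of 1 "norm (of_int k :: complex)" "norm (lam $ a / of_real D)"] by simp
  qed
  moreover have "norm (lam $ a / of_real D) > 0" using a D by simp
  ultimately show ?thesis using that by blast
qed

subsection \<open>Convergence\<close>

lemma conv_common:
  fixes F :: "'n::finite \<Rightarrow> 'n mps"
  assumes "\<And>j. conv (F j)"
  obtains s M where "s > 0" "M \<ge> 0" "\<And>j. bnd s (F j) M"
proof -
  obtain r B where r: "\<And>j. r j > 0" "\<And>j. bnd (r j) (F j) (B j)" using assms unfolding conv_def by metis
  have s: "Min (range r) > 0" using r by simp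
  have b: "bnd (Min (range r)) (F j) (\<Sum>j\<in>UNIV. B j)" for j
  proof (rule bnd_weaken[OF bnd_smaller[OF r(2)]])
    show "B j \<le> (\<Sum>j\<in>UNIV. B j)" using bnd_nonneg[OF r(2)] by (intro member_le_sum) auto
  qed (use less_imp_le[OF s] in auto)
  show ?thesis by (rule that[OF s bnd_nonneg[OF b] b])
qed

text \<open>A partial sum involves finitely many places, and finitely many iterations reach the
  values of the fixed point there.\<close>

lemma tri_bnd:
  fixes T :: "((nat ^ 'n::finite) \<times> 'z \<Rightarrow> complex) \<Rightarrow> (nat ^ 'n) \<times> 'z \<Rightarrow> complex"
    and \<mu> :: "(nat ^ 'n) \<times> 'z \<Rightarrow> nat"
  assumes "\<And>p q i. (\<And>k. \<mu> k < \<mu> i \<Longrightarrow> p k = q k) \<Longrightarrow> T p i = T q i" "T p = p"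
    and "\<And>N. bnd r (Mps (\<lambda>m. (T ^^ N) q (m, z))) B"
  shows "bnd r (Mps (\<lambda>m. p (m, z))) B"
proof (rule bndI)
  fix A :: "(nat ^ 'n) set" assume A: "finite A"
  define N where "N = Suc (\<Sum>m\<in>A. \<mu> (m, z))"
  have eq: "(T ^^ N) q (m, z) = p (m, z)" if "m \<in> A" for m
    using member_le_sum[OF that _ A, of "\<lambda>m. \<mu> (m, z)"]
    by (intro tri_iterate[where T = T and \<mu> = \<mu> and p = p, OF assms(1) assms(2)]) (auto simp: N_def less_Suc_eq_le)
  have "(\<Sum>m\<in>A. norm (coef (Mps (\<lambda>m. p (m, z))) m) * r ^ mdeg m)
      = (\<Sum>m\<in>A. norm (coef (Mps (\<lambda>m. (T ^^ N) q (m, z))) m) * r ^ mdeg m)"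
    using eq by (intro sum.cong) auto
  thus "(\<Sum>m\<in>A. norm (coef (Mps (\<lambda>m. p (m, z))) m) * r ^ mdeg m) \<le> B"
    using bndD[OF assms(3) A] by simp
qed

text \<open>The inverse \<open>Y + \<psi>\<close> is characterised by
  \<open>\<psi> = - \<phi>(Y + \<psi>)\<close>, a triangular fixed-point problem because
  \<open>\<phi>\<close> has order 2. Convergence follows from an invariant ball.\<close>

lemma tangent_right_inverse:
  fixes \<phi> :: "'n::finite \<Rightarrow> 'n mps"
  assumes \<phi>: "\<And>j. ord_ge (\<lambda>_. 1) 2 (\<phi> j)"
  obtains \<psi> where "\<And>j. ord_ge (\<lambda>_. 1) 2 (\<psi> j)" "\<And>j. mcomp (Y j + \<phi> j) (\<lambda>i. Y i + \<psi> i) = Y j"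
    "(\<forall>j. conv (\<phi> j)) \<Longrightarrow> \<forall>j. conv (\<psi> j)"
proof -
  define \<psi> :: "((nat ^ 'n) \<times> 'n \<Rightarrow> complex) \<Rightarrow> 'n \<Rightarrow> 'n mps" where "\<psi> p j = Mps (\<lambda>m. if mdeg m \<ge> 2 then p (m, j) else 0)" for p j
  define T where "T p = (\<lambda>(m, j). if mdeg m \<ge> 2 then - coef (mcomp (\<phi> j) (\<lambda>i. Y i + \<psi> p i)) m else 0)" for p
  define \<mu> :: "(nat ^ 'n) \<times> 'n \<Rightarrow> nat" where "\<mu> = (\<lambda>(m, j). mdeg m - 1)"
  have \<psi>_ord: "ord_ge (\<lambda>_. 1) 2 (\<psi> p j)" for p j by (simp add: ord_ge_def wdeg_1 \<psi>_def)
  have no_const: "no_const (\<lambda>i. Y i + \<psi> p i)" for p using no_const_Y by (auto simp: no_const_def \<psi>_def)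
  have tri: "T p i = T q i" if agree: "\<And>k. \<mu> k < \<mu> i \<Longrightarrow> p k = q k" for p q i
  proof -
    obtain m j where i: "i = (m, j)" by (cases i)
    show ?thesis
    proof (cases "mdeg m \<ge> 2")
      case True
      define N where "N = mdeg m - 1"
      have "ord_ge (\<lambda>_. 1) (1 + N) (\<psi> p k - \<psi> q k)" for k
        unfolding ord_ge_def wdeg_1 using agree by (auto simp: \<psi>_def \<mu>_def i N_def)
      hence "ord_ge (\<lambda>_. 1) (2 + N) (mcomp (\<phi> j) (\<lambda>i. Y i + \<psi> p i) - mcomp (\<phi> j) (\<lambda>i. Y i + \<psi> q i))"
        using no_const by (intro ord_ge_mcomp_diff \<phi>) (auto simp: no_const_ord_ge)
      thus ?thesis using True by (simp add: T_def i ord_ge_def wdeg_1 N_def)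
    qed (simp add: T_def i)
  qed
  obtain p where p: "T p = p" using tri_fix[of \<mu> T] tri by metis
  have eq: "\<psi> p j = - mcomp (\<phi> j) (\<lambda>i. Y i + \<psi> p i)" for j
  proof (rule mps_eqI)
    fix m
    show "coef (\<psi> p j) m = coef (- mcomp (\<phi> j) (\<lambda>i. Y i + \<psi> p i)) m"
    proof (cases "mdeg m \<ge> 2")
      case True
      have "p (m, j) = T p (m, j)" by (simp only: p)
      thus ?thesis using True by (simp add: T_def \<psi>_def)
    next
      case False
      have "ord_ge (\<lambda>_. 1) (2 + 0) (mcomp (\<phi> j) (\<lambda>i. Y i + \<psi> p i) - mcomp (\<phi> j) (\<lambda>_. 0))"
        using no_const by (intro ord_ge_mcomp_diff \<phi>) (auto simp: no_const_ord_ge)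
      moreover have "coef (\<phi> j) 0 = 0" using \<phi>[of j] by (simp add: ord_ge_def wdeg_1)
      ultimately show ?thesis using False by (auto simp: ord_ge_def wdeg_1 \<psi>_def mcomp_zero coef_cst)
    qed
  qed
  show ?thesis
  proof (rule that[of "\<psi> p"])
    fix j show "mcomp (Y j + \<phi> j) (\<lambda>i. Y i + \<psi> p i) = Y j"
      using eq[of j] by (simp add: mcomp_add mcomp_Y[OF no_const])
  next
    assume "\<forall>j. conv (\<phi> j)"
    then obtain s M where s: "s > 0" "M \<ge> 0" "\<And>j. bnd s (\<phi> j) M" using conv_common[of \<phi>] by blast
    \<comment> \<open>\<open>2 * t \<le> s\<close> keeps \<open>Y + \<psi>\<close> inside the domain
      of the bound for \<open>\<phi>\<close>; the second entry gives
      \<open>M * (2 * t / s)\<^sup>2 \<le> t\<close>, so the ball of radius \<open>t\<close> is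
      mapped into itself.\<close>
    define t where "t = min (s / 2) (s\<^sup>2 / (4 * (M + 1)))"
    have t: "t > 0" "2 * t \<le> s" using s by (auto simp: t_def)
    have Mt: "M * (2 * t / s)\<^sup>2 \<le> t"
    proof -
      have "t \<le> s\<^sup>2 / (4 * (M + 1))" by (simp add: t_def)
      hence "t * (4 * (M + 1)) \<le> s\<^sup>2" using s by (subst (asm) pos_le_divide_eq) auto
      hence "4 * M * t \<le> s\<^sup>2" using t by (simp add: algebra_simps)
      hence "(4 * M * t) * t \<le> s\<^sup>2 * t" using t by (intro mult_right_mono) auto
      thus ?thesis using s by (simp add: power_divide divide_le_eq power2_eq_square mult_ac)
    qed
    have ball: "bnd t (Mps (\<lambda>m. (T ^^ N) (\<lambda>_. 0) (m, i))) t" for N i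
    proof (induction N arbitrary: i)
      case 0 show ?case using t by (simp add: bnd_def)
    next
      case (Suc N)
      let ?q = "(T ^^ N) (\<lambda>_. 0)"
      have "bnd t (\<psi> ?q k) (1 * t)" for k
        using t by (intro bnd_scale[OF Suc]) (auto simp: \<psi>_def)
      hence b: "bnd t (Y k + \<psi> ?q k) (2 * t)" for k
        using bnd_add[of t "Y k" t "\<psi> ?q k" t] bnd_mon[of t "axis k 1"] t by simp
      have "bnd (2 * t) (\<phi> i) (M * (2 * t / s)\<^sup>2)"
        using s t by (intro bnd_of_ord_ge \<phi>) auto
      hence "bnd t (mcomp (\<phi> i) (\<lambda>k. Y k + \<psi> ?q k)) (M * (2 * t / s)\<^sup>2)"
        using t by (intro bnd_mcomp[OF _ b]) auto
      hence "bnd t (Mps (\<lambda>m. T ?q (m, i))) (1 * (M * (2 * t / s)\<^sup>2))"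
        by (rule bnd_scale) (use t in \<open>auto simp: T_def\<close>)
      thus ?case using Mt by (auto intro: bnd_weaken)
    qed
    have pj: "bnd t (Mps (\<lambda>m. p (m, j))) t" for j
      by (rule tri_bnd[where T = T and \<mu> = \<mu> and q = "\<lambda>_. 0", OF tri p ball])
    have "bnd t (\<psi> p j) (1 * t)" for j using t by (intro bnd_scale[OF pj[of j]]) (auto simp: \<psi>_def)
    thus "\<forall>j. conv (\<psi> p j)" using t convI by blast
  qed (rule \<psi>_ord)
qed

text \<open>The right inverse \<open>\<psi>\<close> has itself a right inverse \<open>\<xi>\<close>,
  and associativity of substitution gives \<open>\<xi> = \<phi>\<close>, as in a group.\<close>

lemma tangent_inverse:
  fixes \<phi> :: "'n::finite \<Rightarrow> 'n mps"
  assumes \<phi>: "\<And>j. ord_ge (\<lambda>_. 1) 2 (\<phi> j)"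
  obtains \<psi> where "\<And>j. ord_ge (\<lambda>_. 1) 2 (\<psi> j)" "\<And>j. mcomp (Y j + \<phi> j) (\<lambda>i. Y i + \<psi> i) = Y j"
    "\<And>j. mcomp (Y j + \<psi> j) (\<lambda>i. Y i + \<phi> i) = Y j" "(\<forall>j. conv (\<phi> j)) \<Longrightarrow> \<forall>j. conv (\<psi> j)"
proof -
  obtain \<psi> where \<psi>: "\<And>j. ord_ge (\<lambda>_. 1) 2 (\<psi> j)" "\<And>j. mcomp (Y j + \<phi> j) (\<lambda>i. Y i + \<psi> i) = Y j"
    "(\<forall>j. conv (\<phi> j)) \<Longrightarrow> \<forall>j. conv (\<psi> j)" by (rule tangent_right_inverse[of \<phi>, OF \<phi>]) (rule that)
  obtain \<xi> where \<xi>: "\<And>j. ord_ge (\<lambda>_. 1) 2 (\<xi> j)" "\<And>j. mcomp (Y j + \<psi> j) (\<lambda>i. Y i + \<xi> i) = Y j"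
    by (rule tangent_right_inverse[of \<psi>, OF \<psi>(1)]) (rule that)
  have no_const: "no_const (\<lambda>i. Y i + \<theta> i)" if "\<And>j. ord_ge (\<lambda>_. 1) 2 (\<theta> j)" for \<theta> :: "'n \<Rightarrow> 'n mps"
    using no_const_Y that by (auto simp: no_const_def ord_ge_def wdeg_1)
  have "Y j + \<phi> j = Y j + \<xi> j" for j
  proof -
    have "Y j + \<phi> j = mcomp (Y j + \<phi> j) (\<lambda>i. mcomp (Y i + \<psi> i) (\<lambda>i. Y i + \<xi> i))" by (simp add: \<xi>(2))
    also have "\<dots> = mcomp (mcomp (Y j + \<phi> j) (\<lambda>i. Y i + \<psi> i)) (\<lambda>i. Y i + \<xi> i)"
      by (rule mcomp_assoc[OF no_const[OF \<xi>(1)] no_const[OF \<psi>(1)], symmetric])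
    also have "\<dots> = Y j + \<xi> j" using mcomp_Y[OF no_const[OF \<xi>(1)]] by (simp add: \<psi>(2))
    finally show ?thesis .
  qed
  hence "mcomp (Y j + \<psi> j) (\<lambda>i. Y i + \<phi> i) = Y j" for j using \<xi>(2) by simp
  thus ?thesis using that[of \<psi>] \<psi> by blast
qed

text \<open>The equation splits by resonance. Its nonresonant part determines
  \<open>D\<phi> S - S \<phi>\<close>; its resonant part in the one component \<open>a\<close>
  determines \<open>lam $ a * g\<close>, since \<open>g * lie (diagf lam) (\<phi> a)\<close> has no
  resonant terms.\<close>

lemma normal_form_converges:
  fixes F \<phi> :: "'n::finite \<Rightarrow> 'n mps"
  assumes lam: "lam $ a \<noteq> 0" and \<delta>: "\<delta> > 0" "\<And>m j. mpair m lam \<noteq> lam $ j \<Longrightarrow> \<delta> \<le> norm (mpair m lam - lam $ j)"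
    and F: "\<And>j. ord_ge (\<lambda>_. 1) 2 (F j)" "\<And>j. conv (F j)"
    and \<phi>: "\<And>j m. coef (\<phi> j) m \<noteq> 0 \<Longrightarrow> mdeg m \<ge> 2 \<and> mpair m lam \<noteq> lam $ j"
    and g: "\<And>m. coef g m \<noteq> 0 \<Longrightarrow> m \<noteq> 0 \<and> mpair m lam = 0"
    and eq: "\<And>j. diagf lam j * g + lie (diagf lam) (\<phi> j) - cst (lam $ j) * \<phi> j + g * lie (diagf lam) (\<phi> j)
        = mcomp (F j) (\<lambda>i. Y i + \<phi> i)"
  shows "conv (\<phi> j)" "conv g"
proof -
  \<comment> \<open>The unknown at \<open>(m, Some j)\<close> is the coefficient of \<open>D\<phi> S - S \<phi>\<close>, at \<open>(m, None)\<close> that of \<open>g\<close>.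
    The triangular operator \<open>T\<close> preserves a ball of a weighted \<open>l\<^sup>1\<close> norm, so its only fixed point
    lies in that ball.\<close>
  define \<Phi> :: "((nat ^ 'n) \<times> 'n option \<Rightarrow> complex) \<Rightarrow> 'n \<Rightarrow> 'n mps" where
    "\<Phi> p j = Mps (\<lambda>m. if mdeg m \<ge> 2 \<and> mpair m lam \<noteq> lam $ j then p (m, Some j) / (mpair m lam - lam $ j) else 0)" for p j
  define \<gamma> :: "((nat ^ 'n) \<times> 'n option \<Rightarrow> complex) \<Rightarrow> 'n mps" where
    "\<gamma> p = Mps (\<lambda>m. if m \<noteq> 0 \<and> mpair m lam = 0 then p (m, None) else 0)" for p
  define C where "C p j = mcomp (F j) (\<lambda>i. Y i + \<Phi> p i)" for p j
  define E where "E p j = C p j - \<gamma> p * lie (diagf lam) (\<Phi> p j)" for p j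
  define T where "T p = (\<lambda>(m, z). case z of
      Some j \<Rightarrow> if mdeg m \<ge> 2 \<and> mpair m lam \<noteq> lam $ j then coef (E p j) m else 0
    | None \<Rightarrow> if m \<noteq> 0 \<and> mpair m lam = 0 then coef (C p a) (m + axis a 1) / lam $ a else 0)" for p
  \<comment> \<open>The weights of the corresponding fields: a monomial \<open>m\<close> in
    component \<open>j\<close> has weight \<open>mdeg m - 1\<close>, and \<open>m\<close> times the
    linear field has weight \<open>mdeg m\<close>.\<close>
  define \<mu> :: "(nat ^ 'n) \<times> 'n option \<Rightarrow> nat" where
    "\<mu> = (\<lambda>(m, z). case z of Some j \<Rightarrow> mdeg m - 1 | None \<Rightarrow> mdeg m)"
  define p0 where "p0 = (\<lambda>(m, z). case z of Some j \<Rightarrow> (mpair m lam - lam $ j) * coef (\<phi> j) m | None \<Rightarrow> coef g m)"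
  have \<Phi>0: "\<Phi> p0 j = \<phi> j" for j
    using \<phi>[of j] by (intro mps_eqI) (auto simp: \<Phi>_def p0_def)
  have \<gamma>0: "\<gamma> p0 = g" using g by (intro mps_eqI) (auto simp: \<gamma>_def p0_def)
  have \<Phi>_ord: "ord_ge (\<lambda>_. 1) 2 (\<Phi> p j)" for p j by (simp add: ord_ge_def wdeg_1 \<Phi>_def)
  have \<gamma>_ord: "ord_ge (\<lambda>_. 1) 1 (\<gamma> p)" for p by (simp add: ord_ge_def wdeg_1 \<gamma>_def mdeg_eq_0_iff)
  have no_const: "no_const (\<lambda>i. Y i + \<Phi> p i)" for p using no_const_Y by (auto simp: no_const_def \<Phi>_def)
  have S_ord: "ord_ge (\<lambda>_. 1) k (lie (diagf lam) G)" if "ord_ge (\<lambda>_. 1) k G" for k G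
    using that by (simp add: ord_ge_def coef_lie_diagf)
  have tri: "T p i = T q i" if agree: "\<And>k. \<mu> k < \<mu> i \<Longrightarrow> p k = q k" for p q i
  proof -
    obtain m z where i: "i = (m, z)" by (cases i)
    have d\<Phi>: "ord_ge (\<lambda>_. 1) (1 + N) (\<Phi> p k - \<Phi> q k)" if "N = \<mu> i" for N k
      unfolding ord_ge_def wdeg_1 using agree that by (auto simp: \<Phi>_def \<mu>_def)
    have dC: "ord_ge (\<lambda>_. 1) (2 + N) (C p k - C q k)" if "N = \<mu> i" for N k
      unfolding C_def using no_const d\<Phi>[OF that] by (intro ord_ge_mcomp_diff F) (auto simp: no_const_ord_ge)
    show ?thesis
    proof (cases z)
      case None
      show ?thesis using dC[OF refl, of a] by (simp add: T_def i None \<mu>_def ord_ge_def wdeg_1 mdeg_add)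
    next
      case (Some j)
      show ?thesis
      proof (cases "mdeg m \<ge> 2")
        case True
        define N where "N = mdeg m - 1"
        have N: "N = \<mu> i" by (simp add: N_def \<mu>_def i Some)
        have d\<gamma>: "ord_ge (\<lambda>_. 1) N (\<gamma> p - \<gamma> q)"
          unfolding ord_ge_def wdeg_1 N using agree by (auto simp: \<gamma>_def \<mu>_def)
        have "\<gamma> p * lie (diagf lam) (\<Phi> p j) - \<gamma> q * lie (diagf lam) (\<Phi> q j)
            = \<gamma> p * lie (diagf lam) (\<Phi> p j - \<Phi> q j) + (\<gamma> p - \<gamma> q) * lie (diagf lam) (\<Phi> q j)"
          by (simp add: lie_diff algebra_simps)
        moreover have "ord_ge (\<lambda>_. 1) (1 + (1 + N)) (\<gamma> p * lie (diagf lam) (\<Phi> p j - \<Phi> q j))"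
          using d\<Phi>[OF N] by (intro ord_ge_mult \<gamma>_ord S_ord)
        moreover have "ord_ge (\<lambda>_. 1) (N + 2) ((\<gamma> p - \<gamma> q) * lie (diagf lam) (\<Phi> q j))"
          by (intro ord_ge_mult d\<gamma> S_ord \<Phi>_ord)
        moreover have "mdeg m < 2 + N" using True by (simp add: N_def)
        ultimately have "coef (\<gamma> p * lie (diagf lam) (\<Phi> p j) - \<gamma> q * lie (diagf lam) (\<Phi> q j)) m = 0"
          by (simp add: ord_ge_def wdeg_1)
        moreover have "coef (C p j - C q j) m = 0"
          using dC[OF N] \<open>mdeg m < 2 + N\<close> by (simp add: ord_ge_def wdeg_1)
        ultimately have "coef (E p j) m = coef (E q j) m" by (simp add: E_def)
        thus ?thesis by (simp add: T_def i Some)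
      qed (simp add: T_def i Some)
    qed
  qed
  have Tp0: "T p0 = p0"
  proof
    fix i :: "(nat ^ 'n) \<times> 'n option"
    obtain m z where i: "i = (m, z)" by (cases i)
    have res: "coef (diagf lam j * g) m' = 0" if "mpair m' lam \<noteq> lam $ j" for j m'
    proof (cases "m' $ j = 0")
      case True thus ?thesis by (simp add: diagf_def mult.assoc coef_Y_mult)
    next
      case False
      then obtain m'' where "m' = m'' + axis j 1" using add_dec by metis
      thus ?thesis using that g[of m''] by (auto simp: diagf_def mult.assoc mpair_add)
    qed
    have eqm: "coef (diagf lam j * g) m' + (mpair m' lam - lam $ j) * coef (\<phi> j) m' = coef (E p0 j) m'" for j m'
      using arg_cong[OF eq[of j], of "\<lambda>F. coef F m'"]
      by (simp add: E_def C_def \<Phi>0 \<gamma>0 coef_lie_diagf left_diff_distrib eq_diff_eq add_diff_eq)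
    show "T p0 i = p0 i"
    proof (cases z)
      case (Some j)
      show ?thesis
      proof (cases "mdeg m \<ge> 2 \<and> mpair m lam \<noteq> lam $ j")
        case True
        thus ?thesis using eqm[of j m] res[of m j] by (simp add: T_def p0_def i Some)
      next
        case False
        hence "(mpair m lam - lam $ j) * coef (\<phi> j) m = 0" using \<phi>[of j m] by auto
        thus ?thesis using False by (auto simp: T_def p0_def i Some)
      qed
    next
      case None
      show ?thesis
      proof (cases "m \<noteq> 0 \<and> mpair m lam = 0")
        case True
        have "coef (g * lie (diagf lam) (\<phi> a)) (m + axis a 1) = 0"
          unfolding coef_mult
        proof (intro sum.neutral ballI)
          fix p assume p: "p \<in> splits (m + axis a 1)"
          obtain b c where bc: "p = (b, c)" by (cases p)
          have "mpair b lam + mpair c lam = mpair (b + c) lam" by (rule mpair_add[symmetric])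
          also have "b + c = m + axis a 1" using p by (simp add: bc)
          also have "mpair (m + axis a 1) lam = lam $ a" using True by (simp add: mpair_add)
          finally have "mpair b lam + mpair c lam = lam $ a" .
          hence "coef g b = 0 \<or> coef (\<phi> a) c = 0" using g[of b] \<phi>[of a c] by (cases "coef g b = 0") auto
          thus "(case p of (b, c) \<Rightarrow> coef g b * coef (lie (diagf lam) (\<phi> a)) c) = 0"
            by (auto simp: bc coef_lie_diagf)
        qed
        moreover have "mpair (m + axis a 1) lam = lam $ a" using True by (simp add: mpair_add)
        ultimately have "lam $ a * coef g m = coef (C p0 a) (m + axis a 1)"
          using eqm[of a "m + axis a 1"] by (simp add: E_def \<gamma>0 \<Phi>0 diagf_def mult.assoc)
        hence "coef g m = coef (C p0 a) (m + axis a 1) / lam $ a" using lam by (simp add: eq_divide_eq mult.commute)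
        moreover have "T p0 i = coef (C p0 a) (m + axis a 1) / lam $ a" using True by (simp add: T_def i None)
        moreover have "p0 i = coef g m" by (simp add: p0_def i None)
        ultimately show ?thesis by simp
      next
        case False thus ?thesis using g[of m] by (auto simp: T_def p0_def i None)
      qed
    qed
  qed
  obtain s M where s: "s > 0" "M \<ge> 0" "\<And>j. bnd s (F j) M" using conv_common[of F] F(2) by blast
  define \<Lambda> where "\<Lambda> = (\<Sum>j\<in>UNIV. norm (lam $ j))"
  have \<Lambda>: "norm (lam $ j) \<le> \<Lambda>" for j unfolding \<Lambda>_def by (rule member_le_sum) auto
  have \<Lambda>0: "0 \<le> \<Lambda>" unfolding \<Lambda>_def by (intro sum_nonneg) auto
  \<comment> \<open>Bounds \<open>mpair m lam / (mpair m lam - lam $ j)\<close>, the price of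
    passing from the unknown to the derivative of \<open>\<phi>\<close> along the linear
    field.\<close>
  define L where "L = 1 + \<Lambda> / \<delta>"
  have L: "L \<ge> 1" using \<Lambda>0 \<delta>(1) by (simp add: L_def)
  \<comment> \<open>The radius of the ball for \<open>g\<close>. With \<open>c * L = 1 / 2\<close>
    the quadratic term uses half of the ball of radius \<open>\<delta> * t\<close> for the other
    unknown, which in turn keeps \<open>\<phi>\<close> within \<open>t\<close>.\<close>
  define c where "c = 1 / (2 * L)"
  have c: "c > 0" "c * L = 1 / 2" using L by (auto simp: c_def)
  \<comment> \<open>One bound \<open>Q \<le> \<theta> * t\<close> on the composite then covers both
    needs: the remaining half \<open>\<delta> * t / 2\<close>, and
    \<open>c * norm (lam $ a) * t\<close> for \<open>g\<close>.\<close>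
  define \<theta> where "\<theta> = min (\<delta> / 2) (c * norm (lam $ a))"
  have \<theta>: "\<theta> > 0" using \<delta>(1) c(1) lam by (simp add: \<theta>_def)
  define t where "t = min (s / 2) (\<theta> * s\<^sup>2 / (4 * (M + 1)))"
  have t: "t > 0" "2 * t \<le> s" using s \<theta> by (auto simp: t_def)
  define Q where "Q = M * (2 * t / s)\<^sup>2"
  have Q: "Q \<le> \<theta> * t"
  proof -
    have "t \<le> \<theta> * s\<^sup>2 / (4 * (M + 1))" by (simp add: t_def)
    hence "t * (4 * (M + 1)) \<le> \<theta> * s\<^sup>2" using s by (subst (asm) pos_le_divide_eq) auto
    hence "4 * M * t \<le> \<theta> * s\<^sup>2" using t by (simp add: algebra_simps)
    hence "(4 * M * t) * t \<le> (\<theta> * s\<^sup>2) * t" using t by (intro mult_right_mono) auto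
    thus ?thesis unfolding Q_def using s by (simp add: power_divide divide_le_eq power2_eq_square mult_ac)
  qed
  have div1: "norm (coef (\<Phi> p j) m) \<le> 1 / \<delta> * norm (p (m, Some j))" for p j m
  proof (cases "mdeg m \<ge> 2 \<and> mpair m lam \<noteq> lam $ j")
    case True
    hence "norm (p (m, Some j)) / norm (mpair m lam - lam $ j) \<le> norm (p (m, Some j)) / \<delta>"
      using \<delta> by (intro divide_left_mono mult_pos_pos) (auto intro: less_le_trans)
    thus ?thesis using True by (simp add: \<Phi>_def norm_divide)
  next
    case False thus ?thesis using \<delta>(1) by (simp add: \<Phi>_def)
  qed
  have div2: "norm (coef (lie (diagf lam) (\<Phi> p j)) m) \<le> L * norm (p (m, Some j))" for p j m
  proof (cases "mdeg m \<ge> 2 \<and> mpair m lam \<noteq> lam $ j")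
    case True
    have e: "coef (lie (diagf lam) (\<Phi> p j)) m = p (m, Some j) + lam $ j * coef (\<Phi> p j) m"
      using True by (simp add: coef_lie_diagf \<Phi>_def field_simps)
    have "norm (lam $ j * coef (\<Phi> p j) m) \<le> \<Lambda> * (1 / \<delta> * norm (p (m, Some j)))"
      unfolding norm_mult using \<Lambda>0 by (intro mult_mono \<Lambda> div1) auto
    hence "norm (p (m, Some j) + lam $ j * coef (\<Phi> p j) m) \<le> norm (p (m, Some j)) + \<Lambda> * (1 / \<delta> * norm (p (m, Some j)))"
      by (intro order_trans[OF norm_triangle_ineq]) simp
    thus ?thesis unfolding e L_def by (simp add: algebra_simps)
  next
    case False thus ?thesis using L by (simp add: \<Phi>_def coef_lie_diagf)
  qed
  have ball: "(\<forall>j. bnd t (Mps (\<lambda>m. (T ^^ N) (\<lambda>_. 0) (m, Some j))) (\<delta> * t)) \<and>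
      bnd t (Mps (\<lambda>m. (T ^^ N) (\<lambda>_. 0) (m, None))) c" for N
  proof (induction N)
    case 0 show ?case using t \<delta>(1) c(1) by (simp add: bnd_def)
  next
    case (Suc N)
    let ?q = "(T ^^ N) (\<lambda>_. 0)"
    have q1: "bnd t (Mps (\<lambda>m. ?q (m, Some j))) (\<delta> * t)" for j using Suc by blast
    have q2: "bnd t (Mps (\<lambda>m. ?q (m, None))) c" using Suc by blast
    have "bnd t (\<Phi> ?q j) (1 / \<delta> * (\<delta> * t))" for j
      by (rule bnd_scale[OF q1[of j]]) (use div1 t \<delta>(1) in auto)
    hence b: "bnd t (Y j + \<Phi> ?q j) (2 * t)" for j
      using bnd_add[of t "Y j" t "\<Phi> ?q j" t] bnd_mon[of t "axis j 1"] t \<delta>(1) by simp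
    have bS: "bnd t (lie (diagf lam) (\<Phi> ?q j)) (L * (\<delta> * t))" for j
      by (rule bnd_scale[OF q1[of j]]) (use div2 t L in auto)
    have b\<gamma>: "bnd t (\<gamma> ?q) (1 * c)"
      by (rule bnd_scale[OF q2]) (use t in \<open>auto simp: \<gamma>_def\<close>)
    have "bnd (2 * t) (F j) Q" for j unfolding Q_def using s t by (intro bnd_of_ord_ge F) auto
    hence bC: "bnd t (C ?q j) Q" for j unfolding C_def using t by (intro bnd_mcomp[OF _ b]) auto
    have bE: "bnd t (E ?q j) (\<delta> * t)" for j
    proof (rule bnd_weaken)
      show "bnd t (E ?q j) (Q + (1 * c) * (L * (\<delta> * t)))"
        unfolding E_def using t by (intro bnd_diff bnd_mult bC b\<gamma> bS) auto
      have "(1 * c) * (L * (\<delta> * t)) = c * L * (\<delta> * t)" by simp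
      also have "\<dots> = \<delta> * t / 2" unfolding c(2) by simp
      finally have e: "(1 * c) * (L * (\<delta> * t)) = \<delta> * t / 2" .
      have "Q \<le> \<delta> / 2 * t" using t by (intro order_trans[OF Q] mult_right_mono) (auto simp: \<theta>_def)
      thus "Q + (1 * c) * (L * (\<delta> * t)) \<le> \<delta> * t" unfolding e by simp
    qed
    have "bnd t (Mps (\<lambda>m. T ?q (m, Some j))) (1 * (\<delta> * t))" for j
      by (rule bnd_scale[OF bE[of j]]) (use t in \<open>auto simp: T_def\<close>)
    \<comment> \<open>Removing the factor \<open>Y a\<close> costs a division by \<open>t\<close>;
      this is affordable because \<open>Q\<close> is quadratic in \<open>t\<close>.\<close>
    moreover have "bnd t (Mps (\<lambda>m. T ?q (m, None))) c"
    proof (rule bndI)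
      fix A :: "(nat ^ 'n) set" assume A: "finite A"
      have "(\<Sum>m\<in>A. norm (coef (Mps (\<lambda>m. T ?q (m, None))) m) * t ^ mdeg m)
          \<le> (\<Sum>m\<in>A. norm (coef (C ?q a) (m + axis a 1)) * t ^ mdeg (m + axis a 1) / (norm (lam $ a) * t))"
      proof (rule sum_mono)
        fix m
        have "norm (coef (Mps (\<lambda>m. T ?q (m, None))) m) \<le> norm (coef (C ?q a) (m + axis a 1)) / norm (lam $ a)"
          by (auto simp: T_def norm_divide)
        hence "norm (coef (Mps (\<lambda>m. T ?q (m, None))) m) * t ^ mdeg m
            \<le> norm (coef (C ?q a) (m + axis a 1)) / norm (lam $ a) * t ^ mdeg m"
          using t by (intro mult_right_mono) auto
        also have "\<dots> = norm (coef (C ?q a) (m + axis a 1)) * t ^ mdeg (m + axis a 1) / (norm (lam $ a) * t)"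
          using t by (simp add: mdeg_add power_add)
        finally show "norm (coef (Mps (\<lambda>m. T ?q (m, None))) m) * t ^ mdeg m
            \<le> norm (coef (C ?q a) (m + axis a 1)) * t ^ mdeg (m + axis a 1) / (norm (lam $ a) * t)" .
      qed
      also have "\<dots> = (\<Sum>m\<in>(\<lambda>m. m + axis a 1) ` A. norm (coef (C ?q a) m) * t ^ mdeg m) / (norm (lam $ a) * t)"
        by (subst sum.reindex) (auto simp: inj_on_def sum_divide_distrib)
      also have "\<dots> \<le> Q / (norm (lam $ a) * t)"
        using A t by (intro divide_right_mono bndD[OF bC]) auto
      also have "\<dots> \<le> c"
      proof -
        have "Q \<le> (c * norm (lam $ a)) * t" using t by (intro order_trans[OF Q] mult_right_mono) (auto simp: \<theta>_def)
        thus ?thesis using t lam by (simp add: divide_le_eq mult.assoc)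
      qed
      finally show "(\<Sum>m\<in>A. norm (coef (Mps (\<lambda>m. T ?q (m, None))) m) * t ^ mdeg m) \<le> c" .
    qed
    ultimately show ?case by simp
  qed
  have pS: "bnd t (Mps (\<lambda>m. p0 (m, Some j))) (\<delta> * t)" for j
    using ball by (intro tri_bnd[where T = T and \<mu> = \<mu> and q = "\<lambda>_. 0", OF tri Tp0]) auto
  have pN: "bnd t (Mps (\<lambda>m. p0 (m, None))) c"
    using ball by (intro tri_bnd[where T = T and \<mu> = \<mu> and q = "\<lambda>_. 0", OF tri Tp0]) auto
  have "bnd t (\<Phi> p0 j) (1 / \<delta> * (\<delta> * t))"
    by (rule bnd_scale[OF pS[of j]]) (use div1 t \<delta>(1) in auto)
  thus "conv (\<phi> j)" using t \<Phi>0 convI by metis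
  have "Mps (\<lambda>m. p0 (m, None)) = g" by (rule mps_eqI) (simp add: p0_def)
  thus "conv g" using pN t convI by metis
qed

subsection \<open>Functions of finitely many monomials\<close>

text \<open>One coordinate after another is made monotone on a subsequence, and passing to
  subsequences keeps the earlier coordinates monotone.\<close>

lemma dickson_monotone:
  fixes s :: "nat \<Rightarrow> nat ^ 'n"
  assumes "finite I"
  shows "\<exists>f :: nat \<Rightarrow> nat. strict_mono f \<and> (\<forall>i\<in>I. \<forall>k l. k \<le> l \<longrightarrow> s (f k) $ i \<le> s (f l) $ i)"
  using assms
proof (induction I rule: finite_induct)
  case empty
  have "strict_mono (id :: nat \<Rightarrow> nat)" by (simp add: strict_mono_def)
  thus ?case by blast
next
  case (insert x I)
  from insert.IH obtain f :: "nat \<Rightarrow> nat" where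
    f': "strict_mono f \<and> (\<forall>i\<in>I. \<forall>k l. k \<le> l \<longrightarrow> s (f k) $ i \<le> s (f l) $ i)" ..
  hence f: "strict_mono f" "\<forall>i\<in>I. \<forall>k l. k \<le> l \<longrightarrow> s (f k) $ i \<le> s (f l) $ i" by (rule conjunct1, rule conjunct2)
  obtain h where h: "strict_mono h" "monoseq (\<lambda>k. s (f (h k)) $ x)"
    using seq_monosub[of "\<lambda>k. s (f k) $ x"] by blast
  have "\<exists>K. \<forall>k l. K \<le> k \<longrightarrow> k \<le> l \<longrightarrow> s (f (h k)) $ x \<le> s (f (h l)) $ x"
  proof (cases "\<forall>k l. k \<le> l \<longrightarrow> s (f (h k)) $ x \<le> s (f (h l)) $ x")
    case False
    hence dec: "\<And>k l. k \<le> l \<Longrightarrow> s (f (h l)) $ x \<le> s (f (h k)) $ x" using h(2) by (auto simp: monoseq_def)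
    \<comment> \<open>A decreasing sequence of natural numbers is constant from the place of its
      minimum on, hence also increasing there.\<close>
    obtain K where K: "\<And>k. s (f (h K)) $ x \<le> s (f (h k)) $ x"
      using ex_has_least_nat[of "\<lambda>_. True" 0 "\<lambda>k. s (f (h k)) $ x"] by blast
    have "s (f (h k)) $ x \<le> s (f (h l)) $ x" if "K \<le> k" for k l
      using dec[OF that] K[of l] by linarith
    thus ?thesis by blast
  qed blast
  then obtain K where K: "\<And>k l. K \<le> k \<Longrightarrow> k \<le> l \<Longrightarrow> s (f (h k)) $ x \<le> s (f (h l)) $ x" by blast
  have "strict_mono (\<lambda>k. f (h (K + k)))"
    using f(1) h(1) by (simp add: strict_mono_def)
  moreover have "h (K + k) \<le> h (K + l)" if "k \<le> l" for k l
    using h(1) that by (simp add: strict_mono_less_eq)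
  ultimately show ?case using f(2) K by (intro exI[of _ "\<lambda>k. f (h (K + k))"]) auto
qed

text \<open>Dickson's lemma: an infinite antichain would contain a monotone sequence of distinct
  elements.\<close>

lemma dickson_finite:
  fixes A :: "(nat ^ 'n) set"
  assumes anti: "\<And>a b. a \<in> A \<Longrightarrow> b \<in> A \<Longrightarrow> (\<And>i. a $ i \<le> b $ i) \<Longrightarrow> a = b"
  shows "finite A"
proof (rule ccontr)
  assume "infinite A"
  then obtain s :: "nat \<Rightarrow> nat ^ 'n" where s: "inj s" "range s \<subseteq> A" using infinite_countable_subset by blast
  from dickson_monotone[of UNIV s, OF finite] obtain f :: "nat \<Rightarrow> nat" where
    f': "strict_mono f \<and> (\<forall>i\<in>UNIV. \<forall>k l. k \<le> l \<longrightarrow> s (f k) $ i \<le> s (f l) $ i)" ..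
  hence f: "strict_mono f" "\<forall>i\<in>UNIV. \<forall>k l. k \<le> l \<longrightarrow> s (f k) $ i \<le> s (f l) $ i"
    by (rule conjunct1, rule conjunct2)
  have "s (f 0) = s (f 1)" using f(2) s(2) by (intro anti) auto
  hence "f 0 = f 1" using s(1) by (simp add: inj_eq)
  thus False using strict_monoD[OF f(1), of 0 1] by simp
qed

text \<open>The exponents orthogonal to \<open>lam\<close> form a monoid generated by its minimal nonzero elements,
  which are coprime.\<close>

lemma basic_generators:
  fixes lam :: "complex ^ 'n"
  obtains B where "finite B" "B \<subseteq> basic_exponents lam" "0 \<notin> B"
    "\<And>m. mpair m lam = 0 \<Longrightarrow> \<exists>a. m = (\<chi> i. \<Sum>b\<in>B. a b * b $ i)"
proof -
  define Z where "Z = {m :: nat ^ 'n. m \<noteq> 0 \<and> mpair m lam = 0}"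
  define B where "B = {m \<in> Z. \<forall>m'\<in>Z. (\<forall>i. m' $ i \<le> m $ i) \<longrightarrow> m' = m}"
  have fin: "finite B" by (rule dickson_finite) (auto simp: B_def)
  have basic: "b \<in> basic_exponents lam" if b: "b \<in> B" for b
  proof -
    have bZ: "b \<noteq> 0" "mpair b lam = 0" using b by (auto simp: B_def Z_def)
    define d where "d = Gcd (range (($) b))"
    have dvd: "d dvd b $ i" for i unfolding d_def by (rule Gcd_dvd) simp
    have d0: "d \<noteq> 0"
    proof
      assume "d = 0"
      hence "b = 0" using dvd by (simp add: vec_eq_iff)
      thus False using bZ by simp
    qed
    \<comment> \<open>Dividing by the greatest common divisor stays orthogonal to \<open>lam\<close>
      and below \<open>b\<close>, so minimality forces \<open>d = 1\<close>.\<close>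
    define m where "m = (\<chi> i. b $ i div d)"
    have bm: "b $ i = d * m $ i" for i using dvd by (simp add: m_def)
    have "mpair b lam = of_nat d * mpair m lam"
      unfolding mpair_def sum_distrib_left by (intro sum.cong refl) (simp add: bm)
    hence "mpair m lam = 0" using bZ d0 by simp
    moreover have "m \<noteq> 0" using bZ bm by (auto simp: vec_eq_iff)
    ultimately have "m \<in> Z" by (simp add: Z_def)
    moreover have "\<forall>i. m $ i \<le> b $ i" using d0 by (simp add: bm)
    ultimately have mb: "m = b" using b by (simp add: B_def)
    obtain i where "b $ i \<noteq> 0" using bZ by (auto simp: vec_eq_iff)
    moreover have "d * m $ i = m $ i"
    proof -
      have "d * m $ i = b $ i" by (rule bm[symmetric])
      also have "\<dots> = m $ i" by (simp only: mb)
      finally show ?thesis .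
    qed
    ultimately have "d = 1" by (simp add: mb)
    hence G: "Gcd (range (($) b)) = 1" by (simp add: d_def)
    show ?thesis
    proof (cases "mdeg b \<ge> 2")
      case True thus ?thesis using G bZ by (simp add: basic_exponents_def resonant_set_def)
    next
      \<comment> \<open>A minimal element of degree 1 is a unit vector with eigenvalue zero, the
        other kind of exponent in \<open>basic_exponents\<close>.\<close>
      case False
      hence "mdeg b = 1" using bZ mdeg_eq_0_iff[of b] by linarith
      then obtain i where "b = axis i 1" using mdeg_1_axis by metis
      thus ?thesis using G bZ by (auto simp: basic_exponents_def)
    qed
  qed
  have "mdeg m = k \<Longrightarrow> mpair m lam = 0 \<Longrightarrow> \<exists>a. m = (\<chi> i. \<Sum>b\<in>B. a b * b $ i)" for k m
  proof (induction k arbitrary: m rule: less_induct)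
    case (less k)
    show ?case
    proof (cases "m = 0")
      case True thus ?thesis by (intro exI[of _ "\<lambda>_. 0"]) (simp add: vec_eq_iff)
    next
      case False
      let ?Q = "\<lambda>m'. m' \<in> Z \<and> (\<forall>i. m' $ i \<le> m $ i)"
      have "?Q m" using False less by (simp add: Z_def)
      then obtain b where b: "?Q b" "\<And>m'. ?Q m' \<Longrightarrow> mdeg b \<le> mdeg m'"
        using ex_has_least_nat[of ?Q m mdeg] by blast
      \<comment> \<open>An element of least degree among those below \<open>m\<close> is minimal in
        all of \<open>Z\<close>, because anything below it is also below \<open>m\<close>.\<close>
      have bB: "b \<in> B"
        unfolding B_def
      proof (intro CollectI conjI ballI impI)
        fix m' assume m': "m' \<in> Z" "\<forall>i. m' $ i \<le> b $ i"
        then obtain c where c: "b = m' + c" using nat_vec_le_add[of m' b] by blast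
        have "?Q m'" using m' b(1) order_trans by blast
        hence "mdeg b \<le> mdeg m'" by (rule b(2))
        hence "c = 0" using c mdeg_eq_0_iff[of c] by (simp add: mdeg_add)
        thus "m' = b" using c by simp
      qed (use b in auto)
      obtain m' where m': "m = b + m'" using nat_vec_le_add[of b m] b(1) by blast
      have "mdeg b \<noteq> 0" using b(1) by (simp add: Z_def mdeg_eq_0_iff)
      hence "mdeg m' < k" using less(2) m' by (simp add: mdeg_add)
      moreover have "mpair m' lam = 0" using less(3) b(1) by (simp add: m' mpair_add Z_def)
      ultimately obtain a where a: "m' = (\<chi> i. \<Sum>b\<in>B. a b * b $ i)" using less(1) by blast
      have "m = (\<chi> i. \<Sum>c\<in>B. (a c + (if c = b then 1 else 0)) * c $ i)"
      proof -
        have "(\<Sum>c\<in>B. (a c + (if c = b then 1 else 0)) * c $ i) = (\<Sum>c\<in>B. a c * c $ i) + b $ i" for i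
        proof -
          have "(\<Sum>c\<in>B. (if c = b then 1 else 0) * c $ i) = (\<Sum>c\<in>B. if c = b then b $ i else 0)"
            by (intro sum.cong) auto
          thus ?thesis using fin bB by (simp add: distrib_right sum.distrib)
        qed
        thus ?thesis using m' a by (simp add: vec_eq_iff)
      qed
      thus ?thesis by (rule exI[of _ "\<lambda>c. a c + (if c = b then 1 else 0)"])
    qed
  qed
  thus ?thesis using that[of B] fin basic by (force simp: B_def Z_def)
qed

text \<open>Exponents may have several representations by the generators. One,
  \<open>\<alpha> m\<close>, is chosen for each \<open>m\<close>, and \<open>G\<close> carries the
  coefficients of \<open>g\<close> on these only. For small arguments its series is dominated by
  that of \<open>g\<close>.\<close>

lemma analytic_function_of_basic_monomials:
  fixes lam :: "complex ^ 'n"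
  assumes g: "\<And>m. coef g m \<noteq> 0 \<Longrightarrow> mpair m lam = 0" and "conv g"
  shows "analytic_function_of_monomials (basic_exponents lam) (eval g)"
proof -
  obtain B where B: "finite B" "B \<subseteq> basic_exponents lam" "0 \<notin> B"
    "\<And>m. mpair m lam = 0 \<Longrightarrow> \<exists>a. m = (\<chi> i. \<Sum>b\<in>B. a b * b $ i)" by (rule basic_generators[of lam]) (rule that)
  obtain s M where s: "s > 0" "bnd s g M" using assms(2) by (auto simp: conv_def)
  define ev where "ev a = (\<chi> i. \<Sum>b\<in>B. a b * b $ i)" for a :: "nat ^ 'n \<Rightarrow> nat"
  have "\<exists>\<alpha>. \<alpha> \<in> B \<rightarrow>\<^sub>E UNIV \<and> ev \<alpha> = m" if m: "mpair m lam = 0" for m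
  proof -
    obtain a where a: "m = ev a" using B(4)[OF m] by (auto simp: ev_def)
    have "ev (restrict a B) = ev a" by (simp add: ev_def cong: sum.cong)
    thus ?thesis using a by (intro exI[of _ "restrict a B"]) auto
  qed
  then obtain \<alpha> where \<alpha>: "\<And>m. mpair m lam = 0 \<Longrightarrow> \<alpha> m \<in> B \<rightarrow>\<^sub>E UNIV \<and> ev (\<alpha> m) = m" by metis
  define R where "R = {m. mpair m lam = 0}"
  have inj: "inj_on \<alpha> R" 
    by (rule inj_on_inverseI[where g = ev]) (use \<alpha> in \<open>auto simp: R_def\<close>)
  define c where "c a = (if a \<in> \<alpha> ` R then coef g (ev a) else 0)" for a
  define G where "G z = (\<Sum>\<^sub>\<infinity>a\<in>B \<rightarrow>\<^sub>E UNIV. c a * (\<Prod>b\<in>B. z b ^ a b))" for z :: "nat ^ 'n \<Rightarrow> complex"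
  have reindex: "((\<lambda>a. c a * (\<Prod>b\<in>B. z b ^ a b)) has_sum S) (B \<rightarrow>\<^sub>E UNIV)
      \<longleftrightarrow> ((\<lambda>m. coef g m * (\<Prod>b\<in>B. z b ^ \<alpha> m b)) has_sum S) UNIV" for z S
  proof -
    have "((\<lambda>a. c a * (\<Prod>b\<in>B. z b ^ a b)) has_sum S) (B \<rightarrow>\<^sub>E UNIV)
        \<longleftrightarrow> ((\<lambda>a. c a * (\<Prod>b\<in>B. z b ^ a b)) has_sum S) (\<alpha> ` R)"
      using \<alpha> by (intro has_sum_cong_neutral) (auto simp: c_def R_def)
    also have "\<dots> \<longleftrightarrow> ((\<lambda>m. coef g m * (\<Prod>b\<in>B. z b ^ \<alpha> m b)) has_sum S) R"
      using \<alpha> by (subst has_sum_reindex[OF inj]) (auto intro!: has_sum_cong simp: c_def R_def)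
    also have "\<dots> \<longleftrightarrow> ((\<lambda>m. coef g m * (\<Prod>b\<in>B. z b ^ \<alpha> m b)) has_sum S) UNIV"
      using g by (intro has_sum_cong_neutral) (auto simp: R_def)
    finally show ?thesis .
  qed
  \<comment> \<open>No generator has larger degree. As \<open>t \<le> 1\<close>,
    \<open>norm (z b) < t ^ d\<close> implies \<open>norm (z b) \<le> t ^ mdeg b\<close>, and the
    product over the generators is at most \<open>t ^ mdeg m\<close>.\<close>
  define d where "d = (\<Sum>b\<in>B. mdeg b)"
  define t where "t = min s 1"
  have t: "0 < t" "t \<le> 1" "t \<le> s" using s by (auto simp: t_def)
  have deg: "mdeg m = (\<Sum>b\<in>B. \<alpha> m b * mdeg b)" if "mpair m lam = 0" for m
  proof -
    have "mdeg m = mdeg (ev (\<alpha> m))" using \<alpha>[OF that] by simp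
    also have "\<dots> = (\<Sum>i\<in>UNIV. \<Sum>b\<in>B. \<alpha> m b * b $ i)" by (simp add: mdeg_def ev_def)
    also have "\<dots> = (\<Sum>b\<in>B. \<alpha> m b * mdeg b)" by (subst sum.swap) (simp add: mdeg_def sum_distrib_left)
    finally show ?thesis .
  qed
  have summ: "(\<lambda>m. coef g m * (\<Prod>b\<in>B. z b ^ \<alpha> m b)) summable_on UNIV" if z: "\<And>b. b \<in> B \<Longrightarrow> norm (z b) < t ^ d" for z
  proof (rule abs_summable_summable, rule Infinite_Sum.abs_summable_on_comparison_test'[OF bnd_summable[of t g M]])
    fix m
    show "norm (coef g m * (\<Prod>b\<in>B. z b ^ \<alpha> m b)) \<le> norm (coef g m) * t ^ mdeg m"
    proof (cases "coef g m = 0")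
      case False
      hence m: "mpair m lam = 0" using g by blast
      have "norm (\<Prod>b\<in>B. z b ^ \<alpha> m b) \<le> (\<Prod>b\<in>B. t ^ (\<alpha> m b * mdeg b))"
        unfolding prod_norm[symmetric]
      proof (intro prod_mono conjI)
        fix b assume b: "b \<in> B"
        have "mdeg b \<le> d" unfolding d_def using B(1) b by (intro member_le_sum) auto
        hence "t ^ d \<le> t ^ mdeg b" using t by (intro power_decreasing) auto
        hence "norm (z b) \<le> t ^ mdeg b" using z[OF b] by simp
        hence "norm (z b) ^ \<alpha> m b \<le> (t ^ mdeg b) ^ \<alpha> m b" by (intro power_mono) auto
        thus "norm (z b ^ \<alpha> m b) \<le> t ^ (\<alpha> m b * mdeg b)" by (simp add: norm_power power_mult mult.commute)
      qed simp
      also have "\<dots> = t ^ mdeg m" by (simp add: deg[OF m] power_sum)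
      finally show ?thesis unfolding norm_mult by (intro mult_left_mono) auto
    qed simp
  qed (use t s bnd_smaller[OF s(2)] in auto)
  have "((\<lambda>a. c a * (\<Prod>b\<in>B. z b ^ a b)) has_sum G z) (B \<rightarrow>\<^sub>E UNIV)" if "\<forall>b\<in>B. norm (z b) < t ^ d" for z
  proof -
    have "((\<lambda>a. c a * (\<Prod>b\<in>B. z b ^ a b)) has_sum (\<Sum>\<^sub>\<infinity>m. coef g m * (\<Prod>b\<in>B. z b ^ \<alpha> m b))) (B \<rightarrow>\<^sub>E UNIV)"
      unfolding reindex using summ that by (intro has_sum_infsum) blast
    thus ?thesis unfolding G_def by (simp add: infsumI)
  qed
  hence "analytic0_vars B G"
    unfolding analytic0_vars_def using B(1) t by (intro conjI exI[of _ c] exI[of _ "t ^ d"]) auto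
  moreover have "\<forall>\<^sub>F y in nhds 0. eval g y = G (mpow y)"
    using eventually_polydisc[OF s(1)]
  proof eventually_elim
    case (elim y)
    have e: "coef g m * (\<Prod>b\<in>B. mpow y b ^ \<alpha> m b) = coef g m * mpow y m" for m
    proof (cases "coef g m = 0")
      case False
      hence m: "mpair m lam = 0" using g by blast
      have "(\<Prod>b\<in>B. mpow y b ^ \<alpha> m b) = (\<Prod>b\<in>B. \<Prod>i\<in>UNIV. y $ i ^ (\<alpha> m b * b $ i))"
        unfolding mpow_def prod_power_distrib by (simp add: power_mult mult.commute flip: power_mult)
      also have "\<dots> = mpow y (ev (\<alpha> m))"
        by (subst prod.swap) (simp add: mpow_def ev_def power_sum)
      finally show ?thesis using \<alpha>[OF m] by simp
    qed simp
    have "((\<lambda>m. coef g m * mpow y m) has_sum eval g y) UNIV"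
      using elim s by (intro eval_has_sum[OF s(2)]) (auto simp: less_imp_le)
    hence "((\<lambda>a. c a * (\<Prod>b\<in>B. mpow y b ^ a b)) has_sum eval g y) (B \<rightarrow>\<^sub>E UNIV)"
      unfolding reindex e .
    thus ?case unfolding G_def by (simp add: infsumI)
  qed
  ultimately show ?thesis using B(2) unfolding analytic_function_of_monomials_def by blast
qed

subsection \<open>From the normal form to first integrals\<close>

text \<open>A logarithmic derivative without division by a coordinate that may vanish; the factor
  \<open>m $ j\<close> covers the truncation in \<open>dec\<close>.\<close>

lemma mpow_dec: "of_nat (m $ j) * mpow x (dec j m) * x $ j = of_nat (m $ j) * mpow x m"
proof (cases "m $ j = 0")
  case False
  have "mpow x m = mpow x (dec j m) * x $ j" by (subst add_dec[OF False, symmetric]) (simp add: mpow_add)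
  thus ?thesis by simp
qed simp

lemma cgrad_mpow:
  fixes \<psi> :: "complex ^ 'n \<Rightarrow> complex ^ 'n"
  assumes "\<And>i. has_taylor (\<lambda>x. \<psi> x $ i) (coef (P i))"
  shows "\<forall>\<^sub>F x in nhds 0. cgrad (\<lambda>x. mpow (\<psi> x) m) x $ i
    = (\<Sum>j\<in>UNIV. of_nat (m $ j) * mpow (\<psi> x) (dec j m) * cgrad (\<lambda>x. \<psi> x $ j) x $ i)"
proof (rule ht_eventually_eq)
  show "has_taylor (\<lambda>x. cgrad (\<lambda>x. mpow (\<psi> x) m) x $ i) (coef (pd i (mprod P m)))"
    by (intro ht_cgrad ht_mprod assms)
  show "has_taylor (\<lambda>x. \<Sum>j\<in>UNIV. of_nat (m $ j) * mpow (\<psi> x) (dec j m) * cgrad (\<lambda>x. \<psi> x $ j) x $ i)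
      (coef (pd i (mprod P m)))"
    unfolding pd_mprod by (intro ht_sum ht_mult ht_cst ht_mprod ht_cgrad assms)
qed

lemma rvec_family:
  fixes lam :: "complex ^ 'n"
  assumes "resonant_rank lam = K"
  obtains m where "\<And>k. k < K \<Longrightarrow> m k \<in> resonant_set lam"
    "\<And>r. (\<Sum>k<K. r k *\<^sub>R rvec (m k)) = 0 \<Longrightarrow> \<forall>k<K. r k = 0"
proof -
  let ?S = "rvec ` resonant_set lam"
  obtain B where B: "B \<subseteq> ?S" "independent B" "?S \<subseteq> span B" "card B = dim ?S" by (rule basis_exists)
  have fin: "finite B" using B(2) independent_imp_finite by blast
  have "card B = K" using B(4) assms by (simp add: resonant_rank_rvec)
  then obtain b where b: "bij_betw b {..<K} B"
    using ex_bij_betw_nat_finite[OF fin] by (auto simp: lessThan_atLeast0)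
  have "\<exists>m. m \<in> resonant_set lam \<and> rvec m = b k" if "k < K" for k
  proof -
    have "b k \<in> ?S" using b B(1) that by (auto simp: bij_betw_def)
    thus ?thesis by auto
  qed
  then obtain m where m: "\<And>k. k < K \<Longrightarrow> m k \<in> resonant_set lam \<and> rvec (m k) = b k" by metis
  have inj: "inj_on b {..<K}" and im: "b ` {..<K} = B" using b by (auto simp: bij_betw_def)
  have "\<forall>k<K. r k = 0" if r: "(\<Sum>k<K. r k *\<^sub>R rvec (m k)) = 0" for r
  proof (intro allI impI)
    fix k assume k: "k < K"
    let ?u = "\<lambda>v. r (inv_into {..<K} b v)"
    have "(\<Sum>v\<in>B. ?u v *\<^sub>R v) = (\<Sum>k<K. ?u (b k) *\<^sub>R b k)"
      unfolding im[symmetric] by (subst sum.reindex[OF inj]) simp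
    also have "\<dots> = (\<Sum>k<K. r k *\<^sub>R rvec (m k))"
      using m inj by (intro sum.cong) auto
    finally have "(\<Sum>v\<in>B. ?u v *\<^sub>R v) = 0" using r by simp
    hence "?u (b k) = 0" using k im by (intro independentD[OF B(2) fin subset_refl]) auto
    thus "r k = 0" using inj k by simp
  qed
  thus ?thesis using that[of m] m by blast
qed

text \<open>The Jacobian \<open>J\<close> cancels from a linear relation between the gradients.
  Multiplication by the coordinates of \<open>\<psi>\<close> leaves a relation between the exponent
  vectors with coefficients \<open>c k * mpow \<psi> (m k)\<close>; its real and imaginary parts
  contradict their real independence.\<close>

lemma integrals_independent_at:
  fixes \<psi> :: "complex ^ 'n" and J :: "complex ^ 'n ^ 'n"
  assumes m: "\<And>r. (\<Sum>k<K. r k *\<^sub>R rvec (m k)) = 0 \<Longrightarrow> \<forall>k<K. r k = 0"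
    and J: "Determinants.det J \<noteq> 0" and \<psi>: "\<And>i. \<psi> $ i \<noteq> 0"
    and v: "\<And>k i. k < K \<Longrightarrow> v k $ i = (\<Sum>j\<in>UNIV. of_nat (m k $ j) * mpow \<psi> (dec j (m k)) * J $ j $ i)"
    and c: "(\<Sum>k<K. c k *s v k) = 0" and k: "k < K"
  shows "c k = 0"
proof -
  define b where "b j = (\<Sum>k<K. c k * (of_nat (m k $ j) * mpow \<psi> (dec j (m k))))" for j
  have "b j = 0" for j
  proof (rule det_kernel[of "Finite_Cartesian_Product.transpose J"])
    fix i
    have "(\<Sum>j\<in>UNIV. Finite_Cartesian_Product.transpose J $ i $ j * b j)
        = (\<Sum>j\<in>UNIV. \<Sum>k<K. c k * (of_nat (m k $ j) * mpow \<psi> (dec j (m k)) * J $ j $ i))"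
      by (simp add: b_def Finite_Cartesian_Product.transpose_def sum_distrib_left mult_ac)
    also have "\<dots> = (\<Sum>k<K. c k * v k $ i)"
      by (subst sum.swap) (simp add: v sum_distrib_left)
    also have "\<dots> = (\<Sum>k<K. c k *s v k) $ i" by simp
    also have "\<dots> = 0" unfolding c by simp
    finally show "(\<Sum>j\<in>UNIV. Finite_Cartesian_Product.transpose J $ i $ j * b j) = 0" .
  qed (use J in simp)
  define d where "d k = c k * mpow \<psi> (m k)" for k
  have dj: "(\<Sum>k<K. d k * of_nat (m k $ j)) = 0" for j
  proof -
    have "b j * \<psi> $ j = (\<Sum>k<K. c k * (of_nat (m k $ j) * mpow \<psi> (dec j (m k)) * \<psi> $ j))"
      by (simp add: b_def sum_distrib_right mult.assoc)
    also have "\<dots> = (\<Sum>k<K. d k * of_nat (m k $ j))"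
      unfolding mpow_dec by (simp add: d_def mult_ac)
    finally show ?thesis using \<open>b j = 0\<close> by simp
  qed
  have "(\<Sum>k<K. Re (d k) * real (m k $ j)) = 0" "(\<Sum>k<K. Im (d k) * real (m k $ j)) = 0" for j
    using arg_cong[OF dj[of j], of Re] arg_cong[OF dj[of j], of Im] by simp_all
  hence "(\<Sum>k<K. Re (d k) *\<^sub>R rvec (m k)) = 0" "(\<Sum>k<K. Im (d k) *\<^sub>R rvec (m k)) = 0"
    by (simp_all add: vec_eq_iff rvec_def)
  hence "Re (d k) = 0" "Im (d k) = 0"
    using m[of "\<lambda>k. Re (d k)"] m[of "\<lambda>k. Im (d k)"] k by auto
  hence "d k = 0" by (simp add: complex_eq_iff)
  moreover have "mpow \<psi> (m k) \<noteq> 0" using \<psi> by (simp add: mpow_def)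
  ultimately show ?thesis by (simp add: d_def)
qed

text \<open>A component that vanishes on a nonempty open set has zero gradient there, which gives
  the Jacobian a zero row. So each component is nonzero on a dense open set, and finitely many such
  sets are intersected by induction.\<close>

lemma dense_nonvanishing:
  fixes \<psi> :: "complex ^ 'n \<Rightarrow> complex ^ 'n"
  assumes U: "open U" and cont: "\<And>x i. x \<in> U \<Longrightarrow> isCont (\<lambda>x. \<psi> x $ i) x"
    and det: "\<And>x. x \<in> U \<Longrightarrow> Determinants.det (\<chi> i j. cgrad (\<lambda>x. \<psi> x $ i) x $ j) \<noteq> 0"
  shows "open {x \<in> U. \<forall>i. \<psi> x $ i \<noteq> 0}" "U \<subseteq> closure {x \<in> U. \<forall>i. \<psi> x $ i \<noteq> 0}"
proof -
  have op: "open {x \<in> U. \<psi> x $ i \<noteq> 0}" for i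
  proof -
    have "continuous_on U (\<lambda>x. \<psi> x $ i)" using cont by (intro continuous_at_imp_continuous_on) auto
    hence "open (U \<inter> (\<lambda>x. \<psi> x $ i) -` (- {0}))" using U by (intro continuous_open_preimage) auto
    moreover have "U \<inter> (\<lambda>x. \<psi> x $ i) -` (- {0}) = {x \<in> U. \<psi> x $ i \<noteq> 0}" by auto
    ultimately show ?thesis by simp
  qed
  have opJ: "open {x \<in> U. \<forall>i\<in>J. \<psi> x $ i \<noteq> 0}" for J
  proof (cases "J = {}")
    case False
    have "open (\<Inter>i\<in>J. {x \<in> U. \<psi> x $ i \<noteq> 0})" using op by (intro open_INT) auto
    moreover have "(\<Inter>i\<in>J. {x \<in> U. \<psi> x $ i \<noteq> 0}) = {x \<in> U. \<forall>i\<in>J. \<psi> x $ i \<noteq> 0}" using False by auto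
    ultimately show ?thesis by simp
  qed (use U in simp)
  show "open {x \<in> U. \<forall>i. \<psi> x $ i \<noteq> 0}" using opJ[of UNIV] by simp
  have dense: "W \<inter> {x \<in> U. \<forall>i\<in>J. \<psi> x $ i \<noteq> 0} \<noteq> {}" if "open W" "W \<subseteq> U" "W \<noteq> {}" for W J
    using finite[of J]
  proof (induction J rule: finite_induct)
    case empty thus ?case using that by auto
  next
    case (insert i J)
    define W' where "W' = W \<inter> {x \<in> U. \<forall>i\<in>J. \<psi> x $ i \<noteq> 0}"
    have W': "open W'" "W' \<noteq> {}" "W' \<subseteq> U" using insert.IH that opJ by (auto simp: W'_def)
    have "\<exists>x\<in>W'. \<psi> x $ i \<noteq> 0"
    proof (rule ccontr)
      assume "\<not> (\<exists>x\<in>W'. \<psi> x $ i \<noteq> 0)"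
      hence zero: "\<psi> x $ i = 0" if "x \<in> W'" for x using that by blast
      obtain x where x: "x \<in> W'" using W'(2) by blast
      have "cgrad (\<lambda>x. \<psi> x $ i) x $ j = 0" for j
      proof -
        have "\<forall>\<^sub>F y in nhds x. \<psi> y $ i = 0"
          using eventually_nhds_in_open[OF W'(1) x] by eventually_elim (rule zero)
        hence "\<forall>\<^sub>F t in nhds 0. \<psi> (x + axis j t) $ i = 0"
          by (rule eventually_compose_filterlim[OF _ filterlim_axis])
        hence "deriv (\<lambda>t. \<psi> (x + axis j t) $ i) 0 = deriv (\<lambda>t. 0) 0" by (rule deriv_cong_ev) simp
        thus ?thesis by (simp add: cgrad_def)
      qed
      hence "Determinants.det (\<chi> i j. cgrad (\<lambda>x. \<psi> x $ i) x $ j) = 0"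
        by (intro det_zero_row[of i]) (simp_all add: Finite_Cartesian_Product.row_def vec_eq_iff)
      thus False using det x W'(3) by blast
    qed
    thus ?case by (auto simp: W'_def)
  qed
  show "U \<subseteq> closure {x \<in> U. \<forall>i. \<psi> x $ i \<noteq> 0}" (is "_ \<subseteq> closure ?D")
  proof (rule ccontr)
    assume "\<not> U \<subseteq> closure ?D"
    hence "U \<inter> - closure ?D \<noteq> {}" by blast
    moreover have "open (U \<inter> - closure ?D)" using U by (intro open_Int open_Compl closed_closure)
    ultimately have "(U \<inter> - closure ?D) \<inter> {x \<in> U. \<forall>i\<in>UNIV. \<psi> x $ i \<noteq> 0} \<noteq> {}" by (intro dense) auto
    thus False using closure_subset[of ?D] by auto
  qed
qed

lemma analytic0_map_taylor:
  assumes "analytic0_map f"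
  obtains F where "\<And>j. has_taylor (\<lambda>x. f x $ j) (coef (F j))"
  using assms unfolding analytic0_map_def analytic0_mps by metis

text \<open>The integrals are the powers of \<open>\<Psi>\<close> with independent resonant
  exponents. The factor \<open>1 + g\<close> is common to all components, so the derivative along
  the field is a multiple of \<open>mpair (m k) lam = 0\<close>.\<close>

lemma first_integrals_of_normal_form:
  fixes A :: "complex ^ 'n::{finite,wellorder} ^ 'n::{finite,wellorder}"
  assumes rank: "resonant_rank lam = CARD('n) - 1"
    and norm: "analytic_normalization A f h \<Psi>"
    and nf: "\<forall>\<^sub>F y in nhds 0. \<forall>i. (A *v y + h y) $ i = lam $ i * y $ i * (1 + g y)"
  shows "\<exists>H. (\<forall>k < CARD('n) - 1. analytic_first_integral A f (H k)) \<and>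
              functionally_independent (CARD('n) - 1) H"
proof -
  let ?K = "CARD('n) - 1"
  have an: "analytic0_map \<Psi>" and ho: "higher_order (\<lambda>x. \<Psi> x - x)"
    and eq: "\<forall>\<^sub>F x in nhds 0. \<forall>i. deriv_along (\<lambda>x. \<Psi> x $ i) x (A *v x + f x) = (A *v \<Psi> x + h (\<Psi> x)) $ i"
    using norm by (auto simp: analytic_normalization_def)
  obtain P where P: "\<And>j. has_taylor (\<lambda>x. \<Psi> x $ j) (coef (P j))" using analytic0_map_taylor[OF an] by blast
  have "has_taylor (\<lambda>x. (\<Psi> x - x) $ j) (coef (P j - Y j))" for j
    using ht_diff[OF P[of j] ht_Y[of j]] by simp
  hence tan: "ord_ge (\<lambda>_. 1) 2 (P j - Y j)" for j using ho by (rule higher_order_ord_ge)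
  have no_const: "no_const P"
  proof (rule ncI)
    fix i :: 'n
    have "coef (Y i) 0 = 0" using no_const_Y[where ?'a = 'n] unfolding no_const_def by blast
    thus "coef (P i) 0 = 0" using ord_geD[OF tan[of i], of 0] by (simp add: wdeg_def)
  qed
  obtain m where m: "\<And>k. k < ?K \<Longrightarrow> m k \<in> resonant_set lam"
    "\<And>r. (\<Sum>k<?K. r k *\<^sub>R rvec (m k)) = 0 \<Longrightarrow> \<forall>k<?K. r k = 0" using rvec_family[OF rank] by blast
  define H where "H k = (\<lambda>x. mpow (\<Psi> x) (m k))" for k
  have H: "has_taylor (H k) (coef (mprod P (m k)))" for k unfolding H_def by (rule ht_mprod[OF P])
  have "\<forall>\<^sub>F x in nhds 0. \<forall>k\<in>{..<?K}. \<forall>i. cgrad (H k) x $ i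
    = (\<Sum>j\<in>UNIV. of_nat (m k $ j) * mpow (\<Psi> x) (dec j (m k)) * cgrad (\<lambda>x. \<Psi> x $ j) x $ i)"
    unfolding H_def by (intro eventually_ball_finite ballI eventually_all_finite cgrad_mpow[OF P]) auto
  hence grad: "\<forall>\<^sub>F x in nhds 0. \<forall>k<?K. \<forall>i. cgrad (H k) x $ i
    = (\<Sum>j\<in>UNIV. of_nat (m k $ j) * mpow (\<Psi> x) (dec j (m k)) * cgrad (\<lambda>x. \<Psi> x $ j) x $ i)"
    by eventually_elim auto
  have nfP: "\<forall>\<^sub>F x in nhds 0. \<forall>i. (A *v \<Psi> x + h (\<Psi> x)) $ i = lam $ i * \<Psi> x $ i * (1 + g (\<Psi> x))"
    by (rule eventually_compose_filterlim[OF nf ht_filterlim[OF P no_const]])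
  have int: "analytic_first_integral A f (H k)" if k: "k < ?K" for k
    unfolding analytic_first_integral_def
  proof (intro conjI notI)
    show "analytic0 (H k)" using H analytic0_mps by blast
  next
    assume "\<exists>c. \<forall>\<^sub>F x in nhds 0. H k x = c"
    then obtain c where "\<forall>\<^sub>F x in nhds 0. H k x = c" by blast
    hence e: "mprod P (m k) = cst c" using ht_unique_ev[OF H ht_cst] by blast
    have nz: "m k \<noteq> 0" using m(1)[OF k] by (auto simp: resonant_set_def)
    \<comment> \<open>Tangency to the identity keeps the leading monomial, so the coefficient at
      \<open>m k \<noteq> 0\<close> is 1 and the integral is not constant.\<close>
    have "ord_ge (\<lambda>_. 1) (wdeg (\<lambda>_. 1) (m k) + 1) (mprod P (m k) - mprod Y (m k))"
      using no_const no_const_Y tan by (intro ord_ge_mprod_diff) (auto simp: no_const_ord_ge)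
    hence "coef (mprod P (m k)) (m k) = 1"
      by (force simp: ord_ge_def mprod_Y coef_mon)
    thus False using nz unfolding e by (simp add: coef_cst)
  next
    show "\<forall>\<^sub>F x in nhds 0. deriv_along (H k) x (A *v x + f x) = 0"
      using grad eq nfP
    proof eventually_elim
      case (elim x)
      let ?v = "A *v x + f x"
      have "deriv_along (H k) x ?v = (\<Sum>i\<in>UNIV. \<Sum>j\<in>UNIV. of_nat (m k $ j) * mpow (\<Psi> x) (dec j (m k)) * (cgrad (\<lambda>x. \<Psi> x $ j) x $ i * ?v $ i))"
        unfolding deriv_along_def using elim(1) k by (simp add: sum_distrib_right mult.assoc)
      also have "\<dots> = (\<Sum>j\<in>UNIV. of_nat (m k $ j) * mpow (\<Psi> x) (dec j (m k)) * deriv_along (\<lambda>x. \<Psi> x $ j) x ?v)"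
        by (subst sum.swap) (simp add: deriv_along_def sum_distrib_left)
      also have "\<dots> = (\<Sum>j\<in>UNIV. (of_nat (m k $ j) * mpow (\<Psi> x) (dec j (m k)) * \<Psi> x $ j) * (lam $ j * (1 + g (\<Psi> x))))"
        using elim(2,3) by (intro sum.cong) (simp_all add: mult_ac)
      also have "\<dots> = mpow (\<Psi> x) (m k) * (1 + g (\<Psi> x)) * mpair (m k) lam"
        unfolding mpow_dec mpair_def by (simp add: sum_distrib_left mult_ac)
      also have "mpair (m k) lam = 0" using m(1)[OF k] by (simp add: resonant_set_def)
      finally show ?case by simp
    qed
  qed
  let ?J = "\<lambda>x. \<chi> i j. cgrad (\<lambda>x. \<Psi> x $ i) x $ j"
  have detJ: "has_taylor (\<lambda>x. Determinants.det (?J x)) (coef (Determinants.det (\<chi> i j. pd j (P i))))"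
    by (rule ht_det) (simp add: ht_cgrad[OF P])
  have "Determinants.det (?J 0) = 1"
    using ht_at_0[OF detJ] coef_jacobian_0[of P, OF tan] by simp
  moreover have "isCont (\<lambda>x. Determinants.det (?J x)) 0"
    using eventually_nhds_x_imp_x[OF ht_isCont[OF detJ]] .
  ultimately have "((\<lambda>x. Determinants.det (?J x)) \<longlongrightarrow> 1) (at 0)" by (simp add: isCont_def)
  hence "\<forall>\<^sub>F x in at 0. Determinants.det (?J x) \<noteq> 0" by (rule tendsto_imp_eventually_ne) simp
  hence nz: "\<forall>\<^sub>F x in nhds 0. Determinants.det (?J x) \<noteq> 0"
    using \<open>Determinants.det (?J 0) = 1\<close> by (subst (asm) eventually_at_filter) (auto elim: eventually_mono)
  have cont: "\<forall>\<^sub>F x in nhds 0. \<forall>i. isCont (\<lambda>x. \<Psi> x $ i) x"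
    by (intro eventually_all_finite ht_isCont[OF P])
  from grad nz cont have "\<forall>\<^sub>F x in nhds 0. (\<forall>k<?K. \<forall>i. cgrad (H k) x $ i
    = (\<Sum>j\<in>UNIV. of_nat (m k $ j) * mpow (\<Psi> x) (dec j (m k)) * cgrad (\<lambda>x. \<Psi> x $ j) x $ i)) \<and>
    Determinants.det (?J x) \<noteq> 0 \<and> (\<forall>i. isCont (\<lambda>x. \<Psi> x $ i) x)"
    by eventually_elim blast
  then obtain U where U: "open U" "0 \<in> U"
    and Ug: "\<And>x k i. x \<in> U \<Longrightarrow> k < ?K \<Longrightarrow> cgrad (H k) x $ i
    = (\<Sum>j\<in>UNIV. of_nat (m k $ j) * mpow (\<Psi> x) (dec j (m k)) * cgrad (\<lambda>x. \<Psi> x $ j) x $ i)"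
    and Ud: "\<And>x. x \<in> U \<Longrightarrow> Determinants.det (?J x) \<noteq> 0"
    and Uc: "\<And>x i. x \<in> U \<Longrightarrow> isCont (\<lambda>x. \<Psi> x $ i) x"
    unfolding eventually_nhds by blast
  define D where "D = {x \<in> U. \<forall>i. \<Psi> x $ i \<noteq> 0}"
  have D: "open D" "U \<subseteq> closure D" unfolding D_def using dense_nonvanishing[OF U(1) Uc Ud] by auto
  have "inj_on (\<lambda>k. cgrad (H k) x) {..<?K} \<and> vec.independent ((\<lambda>k. cgrad (H k) x) ` {..<?K})" if x: "x \<in> D" for x
  proof -
    have xU: "x \<in> U" "\<And>i. \<Psi> x $ i \<noteq> 0" using x by (auto simp: D_def)
    have "c k = 0" if s: "(\<Sum>k<?K. c k *s cgrad (H k) x) = 0" and k: "k < ?K" for c k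
    proof (rule integrals_independent_at[OF m(2) Ud[OF xU(1)] xU(2) _ s k])
      fix k i assume "k < ?K"
      thus "cgrad (H k) x $ i = (\<Sum>j\<in>UNIV. of_nat (m k $ j) * mpow (\<Psi> x) (dec j (m k)) * ?J x $ j $ i)"
        unfolding vec_lambda_beta by (rule Ug[OF xU(1)])
    qed
    thus ?thesis using independent_family[where K = ?K and v = "\<lambda>k. cgrad (H k) x"] by blast
  qed
  hence "functionally_independent ?K H"
    unfolding functionally_independent_def using U D
    by (intro exI[of _ U] exI[of _ D]) (auto simp: D_def)
  thus ?thesis using int by blast
qed

subsection \<open>Jordan matrices\<close>

text \<open>A nonzero entry lies inside one block, which is upper triangular with constant diagonal;
  the induction strips the blocks off.\<close>

lemma jordan_matrix_entry:
  assumes "i < sum_list (map fst n_as)" "j < sum_list (map fst n_as)" "jordan_matrix n_as $$ (i, j) \<noteq> 0"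
  shows "i \<le> j \<and> jordan_matrix n_as $$ (i, i) = jordan_matrix n_as $$ (j, j)"
  using assms
proof (induction n_as arbitrary: i j)
  case (Cons p n_as)
  obtain n a where p: "p = (n, a)" by (cases p)
  show ?case
  proof (cases "i < n"; cases "j < n")
    assume nn: "\<not> i < n" "\<not> j < n"
    have "i - n \<le> j - n \<and> jordan_matrix n_as $$ (i - n, i - n) = jordan_matrix n_as $$ (j - n, j - n)"
      using nn Cons.prems by (intro Cons.IH) (auto simp: p jordan_matrix_Cons)
    thus ?thesis using nn Cons.prems by (auto simp: p jordan_matrix_Cons)
  qed (use Cons.prems in \<open>auto simp: p jordan_matrix_Cons jordan_block_def split: if_splits\<close>)
qed simp

abbreviation pos :: "'n::{finite,wellorder} \<Rightarrow> nat" where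
  "pos i \<equiv> card {..<i}"

lemma pos_less_iff: "pos i < pos j \<longleftrightarrow> i < j"
proof -
  have m: "pos i < pos j" if "i < j" for i j :: 'a
    using that by (intro psubset_card_mono) auto
  show ?thesis using m[of i j] m[of j i] by (metis less_asym less_irrefl neqE)
qed

lemma pos_lt_card: "pos (i :: 'n::{finite,wellorder}) < CARD('n)"
  by (intro psubset_card_mono) auto

lemma bij_pos: "bij_betw pos (UNIV :: 'n::{finite,wellorder} set) {..<CARD('n)}"
proof -
  have "inj (pos :: 'n \<Rightarrow> nat)" by (intro injI) (metis less_irrefl neqE pos_less_iff)
  moreover from this have "card (pos ` (UNIV :: 'n set)) = CARD('n)" by (rule card_image)
  moreover have "pos ` (UNIV :: 'n set) \<subseteq> {..<CARD('n)}" using pos_lt_card by auto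
  ultimately show ?thesis by (simp add: bij_betw_def card_subset_eq)
qed

lemma lower_jordan_entry:
  fixes A :: "complex ^ 'n::{finite,wellorder} ^ 'n::{finite,wellorder}"
  assumes "lower_jordan A" "A $ i $ j \<noteq> 0" "i \<noteq> j"
  shows "j < i \<and> A $ i $ i = A $ j $ j"
proof -
  obtain n_as where n: "sum_list (map fst n_as) = CARD('n)"
    "\<And>i j. A $ i $ j = transpose_mat (jordan_matrix n_as) $$ (pos i, pos j)"
    using assms(1) unfolding lower_jordan_def by blast
  have e: "A $ i $ j = jordan_matrix n_as $$ (pos j, pos i)" for i j
    using n(1) pos_lt_card[of i] pos_lt_card[of j] by (simp add: n(2))
  have "pos j \<le> pos i \<and> A $ j $ j = A $ i $ i"
    unfolding e[of j j] e[of i i] using assms(2) n(1) pos_lt_card[of i] pos_lt_card[of j]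
    by (intro jordan_matrix_entry) (simp_all add: e)
  thus ?thesis using assms(3) pos_less_iff[of i j] by (metis neqE not_le)
qed

subsection \<open>From first integrals to the normal form\<close>

text \<open>Differentiating \<open>Q \<circ> P = id\<close> along \<open>V\<close> gives the claim
  composed with \<open>P\<close>; substituting \<open>Q\<close> removes \<open>P\<close>.\<close>

lemma conjugacy_inverse:
  assumes P: "no_const P" "\<And>j. mcomp (P j) Q = Y j" and Q: "no_const Q" "\<And>j. mcomp (Q j) P = Y j"
    and conj: "\<And>j. lie V (P j) = mcomp (X j) P"
  shows "lie X (Q i) = mcomp (V i) Q"
proof -
  have "mcomp (lie X (Q i)) P = (\<Sum>j\<in>UNIV. mcomp (pd j (Q i)) P * lie V (P j))"
    by (simp add: lie_def[of X] mcomp_sum mcomp_mult[OF P(1)] conj mult.commute)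
  also have "\<dots> = lie V (mcomp (Q i) P)" by (rule lie_mcomp[OF P(1), symmetric])
  also have "\<dots> = V i" by (simp add: Q(2) lie_Y)
  finally have "mcomp (V i) Q = mcomp (mcomp (lie X (Q i)) P) Q" by simp
  also have "\<dots> = lie X (Q i)" by (simp add: mcomp_assoc[OF Q(1) P(1)] P(2))
  finally show ?thesis by simp
qed

lemma integral_pullback:
  assumes "no_const P" "\<And>j. lie V (P j) = mcomp (X j) P" "lie X G = 0"
  shows "lie V (mcomp G P) = 0"
proof -
  have "lie V (mcomp G P) = mcomp (lie X G) P"
    by (simp add: lie_mcomp[OF assms(1)] lie_def[of X] mcomp_sum mcomp_mult[OF assms(1)] assms(2) mult.commute)
  thus ?thesis by (simp add: assms(3) mcomp_0)
qed

text \<open>If all weights lie in \<open>[k, 2 * k)\<close>, two factors outweigh any single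
  variable.\<close>

lemma ord_ge_vector_lt:
  assumes "\<And>i :: 'n::finite. k \<le> w i" "\<And>i. w i < 2 * k" "mdeg m \<ge> 2"
  shows "w j < wdeg w m"
proof -
  have "w j < k * 2" using assms(2)[of j] by simp
  also have "\<dots> \<le> k * mdeg m" using assms(3) by simp
  also have "\<dots> = (\<Sum>i\<in>UNIV. k * m $ i)" by (simp add: mdeg_def sum_distrib_left)
  also have "\<dots> \<le> wdeg w m" unfolding wdeg_def using assms(1) by (intro sum_mono mult_right_mono) auto
  finally show ?thesis .
qed

text \<open>If all completed formal determinants vanished, then, since there are finitely many
  choices of \<open>b\<close>, the pointwise determinants would vanish on one neighbourhood of 0. It
  meets the dense set of independence, where some completion is nonsingular.\<close>

lemma formal_independence:
  fixes H :: "nat \<Rightarrow> complex ^ 'n \<Rightarrow> complex"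
  assumes H: "\<And>k. k < CARD('n) - 1 \<Longrightarrow> has_taylor (H k) (coef (G k))"
    and ind: "functionally_independent (CARD('n) - 1) H"
    and e: "bij_betw e (UNIV :: 'n set) {..<CARD('n)}"
  obtains b where "Determinants.det (\<chi> i j. if e i < CARD('n) - 1 then pd j (G (e i)) else cst ((axis b 1 :: complex ^ 'n) $ j)) \<noteq> 0"
proof (rule ccontr)
  let ?K = "CARD('n) - 1"
  let ?N = "\<lambda>b. (\<chi> i j. if e i < ?K then pd j (G (e i)) else cst ((axis b 1 :: complex ^ 'n) $ j)) :: 'n mps ^ 'n ^ 'n"
  let ?M = "\<lambda>b x. (\<chi> i. if e i < ?K then cgrad (H (e i)) x else axis b 1) :: complex ^ 'n ^ 'n"
  assume "\<not> thesis"
  hence z: "Determinants.det (?N b) = 0" for b using that by blast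
  have "\<forall>\<^sub>F x in nhds 0. Determinants.det (?M b x) = 0" for b
  proof -
    have "has_taylor (\<lambda>x. ?M b x $ i $ j) (coef (?N b $ i $ j))" for i j
    proof (cases "e i < ?K")
      case True thus ?thesis using ht_cgrad[OF H[OF True], of j] by simp
    next
      case False thus ?thesis using ht_cst[of "axis b 1 $ j"] by simp
    qed
    hence "has_taylor (\<lambda>x. Determinants.det (?M b x)) (coef (Determinants.det (?N b)))" by (rule ht_det)
    moreover have "has_taylor (\<lambda>x. 0) (coef (Determinants.det (?N b)))"
      unfolding z using ht_cst[of 0] by (simp add: cst_hom)
    ultimately show ?thesis by (rule ht_eventually_eq)
  qed
  hence "\<forall>\<^sub>F x in nhds 0. \<forall>b. Determinants.det (?M b x) = 0" by (rule eventually_all_finite)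
  then obtain V where V: "open V" "0 \<in> V" "\<And>x b. x \<in> V \<Longrightarrow> Determinants.det (?M b x) = 0"
    unfolding eventually_nhds by blast
  obtain U D where UD: "0 \<in> U" "U \<subseteq> closure D"
    and D: "\<And>x. x \<in> D \<Longrightarrow> inj_on (\<lambda>i. cgrad (H i) x) {..<?K} \<and> vec.independent ((\<lambda>i. cgrad (H i) x) ` {..<?K})"
    using ind unfolding functionally_independent_def by blast
  have "V \<inter> closure D \<noteq> {}" using V(2) UD by blast
  hence "V \<inter> D \<noteq> {}" using V(1) by (simp add: open_Int_closure_eq_empty)
  then obtain x where x: "x \<in> V" "x \<in> D" by blast
  obtain b where "Determinants.det (?M b x) \<noteq> 0"
    using complete_rows[of "\<lambda>i. cgrad (H i) x" e] D[OF x(2)] e by blast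
  thus False using V(3)[OF x(1)] by simp
qed

text \<open>Parallelism is used twice, always against \<open>diagf lam\<close>: with
  \<open>diagf v\<close> for \<open>v\<close> orthogonal to the resonances, which gives the rank,
  and with the formal normal form, which gives \<open>g\<close>.\<close>

lemma formal_normal_form_of_integrals:
  fixes F0 :: "'n::{finite,wellorder} \<Rightarrow> 'n mps" and A :: "complex ^ 'n::{finite,wellorder} ^ 'n::{finite,wellorder}"
  assumes A: "lower_jordan A" and lam: "lam = eigenvalue_tuple A" "lam \<noteq> 0"
    and F0: "\<And>j. ord_ge (\<lambda>_. 1) 2 (F0 j)"
    and X: "\<And>j. X j = (\<Sum>i\<in>UNIV. cst (A $ j $ i) * Y i) + F0 j"
    and G: "\<And>k. k < CARD('n) - 1 \<Longrightarrow> lie X (G k) = 0"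
    and det: "Determinants.det (\<chi> i j. if pos i < CARD('n) - 1 then pd j (G (pos i)) else cst (\<rho> $ j)) \<noteq> 0"
  obtains \<phi> g where "resonant_rank lam = CARD('n) - 1"
    "\<And>j. (\<Sum>i\<in>UNIV. cst (A $ j $ i) * Y i) = diagf lam j"
    "\<And>j m. coef (\<phi> j) m \<noteq> 0 \<Longrightarrow> mdeg m \<ge> 2 \<and> mpair m lam \<noteq> lam $ j"
    "\<And>m. coef g m \<noteq> 0 \<Longrightarrow> m \<noteq> 0 \<and> mpair m lam = 0"
    "\<And>j. lie (\<lambda>i. diagf lam i + diagf lam i * g) (Y j + \<phi> j) = mcomp (X j) (\<lambda>i. Y i + \<phi> i)"
    "\<And>j. diagf lam j * g + lie (diagf lam) (\<phi> j) - cst (lam $ j) * \<phi> j + g * lie (diagf lam) (\<phi> j)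
        = mcomp (F0 j) (\<lambda>i. Y i + \<phi> i)"
proof -
  let ?K = "CARD('n) - 1"
  \<comment> \<open>The weights decrease along each Jordan chain, so the nilpotent part of \<open>A\<close> raises the weight
    and can be treated like the nonlinear terms.\<close>
  define w where "w i = 2 * CARD('n) + 1 - pos i" for i :: 'n
  define L where "L j = (\<Sum>i\<in>UNIV. cst (A $ j $ i) * Y i) - diagf lam j" for j
  define F where "F j = L j + F0 j" for j
  \<comment> \<open>The offset in the weights keeps them within a factor of two of each other, as
    \<open>ord_ge_vector_lt\<close> requires.\<close>
  have w: "CARD('n) + 2 \<le> w i" "w i < 2 * (CARD('n) + 2)" for i
    using pos_lt_card[of i] by (auto simp: w_def)
  have w2: "w j < wdeg w m" if "mdeg m \<ge> 2" for m j by (rule ord_ge_vector_lt[OF w that])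
  have coefA: "coef (\<Sum>i\<in>UNIV. cst (A $ j $ i) * Y i) m = (if \<exists>i. m = axis i 1 then A $ j $ (THE i. m = axis i 1) else 0)" for j m
  proof (cases "\<exists>i. m = axis i 1")
    case True
    then obtain i where i: "m = axis i 1" by blast
    have eq: "axis i 1 = (axis k 1 :: nat ^ 'n::{finite,wellorder}) \<longleftrightarrow> k = i" for k by (auto simp: axis_eq_axis)
    have "coef (\<Sum>k\<in>UNIV. cst (A $ j $ k) * Y k) m = (\<Sum>k\<in>UNIV. if k = i then A $ j $ i else 0)"
      unfolding coef_sum by (intro sum.cong) (auto simp: i coef_mon eq)
    thus ?thesis by (simp add: i eq)
  next
    case False thus ?thesis by (auto simp: coef_mon intro!: sum.neutral)
  qed
  have eqax: "axis i 1 = (axis k 1 :: nat ^ 'n::{finite,wellorder}) \<longleftrightarrow> k = i" for i k by (auto simp: axis_eq_axis)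
  have Lax: "coef (L j) (axis i 1) = (if i = j then 0 else A $ j $ i)" for i j
    unfolding L_def coef_diff coefA by (simp add: eqax diagf_def coef_mon lam(1) eigenvalue_tuple_def)
  have L0: "coef (L j) m = 0" if "\<And>i. m \<noteq> axis i 1" for j m
    using that by (auto simp: L_def coefA diagf_def coef_mon)
  have L: "\<exists>i. m = axis i 1 \<and> i < j \<and> lam $ i = lam $ j" if nz: "coef (L j) m \<noteq> 0" for j m
  proof -
    obtain i where i: "m = axis i 1" using nz L0 by blast
    hence "i \<noteq> j" "A $ j $ i \<noteq> 0" using nz by (auto simp: Lax split: if_splits)
    hence "i < j \<and> A $ j $ j = A $ i $ i" using lower_jordan_entry[OF A, of j i] by auto
    thus ?thesis using i by (intro exI[of _ i]) (simp add: lam(1) eigenvalue_tuple_def)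
  qed
  have ordF: "ord_ge w (w j + 1) (F j)" for j
  proof (rule ord_geI)
    fix m assume nz: "coef (F j) m \<noteq> 0"
    show "w j + 1 \<le> wdeg w m"
    proof (cases "coef (L j) m = 0")
      case True
      hence "coef (F0 j) m \<noteq> 0" using nz by (simp add: F_def)
      hence "mdeg m \<ge> 2" using F0[of j] by (force simp: ord_ge_def wdeg_1 not_less)
      thus ?thesis using w2[of m j] by linarith
    next
      case False
      then obtain i where i: "m = axis i 1" "i < j" using L by blast
      have "pos i < pos j" using i(2) by (simp add: pos_less_iff)
      thus ?thesis using i(1) pos_lt_card[of j] by (simp add: w_def)
    qed
  qed
  have linF: "mpair m lam = lam $ j" if "mdeg m \<le> 1" "coef (F j) m \<noteq> 0" for j m
  proof -
    have "coef (F0 j) m = 0" using F0[of j] that(1) by (simp add: ord_ge_def wdeg_1)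
    hence "coef (L j) m \<noteq> 0" using that(2) by (simp add: F_def)
    then obtain i where "m = axis i 1" "lam $ i = lam $ j" using L by blast
    thus ?thesis by simp
  qed
  obtain \<phi> h where \<phi>: "\<And>j m. coef (\<phi> j) m \<noteq> 0 \<Longrightarrow> mdeg m \<ge> 2 \<and> mpair m lam \<noteq> lam $ j"
    and h: "\<And>j m. coef (h j) m \<noteq> 0 \<Longrightarrow> w j < wdeg w m \<and> mpair m lam = lam $ j"
    and hlin: "\<And>j m. mdeg m \<le> 1 \<Longrightarrow> coef (h j) m = coef (F j) m"
    and eq: "\<And>j. lie (\<lambda>i. diagf lam i + h i) (Y j + \<phi> j)
        = diagf lam j + cst (lam $ j) * \<phi> j + mcomp (F j) (\<lambda>i. Y i + \<phi> i)"
    by (rule poincare_dulac[of w F lam, OF w2 ordF linF]) (assumption, assumption, assumption, rule that)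
  define \<Phi> where "\<Phi> i = Y i + \<phi> i" for i
  have \<phi>2: "ord_ge (\<lambda>_. 1) 2 (\<phi> j)" for j using \<phi> by (intro ord_geI) (simp add: wdeg_1)
  have no_const: "no_const \<Phi>" using no_const_Y ord_geD[OF \<phi>2, of 0] by (simp add: no_const_def \<Phi>_def wdeg_def)
  have tan: "ord_ge (\<lambda>_. 1) 2 (\<Phi> i - Y i)" for i using \<phi>2 by (simp add: \<Phi>_def)
  let ?V = "\<lambda>i. diagf lam i + h i"
  have XF: "X j = diagf lam j + F j" for j by (simp add: X F_def L_def)
  have conj: "lie ?V (\<Phi> j) = mcomp (X j) \<Phi>" for j
    using eq[of j] by (simp add: XF mcomp_add diagf_def mcomp_cst_mult mcomp_Y[OF no_const] \<Phi>_def[symmetric])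
      (simp add: \<Phi>_def algebra_simps)
  have V0: "lie ?V (mcomp (G k) \<Phi>) = 0" if "k < ?K" for k
    by (rule integral_pullback[OF no_const conj G[OF that]])
  have inv: "mpair m lam = 0" if "k < ?K" "coef (mcomp (G k) \<Phi>) m \<noteq> 0" for k m
    by (rule normal_form_integral_invariant[OF h V0[OF that(1)] that(2)])
  have diag0: "lie (diagf v) (mcomp (G k) \<Phi>) = 0" if "\<And>m. mpair m lam = 0 \<Longrightarrow> mpair m v = 0" "k < ?K" for v k
    by (rule mps_eqI) (use inv[OF that(2)] that(1) in \<open>auto simp: coef_lie_diagf\<close>)
  note par = parallel_fields[where e = pos and K = ?K and \<rho> = \<rho> and G = G, OF no_const tan det]
  have "lam $ a * v $ b = lam $ b * v $ a" if v: "\<And>m. mpair m lam = 0 \<Longrightarrow> mpair m v = 0" for v a b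
  proof -
    have "diagf lam a * diagf v b = diagf lam b * diagf v a"
      by (rule par) (use diag0[of lam] diag0[OF v] in auto)
    \<comment> \<open>Comparing the coefficients at \<open>axis a 1 + axis b 1\<close> turns
      parallelism of two diagonal fields into proportionality of their eigenvalues.\<close>
    moreover have "coef (diagf x i * diagf y j) (axis i 1 + axis j 1) = x $ i * y $ j" for x y and i j :: 'n
    proof -
      have "diagf x i * diagf y j = cst (x $ i) * (cst (y $ j) * mon (axis i 1 + axis j 1))"
        by (simp add: diagf_def mon_add mult_ac)
      thus ?thesis by (simp add: coef_mon)
    qed
    note this[of lam a v b] this[of lam b v a]
    ultimately show ?thesis by (simp add: add.commute)
  qed
  hence rank: "resonant_rank lam = ?K" by (rule resonant_rank_eqI[OF lam(2)])
  have parV: "diagf lam a * h b = diagf lam b * h a" for a b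
  proof -
    have "diagf lam a * ?V b = diagf lam b * ?V a"
      by (rule par) (use diag0[of lam] V0 in auto)
    thus ?thesis by (simp add: algebra_simps)
  qed
  obtain g where g: "\<And>j. h j = diagf lam j * g" "\<And>m. coef g m \<noteq> 0 \<Longrightarrow> mpair m lam = 0"
    using parallel_factor[of lam h, OF parV _ lam(2)] h by blast
  obtain a where a: "lam $ a \<noteq> 0" using lam(2) by (auto simp: vec_eq_iff)
  \<comment> \<open>A constant term of \<open>g\<close> would put \<open>Y a\<close> into
    \<open>h a\<close>, a term whose weight equals \<open>w a\<close>, whereas all terms of
    \<open>h a\<close> have larger weight.\<close>
  have g0: "coef g 0 = 0"
  proof -
    have "coef (h a) (axis a 1) = lam $ a * coef g 0"
      using coef_mon_mult(1)[of "axis a 1" g 0] by (simp add: g(1) diagf_def mult.assoc)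
    moreover have "coef (h a) (axis a 1) = 0" using h[of a "axis a 1"] by force
    ultimately show ?thesis using a by simp
  qed
  \<comment> \<open>Here \<open>A\<close> turns out to be diagonal: off the diagonal the linear part
    of \<open>h j\<close> is \<open>L j\<close>, but \<open>h j\<close> is divisible by
    \<open>Y j\<close> and so has no linear term in another variable.\<close>
  have Lz: "L j = 0" for j
  proof (rule mps_eqI)
    fix m
    show "coef (L j) m = coef 0 m"
    proof (cases "\<exists>i. m = axis i 1 \<and> i \<noteq> j")
      case True
      then obtain i where i: "m = axis i 1" "i \<noteq> j" by blast
      have "coef (L j) m = coef (F j) m" using F0[of j] by (simp add: F_def ord_ge_def wdeg_1 i)
      also have "\<dots> = coef (h j) m" by (simp add: hlin i)
      also have "\<dots> = 0" using i by (simp add: g(1) diagf_def mult.assoc coef_Y_mult) (simp add: axis_def)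
      finally show ?thesis by simp
    next
      case False
      thus ?thesis using L0[of m j] Lax[of j j] by (cases "m = axis j 1") auto
    qed
  qed
  have FF0: "F j = F0 j" for j by (simp add: F_def Lz)
  have lieh: "lie h (\<phi> j) = g * lie (diagf lam) (\<phi> j)" for j
    using lie_mult_left[of g "diagf lam" "\<phi> j"] by (simp add: g(1)[abs_def] mult.commute)
  show ?thesis
  proof (rule that[OF rank])
    show "(\<Sum>i\<in>UNIV. cst (A $ j $ i) * Y i) = diagf lam j" for j using Lz[of j] by (simp add: L_def)
    show "m \<noteq> 0 \<and> mpair m lam = 0" if "coef g m \<noteq> 0" for m using g(2)[OF that] g0 that by auto
    show "lie (\<lambda>i. diagf lam i + diagf lam i * g) (Y j + \<phi> j) = mcomp (X j) (\<lambda>i. Y i + \<phi> i)" for j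
      using conj[of j] by (simp add: g(1) \<Phi>_def[abs_def])
    show "diagf lam j * g + lie (diagf lam) (\<phi> j) - cst (lam $ j) * \<phi> j + g * lie (diagf lam) (\<phi> j)
        = mcomp (F0 j) (\<lambda>i. Y i + \<phi> i)" for j
      using eq[of j] lieh[of j] by (simp add: lie_add_left lie_add lie_Y FF0 g(1)[of j] algebra_simps)
  qed (use \<phi> in auto)
qed

text \<open>Passage from series to germs. The convergent nonresonant map is \<open>\<Phi>\<close>,
  from normal form coordinates to the original ones; the normalization \<open>\<Psi>\<close> is its
  convergent inverse, and \<open>conjugacy_inverse\<close> transfers the equation to it.\<close>

lemma normal_form_of_first_integrals:
  fixes A :: "complex ^ 'n::{finite,wellorder} ^ 'n::{finite,wellorder}"
  assumes A: "lower_jordan A" and f: "analytic0_map f" "higher_order f"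
    and lam: "lam = eigenvalue_tuple A" "lam \<noteq> 0"
    and int: "\<forall>k < CARD('n) - 1. analytic_first_integral A f (H k)"
    and ind: "functionally_independent (CARD('n) - 1) H"
  shows "resonant_rank lam = CARD('n) - 1 \<and>
      (\<exists>\<Psi> h g. distinguished_normalization A f h \<Psi> \<and>
         (\<forall>\<^sub>F y in nhds 0. \<forall>i. (A *v y + h y) $ i = lam $ i * y $ i * (1 + g y)) \<and>
         g 0 = 0 \<and>
         analytic_function_of_monomials (basic_exponents lam) g)"
proof -
  let ?K = "CARD('n) - 1"
  obtain F0 where F0: "\<And>j. has_taylor (\<lambda>x. f x $ j) (coef (F0 j))" using analytic0_map_taylor[OF f(1)] by blast
  have F2: "ord_ge (\<lambda>_. 1) 2 (F0 j)" for j by (rule higher_order_ord_ge[OF F0 f(2)])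
  define X where "X j = (\<Sum>i\<in>UNIV. cst (A $ j $ i) * Y i) + F0 j" for j
  have linA: "has_taylor (\<lambda>x. (A *v x) $ j) (coef (\<Sum>i\<in>UNIV. cst (A $ j $ i) * Y i))" for j
    unfolding matrix_vector_mult_def vec_lambda_beta by (intro ht_sum ht_cst_mult ht_Y)
  have hX: "has_taylor (\<lambda>x. (A *v x + f x) $ j) (coef (X j))" for j
    unfolding X_def vector_add_component by (intro ht_add linA F0)
  have "\<exists>G. has_taylor (H k) (coef G)" if "k < ?K" for k
    using int that by (auto simp: analytic_first_integral_def analytic0_mps)
  then obtain G where G: "\<And>k. k < ?K \<Longrightarrow> has_taylor (H k) (coef (G k))" by metis
  have lieG: "lie X (G k) = 0" if "k < ?K" for k
  proof (rule ht_unique_ev[OF ht_deriv_along[OF G[OF that] hX]])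
    show "has_taylor (\<lambda>_. 0) (coef 0)" using ht_cst[of 0] by (simp add: cst_hom)
    show "\<forall>\<^sub>F x in nhds 0. deriv_along (H k) x (A *v x + f x) = 0"
      using int that by (simp add: analytic_first_integral_def)
  qed
  obtain b where det: "Determinants.det (\<chi> i j. if pos i < ?K then pd j (G (pos i)) else cst ((axis b 1 :: complex ^ 'n::{finite,wellorder}) $ j)) \<noteq> 0"
    using formal_independence[of H G pos] G ind bij_pos by blast
  obtain \<phi> g where rank: "resonant_rank lam = ?K"
    and Adiag: "\<And>j. (\<Sum>i\<in>UNIV. cst (A $ j $ i) * Y i) = diagf lam j"
    and \<phi>: "\<And>j m. coef (\<phi> j) m \<noteq> 0 \<Longrightarrow> mdeg m \<ge> 2 \<and> mpair m lam \<noteq> lam $ j"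
    and g: "\<And>m. coef g m \<noteq> 0 \<Longrightarrow> m \<noteq> 0 \<and> mpair m lam = 0"
    and conj: "\<And>j. lie (\<lambda>i. diagf lam i + diagf lam i * g) (Y j + \<phi> j) = mcomp (X j) (\<lambda>i. Y i + \<phi> i)"
    and eq: "\<And>j. diagf lam j * g + lie (diagf lam) (\<phi> j) - cst (lam $ j) * \<phi> j + g * lie (diagf lam) (\<phi> j)
        = mcomp (F0 j) (\<lambda>i. Y i + \<phi> i)"
    by (rule formal_normal_form_of_integrals[OF A lam F2 X_def lieG det]) (assumption, rule that)
  obtain a where a: "lam $ a \<noteq> 0" using lam(2) by (auto simp: vec_eq_iff)
  obtain \<delta> where \<delta>: "\<delta> > 0" "\<And>m j. mpair m lam \<noteq> lam $ j \<Longrightarrow> \<delta> \<le> norm (mpair m lam - lam $ j)"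
    using no_small_divisors[OF rank lam(2)] by blast
  have conv: "conv (\<phi> j)" "conv g" for j
    using normal_form_converges[OF a \<delta> F2 ht_conv[OF F0] \<phi> g eq] by blast+
  have \<phi>2: "ord_ge (\<lambda>_. 1) 2 (\<phi> j)" for j using \<phi> by (intro ord_geI) (simp add: wdeg_1)
  obtain \<psi> where \<psi>2: "\<And>j. ord_ge (\<lambda>_. 1) 2 (\<psi> j)"
    and \<phi>\<psi>: "\<And>j. mcomp (Y j + \<phi> j) (\<lambda>i. Y i + \<psi> i) = Y j"
    and \<psi>\<phi>: "\<And>j. mcomp (Y j + \<psi> j) (\<lambda>i. Y i + \<phi> i) = Y j"
    and "(\<forall>j. conv (\<phi> j)) \<Longrightarrow> \<forall>j. conv (\<psi> j)"
    by (rule tangent_inverse[of \<phi>, OF \<phi>2]) (rule that)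
  hence \<psi>c: "\<forall>j. conv (\<psi> j)" using conv(1) by blast
  have no_const: "no_const (\<lambda>i. Y i + \<theta> i)" if "\<And>j. ord_ge (\<lambda>_. 1) 2 (\<theta> j)" for \<theta> :: "'n \<Rightarrow> 'n mps"
    using no_const_Y that by (simp add: no_const_def ord_ge_def wdeg_1)
  note no_const\<phi> = no_const[of \<phi>, OF \<phi>2] and no_const\<psi> = no_const[of \<psi>, OF \<psi>2]
  define \<Phi> where "\<Phi> y = (\<chi> i. y $ i + eval (\<phi> i) y)" for y
  define \<Psi> where "\<Psi> x = (\<chi> i. x $ i + eval (\<psi> i) x)" for x
  define h where "h y = (\<chi> i. lam $ i * y $ i * eval g y)" for y
  have h\<Phi>: "has_taylor (\<lambda>y. \<Phi> y $ i) (coef (Y i + \<phi> i))" for i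
    unfolding \<Phi>_def vec_lambda_beta by (intro ht_add ht_Y ht_eval conv)
  have h\<Psi>: "has_taylor (\<lambda>x. \<Psi> x $ i) (coef (Y i + \<psi> i))" for i
    unfolding \<Psi>_def vec_lambda_beta using \<psi>c by (intro ht_add ht_Y ht_eval) blast
  have hh: "has_taylor (\<lambda>y. h y $ i) (coef (diagf lam i * g))" for i
    unfolding h_def vec_lambda_beta diagf_def by (intro ht_mult ht_cst ht_Y ht_eval conv)
  have gord: "ord_ge (\<lambda>_. 1) 1 g"
  proof (rule ord_geI)
    fix m assume "coef g m \<noteq> 0"
    hence "mdeg m \<noteq> 0" using g mdeg_eq_0_iff by blast
    thus "1 \<le> wdeg (\<lambda>_. 1) m" by (simp add: wdeg_1)
  qed
  have h2: "ord_ge (\<lambda>_. 1) 2 (diagf lam i * g)" for i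
  proof -
    have "ord_ge (\<lambda>_. 1) 1 (diagf lam i)" unfolding diagf_def using ord_ge_mon[of "\<lambda>_. 1" "axis i 1"]
      by (intro ord_ge_cst_mult) simp
    hence "ord_ge (\<lambda>_. 1) (1 + 1) (diagf lam i * g)" using gord by (rule ord_ge_mult)
    thus ?thesis by simp
  qed
  have hres: "resonant_monomial lam m i" if nz: "coef (diagf lam i * g) m \<noteq> 0" for i m
  proof -
    have d: "mdeg m \<ge> 2" using nz h2[of i] by (force simp: ord_ge_def wdeg_1 not_less)
    have "m $ i \<noteq> 0" using nz by (simp add: diagf_def mult.assoc coef_Y_mult split: if_splits)
    then obtain m' where m': "m = m' + axis i 1" using add_dec by metis
    hence "coef g m' \<noteq> 0" using nz by (simp add: diagf_def mult.assoc)
    thus ?thesis using d g m' by (simp add: resonant_monomial_def mpair_add)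
  qed
  have norm: "analytic_normalization A f h \<Psi>"
    unfolding analytic_normalization_def
  proof (intro conjI)
    show "analytic0_map h" "analytic0_map \<Psi>"
      unfolding analytic0_map_def analytic0_mps using hh h\<Psi> by blast+
    show "higher_order h" by (rule ord_ge_higher_order[OF hh h2])
    show "in_normal_form A h"
      unfolding in_normal_form_def using A hh hres by (auto simp flip: lam(1))
    have "has_taylor (\<lambda>x. (\<Psi> x - x) $ i) (coef (\<psi> i))" for i
      using ht_diff[OF h\<Psi>[of i] ht_Y[of i]] by simp
    thus "higher_order (\<lambda>x. \<Psi> x - x)" using \<psi>2 by (rule ord_ge_higher_order)
    show "\<forall>\<^sub>F x in nhds 0. \<forall>i. deriv_along (\<lambda>x. \<Psi> x $ i) x (A *v x + f x) = (A *v \<Psi> x + h (\<Psi> x)) $ i"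
    proof (rule eventually_all_finite)
      fix i
      have "has_taylor (\<lambda>y. (A *v y + h y) $ i) (coef (diagf lam i + diagf lam i * g))"
        unfolding vector_add_component using linA[of i] by (intro ht_add hh) (simp add: Adiag)
      hence "has_taylor (\<lambda>x. (A *v \<Psi> x + h (\<Psi> x)) $ i) (coef (mcomp (diagf lam i + diagf lam i * g) (\<lambda>i. Y i + \<psi> i)))"
        by (rule ht_mcomp[OF _ h\<Psi> no_const\<psi>])
      moreover have "lie X (Y i + \<psi> i) = mcomp (diagf lam i + diagf lam i * g) (\<lambda>i. Y i + \<psi> i)"
        by (rule conjugacy_inverse[OF no_const\<phi> \<phi>\<psi> no_const\<psi> \<psi>\<phi> conj])
      ultimately show "\<forall>\<^sub>F x in nhds 0. deriv_along (\<lambda>x. \<Psi> x $ i) x (A *v x + f x) = (A *v \<Psi> x + h (\<Psi> x)) $ i"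
        using ht_eventually_eq[OF ht_deriv_along[OF h\<Psi>[of i] hX]] by simp
    qed
  qed
  have inverse: "\<forall>\<^sub>F x in nhds 0. \<alpha> (\<beta> x) = x"
    if "\<And>i. has_taylor (\<lambda>y. \<alpha> y $ i) (coef (P i))" "\<And>i. has_taylor (\<lambda>y. \<beta> y $ i) (coef (Q i))"
      "no_const Q" "\<And>i. mcomp (P i) Q = Y i"
    for \<alpha> \<beta> :: "complex ^ 'n::{finite,wellorder} \<Rightarrow> complex ^ 'n::{finite,wellorder}" and P Q :: "'n \<Rightarrow> 'n mps"
  proof -
    have "\<forall>\<^sub>F x in nhds 0. \<forall>i. \<alpha> (\<beta> x) $ i = x $ i"
    proof (rule eventually_all_finite)
      fix i
      have "has_taylor (\<lambda>x. \<alpha> (\<beta> x) $ i) (coef (Y i))"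
        using ht_mcomp[OF that(1)[of i] that(2,3)] that(4)[of i] by simp
      thus "\<forall>\<^sub>F x in nhds 0. \<alpha> (\<beta> x) $ i = x $ i" by (rule ht_eventually_eq[OF _ ht_Y])
    qed
    thus ?thesis by (simp add: vec_eq_iff)
  qed
  have dist: "distinguished_normalization A f h \<Psi>"
    unfolding distinguished_normalization_def
  proof (intro conjI norm exI[of _ \<Phi>] allI)
    show "\<forall>\<^sub>F x in nhds 0. \<Phi> (\<Psi> x) = x" by (rule inverse[OF h\<Phi> h\<Psi> no_const\<psi> \<phi>\<psi>])
    show "\<forall>\<^sub>F y in nhds 0. \<Psi> (\<Phi> y) = y" by (rule inverse[OF h\<Psi> h\<Phi> no_const\<phi> \<psi>\<phi>])
    fix j
    have "has_taylor (\<lambda>y. \<Phi> y $ j - y $ j) (coef (\<phi> j))"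
      using ht_diff[OF h\<Phi>[of j] ht_Y[of j]] by simp
    moreover have "\<forall>m. coef (\<phi> j) m \<noteq> 0 \<longrightarrow> mdeg m \<ge> 2 \<and> \<not> resonant_monomial (eigenvalue_tuple A) m j"
    proof (intro allI impI)
      fix m assume "coef (\<phi> j) m \<noteq> 0"
      from \<phi>[OF this] show "mdeg m \<ge> 2 \<and> \<not> resonant_monomial (eigenvalue_tuple A) m j"
        unfolding resonant_monomial_def lam(1)[symmetric] by auto
    qed
    ultimately show "\<exists>c. has_taylor (\<lambda>y. \<Phi> y $ j - y $ j) c \<and>
           (\<forall>m. c m \<noteq> 0 \<longrightarrow> mdeg m \<ge> 2 \<and> \<not> resonant_monomial (eigenvalue_tuple A) m j)" by blast
  qed
  have nf: "\<forall>\<^sub>F y in nhds 0. \<forall>i. (A *v y + h y) $ i = lam $ i * y $ i * (1 + eval g y)"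
  proof (rule eventually_all_finite)
    fix i
    have "has_taylor (\<lambda>y. lam $ i * y $ i) (coef (diagf lam i))"
      unfolding diagf_def by (intro ht_cst_mult ht_Y)
    hence "\<forall>\<^sub>F y in nhds 0. (A *v y) $ i = lam $ i * y $ i"
      using ht_eventually_eq[OF linA[of i, unfolded Adiag]] by blast
    thus "\<forall>\<^sub>F y in nhds 0. (A *v y + h y) $ i = lam $ i * y $ i * (1 + eval g y)"
      by eventually_elim (simp add: h_def algebra_simps)
  qed
  have "eval g 0 = 0" using ht_at_0[OF ht_eval[OF conv(2)]] g[of 0] by auto
  moreover have "analytic_function_of_monomials (basic_exponents lam) (eval g)"
    using g conv(2) by (intro analytic_function_of_basic_monomials) auto
  ultimately show ?thesis using rank dist nf by blast
qed

theorem theorem3: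
  fixes A :: "complex ^ 'n::{finite,wellorder} ^ 'n::{finite,wellorder}"
    and f :: "complex ^ 'n::{finite,wellorder} \<Rightarrow> complex ^ 'n::{finite,wellorder}"
    and lam :: "complex ^ 'n::{finite,wellorder}"
  assumes "CARD('n) \<ge> 2"
    and "lower_jordan A"
    and "analytic0_map f"
    and "higher_order f"
    and "lam = eigenvalue_tuple A"
    and "lam \<noteq> 0"
  shows "(\<exists>H. (\<forall>k < CARD('n) - 1. analytic_first_integral A f (H k)) \<and>
              functionally_independent (CARD('n) - 1) H)
     \<longleftrightarrow>
     (resonant_rank lam = CARD('n) - 1 \<and>
      (\<exists>\<Psi> h g. distinguished_normalization A f h \<Psi> \<and>
         (\<forall>\<^sub>F y in nhds 0. \<forall>i. (A *v y + h y) $ i = lam $ i * y $ i * (1 + g y)) \<and>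
         g 0 = 0 \<and>
         analytic_function_of_monomials (basic_exponents lam) g))"
proof
  assume "\<exists>H. (\<forall>k < CARD('n) - 1. analytic_first_integral A f (H k)) \<and>
      functionally_independent (CARD('n) - 1) H"
  thus "resonant_rank lam = CARD('n) - 1 \<and>
      (\<exists>\<Psi> h g. distinguished_normalization A f h \<Psi> \<and>
         (\<forall>\<^sub>F y in nhds 0. \<forall>i. (A *v y + h y) $ i = lam $ i * y $ i * (1 + g y)) \<and>
         g 0 = 0 \<and>
         analytic_function_of_monomials (basic_exponents lam) g)"
    using normal_form_of_first_integrals[OF assms(2-6)] by blast
next
  assume "resonant_rank lam = CARD('n) - 1 \<and>
      (\<exists>\<Psi> h g. distinguished_normalization A f h \<Psi> \<and>
         (\<forall>\<^sub>F y in nhds 0. \<forall>i. (A *v y + h y) $ i = lam $ i * y $ i * (1 + g y)) \<and>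
         g 0 = 0 \<and>
         analytic_function_of_monomials (basic_exponents lam) g)"
  thus "\<exists>H. (\<forall>k < CARD('n) - 1. analytic_first_integral A f (H k)) \<and>
      functionally_independent (CARD('n) - 1) H"
    using first_integrals_of_normal_form unfolding distinguished_normalization_def by blast
qed

end
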